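(* Let $u\in H^1(\Omega)$ with $\Omega=\Omega_1\times\cdots\times\Omega_d$. For $1\le j\le d$ let $U^{\min}_j(u)\subset H^1(\Omega_j)$ be the $j$-th minimal subspace of $u$ and let $P^j:H^1(\Omega_j)\to U_j^{\min}(u)$ be the ($H^1(\Omega_j)$-)orthogonal projection. Assume that each $P^j$ is continuous in $L^2$, i.e. $$\sup_{v_j\in H^1(\Omega_j),\,v_j\ne0}\frac{\|P^jv_j\|_0}{\|v_j\|_0}<\infty,\qquad 1\le j\le d.$$ Then $$u\in{}_{\|\cdot\|_1}\bigotimes_{j=1}^dU^{\min}_j(u),$$ i.e. $u$ belongs to the closure in $H^1(\Omega)$ of the algebraic tensor product ${}_a\bigotimes_{j=1}^dU^{\min}_j(u)$.
   Context: $\Omega_1,\dots,\Omega_d\subset\mathbb R$ are domains (open intervals) and $\Omega=\Omega_1\times\cdots\times\Omega_d$. $\|\cdot\|_0$ denotes the $L^2$-norm and $\|\cdot\|_1$ the $H^1$-norm, both on $\Omega$ and on each $\Omega_j$. ${}_a\bigotimes_{j}X_j$ denotes the algebraic tensor product (finite sums of elementary tensors, without completion), with $(\bigotimes_jv_j)(x_1,\dots,x_d)=\prod_jv_j(x_j)$, and ${}_{\|\cdot\|}\bigotimes_jX_j$ is its completion (closure) with respect to $\|\cdot\|$. For $u\in H^1(\Omega)$ and $1\le j\le d$, $$U^j(u):=\operatorname{span}\Big\{\varphi(u):\varphi=\bigotimes_{k=1}^d\varphi_k,\ \varphi_j=\operatorname{id}_j,\ \varphi_k\in(L^2(\Omega_k))^*\text{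 for }k\ne j\Big\},$$ where $\operatorname{id}_j$ is the identity; i.e. if $\varphi_k=\langle\cdot,g_k\rangle_{L^2(\Omega_k)}$, then $\varphi(u)(x_j)=\int u(x)\prod_{k\ne j}g_k(x_k)\prod_{k\neq j}dx_k$. One has $U^j(u)\subset H^1(\Omega_j)$. The $j$-th minimal subspace is $U^{\min}_j(u):=\overline{U^j(u)}^{\|\cdot\|_1}\subset H^1(\Omega_j)$, the closure in $H^1(\Omega_j)$. *)

theory Defs
  imports "HOL-Analysis.Analysis"
begin

text \<open>
  Elements of \<open>L\<^sup>2(\<Omega>)\<close> and \<open>H\<^sup>1(\<Omega>)\<close> are represented by real functions on the ambient space whose
  values outside \<open>\<Omega>\<close> are irrelevant; functions that agree almost everywhere on \<open>\<Omega>\<close> represent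
  the same element, so norms and inner products are positive semidefinite on representatives.
  Representatives are Borel measurable: every class of Lebesgue measurable functions contains one.
  The definitions for a general Euclidean space serve both for the intervals in \<open>\<real>\<close> and for
  their product in \<open>real ^ 'd\<close>.
\<close>

definition L2 :: "'a::euclidean_space set \<Rightarrow> ('a \<Rightarrow> real) set" where
  "L2 \<Omega> = {f. set_borel_measurable lborel \<Omega> f \<and> set_integrable lborel \<Omega> (\<lambda>x. (f x)\<^sup>2)}"

definition L2_inner :: "'a::euclidean_space set \<Rightarrow> ('a \<Rightarrow> real) \<Rightarrow> ('a \<Rightarrow> real) \<Rightarrow> real" where
  "L2_inner \<Omega> f g = (LINT x:\<Omega>|lborel. f x * g x)"

definition L2_norm :: "'a::euclidean_space set \<Rightarrow> ('a \<Rightarrow> real) \<Rightarrow> real" where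
  "L2_norm \<Omega> f = sqrt (L2_inner \<Omega> f f)"

definition partial :: "'a::euclidean_space \<Rightarrow> ('a \<Rightarrow> real) \<Rightarrow> 'a \<Rightarrow> real" where
  "partial b f x = frechet_derivative f (at x) b"

primrec times_cont_diff :: "nat \<Rightarrow> ('a::euclidean_space \<Rightarrow> real) \<Rightarrow> bool" where
  "times_cont_diff 0 f \<longleftrightarrow> continuous_on UNIV f"
| "times_cont_diff (Suc n) f \<longleftrightarrow>
     (\<forall>x. f differentiable (at x)) \<and> (\<forall>b\<in>Basis. times_cont_diff n (partial b f))"

text \<open>The space \<open>C\<^sub>c\<^sup>\<infinity>(\<Omega>)\<close>, with each function extended by zero to the whole space.\<close>

definition test_functions :: "'a::euclidean_space set \<Rightarrow> ('a \<Rightarrow> real) set" where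
  "test_functions \<Omega> =
     {\<phi>. (\<forall>n. times_cont_diff n \<phi>) \<and>
         compact (closure {x. \<phi> x \<noteq> 0}) \<and> closure {x. \<phi> x \<noteq> 0} \<subseteq> \<Omega>}"

definition has_weak_partial ::
  "'a::euclidean_space set \<Rightarrow> 'a \<Rightarrow> ('a \<Rightarrow> real) \<Rightarrow> ('a \<Rightarrow> real) \<Rightarrow> bool" where
  "has_weak_partial \<Omega> b f g \<longleftrightarrow>
     (\<forall>\<phi>\<in>test_functions \<Omega>.
        (LINT x:\<Omega>|lborel. f x * partial b \<phi> x) = - (LINT x:\<Omega>|lborel. g x * \<phi> x))"

definition H1 :: "'a::euclidean_space set \<Rightarrow> ('a \<Rightarrow> real) set" where
  "H1 \<Omega> = {f \<in> L2 \<Omega>. \<forall>b\<in>Basis. \<exists>g\<in>L2 \<Omega>. has_weak_partial \<Omega> b f g}"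

text \<open>For open \<open>\<Omega>\<close> the weak partial derivative is unique up to null sets; an arbitrary
  representative is chosen.\<close>

definition weak_partial :: "'a::euclidean_space set \<Rightarrow> 'a \<Rightarrow> ('a \<Rightarrow> real) \<Rightarrow> 'a \<Rightarrow> real" where
  "weak_partial \<Omega> b f = (SOME g. g \<in> L2 \<Omega> \<and> has_weak_partial \<Omega> b f g)"

definition H1_inner :: "'a::euclidean_space set \<Rightarrow> ('a \<Rightarrow> real) \<Rightarrow> ('a \<Rightarrow> real) \<Rightarrow> real" where
  "H1_inner \<Omega> f g =
     L2_inner \<Omega> f g + (\<Sum>b\<in>Basis. L2_inner \<Omega> (weak_partial \<Omega> b f) (weak_partial \<Omega> b g))"

definition H1_norm :: "'a::euclidean_space set \<Rightarrow> ('a \<Rightarrow> real) \<Rightarrow> real" where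
  "H1_norm \<Omega> f = sqrt (H1_inner \<Omega> f f)"

text \<open>Closure in \<open>H\<^sup>1(\<Omega>)\<close>. The norm is only meaningful on \<open>H1 \<Omega>\<close>, hence the intersection.\<close>

definition H1_closure :: "'a::euclidean_space set \<Rightarrow> ('a \<Rightarrow> real) set \<Rightarrow> ('a \<Rightarrow> real) set" where
  "H1_closure \<Omega> S =
     {f \<in> H1 \<Omega>. \<forall>\<epsilon>>0. \<exists>g\<in>S \<inter> H1 \<Omega>. H1_norm \<Omega> (\<lambda>x. f x - g x) < \<epsilon>}"

definition H1_orthogonal_projection ::
  "'a::euclidean_space set \<Rightarrow> ('a \<Rightarrow> real) set \<Rightarrow> (('a \<Rightarrow> real) \<Rightarrow> 'a \<Rightarrow> real) \<Rightarrow> bool" where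
  "H1_orthogonal_projection \<Omega> V P \<longleftrightarrow>
     (\<forall>v\<in>H1 \<Omega>. P v \<in> V \<and> (\<forall>w\<in>V. H1_inner \<Omega> (\<lambda>x. v x - P v x) w = 0))"

definition fun_span :: "('a \<Rightarrow> real) set \<Rightarrow> ('a \<Rightarrow> real) set" where
  "fun_span S =
     {f. \<exists>(n::nat) c s. (\<forall>i<n. s i \<in> S) \<and> f = (\<lambda>x. \<Sum>i<n. c i * s i x)}"

definition product_domain :: "('d::finite \<Rightarrow> real set) \<Rightarrow> (real ^ 'd) set" where
  "product_domain \<Omega> = {x. \<forall>k. x $ k \<in> \<Omega> k}"

definition elementary_tensor :: "('d::finite \<Rightarrow> real \<Rightarrow> real) \<Rightarrow> real ^ 'd \<Rightarrow> real" where
  "elementary_tensor v x = (\<Prod>k\<in>UNIV. v k (x $ k))"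

definition algebraic_tensor :: "('d::finite \<Rightarrow> (real \<Rightarrow> real) set) \<Rightarrow> (real ^ 'd \<Rightarrow> real) set" where
  "algebraic_tensor X = fun_span {elementary_tensor v |v. \<forall>k. v k \<in> X k}"

text \<open>
  The value at \<open>u\<close> of the functional \<open>\<Otimes>\<^sub>k \<phi>\<^sub>k\<close> with \<open>\<phi>\<^sub>j = id\<close> and \<open>\<phi>\<^sub>k = \<langle>\<cdot>, g\<^sub>k\<rangle>\<close> in \<open>L\<^sup>2(\<Omega>\<^sub>k)\<close>
  for \<open>k \<noteq> j\<close>; by the Riesz representation these are all elements of the dual space. The
  integrand is integrable for almost every \<open>t\<close>, and \<open>g j\<close> is not used.
\<close>

definition partial_contraction ::
  "('d::finite \<Rightarrow> real set) \<Rightarrow> 'd \<Rightarrow> ('d \<Rightarrow> real \<Rightarrow> real) \<Rightarrow> (real ^ 'd \<Rightarrow> real) \<Rightarrow> real \<Rightarrow> real" where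
  "partial_contraction \<Omega> j g u t =
     (LINT y:(\<Pi>\<^sub>E k\<in>UNIV - {j}. \<Omega> k)|(\<Pi>\<^sub>M k\<in>UNIV - {j}. lborel).
        u (\<chi> k. if k = j then t else y k) * (\<Prod>k\<in>UNIV - {j}. g k (y k)))"

definition U_span ::
  "('d::finite \<Rightarrow> real set) \<Rightarrow> 'd \<Rightarrow> (real ^ 'd \<Rightarrow> real) \<Rightarrow> (real \<Rightarrow> real) set" where
  "U_span \<Omega> j u =
     fun_span {partial_contraction \<Omega> j g u |g. \<forall>k. k \<noteq> j \<longrightarrow> g k \<in> L2 (\<Omega> k)}"

definition U_min ::
  "('d::finite \<Rightarrow> real set) \<Rightarrow> 'd \<Rightarrow> (real ^ 'd \<Rightarrow> real) \<Rightarrow> (real \<Rightarrow> real) set" where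
  "U_min \<Omega> j u = H1_closure (\<Omega> j) (U_span \<Omega> j u)"

end

theory Submission
  imports Defs
begin

text \<open>
  Fix a direction \<open>j\<close> and let \<open>M g\<close> be the contraction of \<open>u\<close> with \<open>g \<in> L\<^sup>2\<close> of the other variables, so
  that \<open>M g\<close> lies in \<open>U_span\<close> when \<open>g\<close> is a finite sum of elementary tensors. The operators
  \<open>A = 1 - (1 - \<kappa> M M\<^sup>*)\<^sup>n\<close>, acting on the \<open>j\<close>-th variable, have norm at most 2 in \<open>L\<^sup>2\<close> and
  \<open>A u\<close> tends to \<open>u\<close>. Since \<open>p(M M\<^sup>*) M = M p(M\<^sup>* M)\<close> for polynomials \<open>p\<close>, applying \<open>A\<close> to \<open>u\<close> is the
  same as applying a bounded operator to the other variables, which commutes with \<open>\<partial>\<^sub>j\<close>; hence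
  \<open>\<partial>\<^sub>j A u\<close> is bounded by a multiple of \<open>\<partial>\<^sub>j u\<close>, uniformly in \<open>n\<close>. To have finite rank, \<open>M\<close> is
  restricted to the span of finitely many orthonormal \<open>f\<^sub>m\<close>, chosen so large (depending on \<open>n\<close>) that
  the error is negligible. The operators for different directions commute with each other and with the
  derivatives in the other directions, so applying all of them to an \<open>L\<^sup>2\<close>-approximation of \<open>u\<close> by a
  sum of elementary tensors gives elements of the algebraic tensor product that are bounded in \<open>H\<^sup>1\<close>
  and converge to \<open>u\<close> in \<open>L\<^sup>2\<close>, hence weakly in \<open>H\<^sup>1\<close>.
\<close>

subsection \<open>Function spaces with a semidefinite inner product\<close>

text \<open>The polynomial in \<open>A\<close> is there to avoid inverse singular values of
  \<open>M\<close>. The orthogonal projection onto finitely many contractions of \<open>u\<close>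
  also fixes most of \<open>u\<close>, but its coefficients involve such inverses, which have no
  common bound, and on an approximation of \<open>u\<close> they would multiply the derivative. In
  \<open>A\<close> they are replaced by a polynomial of norm at most \<open>\<kappa> * n\<close>, a
  fixed number once \<open>n\<close> is fixed. The order of the choices is the crux: finitely many
  contractions that carry most of \<open>u\<close> determine \<open>n\<close>, and \<open>n\<close>
  determines how many more are added. The additions do not disturb the choice of \<open>n\<close>,
  because the residual of each single contraction is at most \<open>1 / sqrt (n * \<kappa>)\<close>
  however many there are, and \<kappa> depends on the norm of \<open>u\<close> alone. The derivative
  in the direction of \<open>A\<close> gets the factor 3, of which 2 comes from the exact
  commutation and 1 from the truncation error. Weak convergence is enough at the end because a weak
  limit of points of a convex set is a strong limit of points of that set.\<close>

definition ip_norm :: "(('a \<Rightarrow> real) \<Rightarrow> ('a \<Rightarrow> real) \<Rightarrow> real) \<Rightarrow> ('a \<Rightarrow> real) \<Rightarrow> real" where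
  "ip_norm ip f = sqrt (ip f f)"

locale fun_subspace =
  fixes V :: "('a \<Rightarrow> real) set"
  assumes zero: "(\<lambda>x. 0) \<in> V"
    and add: "f \<in> V \<Longrightarrow> g \<in> V \<Longrightarrow> (\<lambda>x. f x + g x) \<in> V"
    and scale: "f \<in> V \<Longrightarrow> (\<lambda>x. c * f x) \<in> V"
begin

lemma diff: "f \<in> V \<Longrightarrow> g \<in> V \<Longrightarrow> (\<lambda>x. f x - g x) \<in> V"
  using add[of f "\<lambda>x. -1 * g x"] scale[of g "-1"] by simp

lemma sum: "finite I \<Longrightarrow> (\<And>i. i \<in> I \<Longrightarrow> f i \<in> V) \<Longrightarrow> (\<lambda>x. \<Sum>i\<in>I. f i x) \<in> V"
  by (induction I rule: finite_induct) (auto simp: zero intro: add)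

lemma lincomb:
  "(\<And>i. i < (n::nat) \<Longrightarrow> f i \<in> V) \<Longrightarrow> (\<lambda>x. \<Sum>i<n. c i * f i x) \<in> V"
  by (intro sum scale) auto

end

locale psd_space = fun_subspace V for V :: "('a \<Rightarrow> real) set" +
  fixes ip :: "('a \<Rightarrow> real) \<Rightarrow> ('a \<Rightarrow> real) \<Rightarrow> real"
  assumes ip_add: "f \<in> V \<Longrightarrow> g \<in> V \<Longrightarrow> h \<in> V \<Longrightarrow> ip (\<lambda>x. f x + g x) h = ip f h + ip g h"
    and ip_scale: "f \<in> V \<Longrightarrow> h \<in> V \<Longrightarrow> ip (\<lambda>x. c * f x) h = c * ip f h"
    and ip_sym: "f \<in> V \<Longrightarrow> g \<in> V \<Longrightarrow> ip f g = ip g f"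
    and ip_nonneg: "f \<in> V \<Longrightarrow> 0 \<le> ip f f"
begin

abbreviation "nrm \<equiv> ip_norm ip"

lemma ip_zero: "f \<in> V \<Longrightarrow> ip (\<lambda>x. 0) f = 0"
  using ip_scale[of "\<lambda>x. 0" f 0] zero by simp

lemma ip_diff: "f \<in> V \<Longrightarrow> g \<in> V \<Longrightarrow> h \<in> V \<Longrightarrow> ip (\<lambda>x. f x - g x) h = ip f h - ip g h"
  using ip_add[of f "\<lambda>x. -1 * g x" h] ip_scale[of g h "-1"] scale[of g "-1"] by simp

lemma ip_add_right: "f \<in> V \<Longrightarrow> g \<in> V \<Longrightarrow> h \<in> V \<Longrightarrow> ip h (\<lambda>x. f x + g x) = ip h f + ip h g"
  using ip_sym[of h "\<lambda>x. f x + g x"] ip_sym[of h f] ip_sym[of h g] by (simp add: add ip_add)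

lemma ip_diff_right: "f \<in> V \<Longrightarrow> g \<in> V \<Longrightarrow> h \<in> V \<Longrightarrow> ip h (\<lambda>x. f x - g x) = ip h f - ip h g"
  using ip_sym[of h "\<lambda>x. f x - g x"] ip_sym[of h f] ip_sym[of h g] by (simp add: diff ip_diff)

lemma ip_scale_right: "f \<in> V \<Longrightarrow> h \<in> V \<Longrightarrow> ip h (\<lambda>x. c * f x) = c * ip h f"
  using ip_sym[of h "\<lambda>x. c * f x"] ip_sym[of h f] by (simp add: scale ip_scale)

lemma ip_sum:
  "finite I \<Longrightarrow> (\<And>i. i \<in> I \<Longrightarrow> f i \<in> V) \<Longrightarrow> h \<in> V \<Longrightarrow> ip (\<lambda>x. \<Sum>i\<in>I. f i x) h = (\<Sum>i\<in>I. ip (f i) h)"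
  by (induction I rule: finite_induct) (auto simp: ip_zero ip_add sum)

lemma ip_lincomb:
  "(\<And>i. i < (n::nat) \<Longrightarrow> f i \<in> V) \<Longrightarrow> h \<in> V \<Longrightarrow> ip (\<lambda>x. \<Sum>i<n. c i * f i x) h = (\<Sum>i<n. c i * ip (f i) h)"
  by (subst ip_sum) (auto simp: ip_scale scale)

lemma ip_lincomb_right:
  "(\<And>i. i < (n::nat) \<Longrightarrow> f i \<in> V) \<Longrightarrow> h \<in> V \<Longrightarrow> ip h (\<lambda>x. \<Sum>i<n. c i * f i x) = (\<Sum>i<n. c i * ip h (f i))"
  by (subst ip_sym) (auto simp: ip_lincomb lincomb ip_sym intro!: sum.cong)

lemma nrm_sq: "f \<in> V \<Longrightarrow> (nrm f)\<^sup>2 = ip f f"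
  by (simp add: ip_norm_def ip_nonneg)

lemma nrm_nonneg: "f \<in> V \<Longrightarrow> 0 \<le> nrm f"
  by (simp add: ip_norm_def ip_nonneg)

lemma nrm_zero: "nrm (\<lambda>x. 0) = 0"
  by (simp add: ip_norm_def ip_zero zero)

lemma nrm_scale: "f \<in> V \<Longrightarrow> nrm (\<lambda>x. c * f x) = \<bar>c\<bar> * nrm f"
  by (simp add: ip_norm_def ip_scale ip_scale_right scale mult.assoc[symmetric] real_sqrt_mult)

lemma ip_add_self:
  "f \<in> V \<Longrightarrow> g \<in> V \<Longrightarrow> ip (\<lambda>x. f x + g x) (\<lambda>x. f x + g x) = ip f f + 2 * ip f g + ip g g"
  by (simp add: ip_add ip_add_right add ip_sym)

lemma ip_diff_self:
  "f \<in> V \<Longrightarrow> g \<in> V \<Longrightarrow> ip (\<lambda>x. f x - g x) (\<lambda>x. f x - g x) = ip f f - 2 * ip f g + ip g g"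
  by (simp add: ip_diff ip_diff_right diff ip_sym)

lemma Cauchy_Schwarz: assumes "f \<in> V" "g \<in> V" shows "\<bar>ip f g\<bar> \<le> nrm f * nrm g"
proof -
  have q: "0 \<le> ip f f - 2 * t * ip f g + t\<^sup>2 * ip g g" for t
    using ip_nonneg[OF diff[OF assms(1) scale[OF assms(2), of t]]] assms
    by (simp add: ip_diff_self scale ip_scale ip_scale_right power2_eq_square)
  have "(ip f g)\<^sup>2 \<le> ip f f * ip g g"
  proof (cases "ip g g = 0")
    case True
    have "ip f g = 0"
    proof (rule ccontr)
      assume "ip f g \<noteq> 0"
      \<comment> \<open>With \<open>ip g g = 0\<close> the quadratic in \<open>q\<close> is affine
        in \<open>t\<close>; at this \<open>t\<close> its value is -1.\<close>
      then show False
        using q[of "(ip f f + 1) / (2 * ip f g)"] True by simp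
    qed
    then show ?thesis by (simp add: True)
  next
    case False
    then have "0 < ip g g" using ip_nonneg[OF assms(2)] by simp
    then show ?thesis using q[of "ip f g / ip g g"]
      by (simp add: field_simps power2_eq_square)
  qed
  also have "\<dots> = (nrm f * nrm g)\<^sup>2" by (simp add: power_mult_distrib nrm_sq assms)
  finally show ?thesis
    using abs_le_square_iff[of "ip f g" "nrm f * nrm g"] nrm_nonneg assms by simp
qed

lemma triangle: assumes "f \<in> V" "g \<in> V" shows "nrm (\<lambda>x. f x + g x) \<le> nrm f + nrm g"
proof (rule power2_le_imp_le)
  have "(nrm (\<lambda>x. f x + g x))\<^sup>2 = ip f f + 2 * ip f g + ip g g"
    using assms by (simp add: nrm_sq add ip_add_self)
  also have "\<dots> \<le> (nrm f)\<^sup>2 + 2 * (nrm f * nrm g) + (nrm g)\<^sup>2"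
    using Cauchy_Schwarz[OF assms] by (simp add: nrm_sq assms)
  finally show "(nrm (\<lambda>x. f x + g x))\<^sup>2 \<le> (nrm f + nrm g)\<^sup>2" by (simp add: power2_sum algebra_simps)
qed (simp add: nrm_nonneg assms)

lemma triangle_diff: assumes "f \<in> V" "g \<in> V" shows "nrm (\<lambda>x. f x - g x) \<le> nrm f + nrm g"
  using triangle[OF assms(1) scale[OF assms(2), of "-1"]] nrm_scale[OF assms(2), of "-1"] by simp

lemma nrm_diff_commute: "f \<in> V \<Longrightarrow> g \<in> V \<Longrightarrow> nrm (\<lambda>x. f x - g x) = nrm (\<lambda>x. g x - f x)"
  using nrm_scale[OF diff, of f g "-1"] by simp

lemma nrm_sum_le:
  "finite I \<Longrightarrow> (\<And>i. i \<in> I \<Longrightarrow> f i \<in> V) \<Longrightarrow> nrm (\<lambda>x. \<Sum>i\<in>I. f i x) \<le> (\<Sum>i\<in>I. nrm (f i))"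
proof (induction I rule: finite_induct)
  case (insert i I)
  then show ?case using triangle[of "f i" "\<lambda>x. \<Sum>i\<in>I. f i x"] sum[of I f] by fastforce
qed (simp add: nrm_zero)

lemma nrm_lincomb_le:
  assumes "\<And>i. i < (n::nat) \<Longrightarrow> f i \<in> V"
  shows "(nrm (\<lambda>x. \<Sum>i<n. c i * f i x))\<^sup>2 \<le> (\<Sum>i<n. (c i)\<^sup>2) * (\<Sum>i<n. ip (f i) (f i))"
proof -
  have "nrm (\<lambda>x. \<Sum>i<n. c i * f i x) \<le> (\<Sum>i<n. \<bar>c i\<bar> * nrm (f i))"
    using nrm_sum_le[of "{..<n}" "\<lambda>i x. c i * f i x"] assms by (simp add: scale nrm_scale)
  then have "(nrm (\<lambda>x. \<Sum>i<n. c i * f i x))\<^sup>2 \<le> (\<Sum>i<n. \<bar>c i\<bar> * nrm (f i))\<^sup>2"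
    by (intro power_mono nrm_nonneg lincomb assms)
  also have "\<dots> \<le> (\<Sum>i<n. \<bar>c i\<bar>\<^sup>2) * (\<Sum>i<n. (nrm (f i))\<^sup>2)"
    by (rule Cauchy_Schwarz_ineq_sum)
  finally show ?thesis by (simp add: nrm_sq assms)
qed

definition orthonormal :: "nat \<Rightarrow> (nat \<Rightarrow> 'a \<Rightarrow> real) \<Rightarrow> bool" where
  "orthonormal n h \<longleftrightarrow> (\<forall>i<n. h i \<in> V) \<and> (\<forall>i<n. \<forall>j<n. ip (h i) (h j) = (if i = j then 1 else 0))"

definition proj_residual :: "nat \<Rightarrow> (nat \<Rightarrow> 'a \<Rightarrow> real) \<Rightarrow> ('a \<Rightarrow> real) \<Rightarrow> 'a \<Rightarrow> real" where
  "proj_residual n h f = (\<lambda>x. f x - (\<Sum>i<n. ip f (h i) * h i x))"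

lemma orthonormalD: "orthonormal n h \<Longrightarrow> i < n \<Longrightarrow> h i \<in> V"
  by (simp add: orthonormal_def)

lemma orthonormal_ip: "orthonormal n h \<Longrightarrow> i < n \<Longrightarrow> j < n \<Longrightarrow> ip (h i) (h j) = (if i = j then 1 else 0)"
  by (simp add: orthonormal_def)

lemma orthonormal_lincomb_ip:
  assumes "orthonormal n h" "j < n"
  shows "ip (\<lambda>x. \<Sum>i<n. c i * h i x) (h j) = c j"
proof -
  have "ip (\<lambda>x. \<Sum>i<n. c i * h i x) (h j) = (\<Sum>i<n. c i * (if i = j then 1 else 0))"
    using assms by (subst ip_lincomb) (auto simp: orthonormalD orthonormal_ip intro!: sum.cong)
  also have "\<dots> = (\<Sum>i<n. if i = j then c j else 0)" by (intro sum.cong) auto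
  finally have "ip (\<lambda>x. \<Sum>i<n. c i * h i x) (h j) = (\<Sum>i<n. if i = j then c j else 0)" .
  with assms(2) show ?thesis by simp
qed

lemma orthonormal_lincomb_ip_self:
  assumes "orthonormal n h"
  shows "ip (\<lambda>x. \<Sum>i<n. c i * h i x) (\<lambda>x. \<Sum>i<n. c i * h i x) = (\<Sum>i<n. (c i)\<^sup>2)"
proof -
  have "ip (\<lambda>x. \<Sum>i<n. c i * h i x) (\<lambda>x. \<Sum>i<n. c i * h i x)
      = (\<Sum>j<n. c j * ip (\<lambda>x. \<Sum>i<n. c i * h i x) (h j))"
    using assms by (subst ip_lincomb_right) (auto intro!: lincomb simp: orthonormalD)
  then show ?thesis using assms by (simp add: orthonormal_lincomb_ip power2_eq_square)
qed

lemma proj_residual_in: "orthonormal n h \<Longrightarrow> f \<in> V \<Longrightarrow> proj_residual n h f \<in> V"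
  unfolding proj_residual_def by (intro diff lincomb) (auto simp: orthonormalD)

lemma proj_residual_sq:
  assumes "orthonormal n h" "f \<in> V"
  shows "(nrm (proj_residual n h f))\<^sup>2 = ip f f - (\<Sum>i<n. (ip f (h i))\<^sup>2)"
proof -
  have in_V: "(\<lambda>x. \<Sum>i<n. ip f (h i) * h i x) \<in> V"
    using assms by (intro lincomb) (auto simp: orthonormalD)
  have "ip f (\<lambda>x. \<Sum>i<n. ip f (h i) * h i x) = (\<Sum>i<n. (ip f (h i))\<^sup>2)"
    using assms by (subst ip_lincomb_right) (auto simp: orthonormalD power2_eq_square)
  with orthonormal_lincomb_ip_self[OF assms(1)] show ?thesis
    using nrm_sq[OF proj_residual_in[OF assms]] assms in_V
    by (simp add: proj_residual_def ip_diff_self)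
qed

lemma Bessel: "orthonormal n h \<Longrightarrow> f \<in> V \<Longrightarrow> (\<Sum>i<n. (ip f (h i))\<^sup>2) \<le> ip f f"
  using proj_residual_sq[of n h f] zero_le_power2[of "nrm (proj_residual n h f)"] by linarith

lemma proj_residual_le: "orthonormal n h \<Longrightarrow> f \<in> V \<Longrightarrow> nrm (proj_residual n h f) \<le> nrm f"
  by (rule power2_le_imp_le) (auto simp: proj_residual_sq nrm_sq nrm_nonneg sum_nonneg)

lemma proj_residual_ip_zero:
  assumes "orthonormal n h" "f \<in> V" "j < n"
  shows "ip (proj_residual n h f) (h j) = 0"
proof -
  have "ip (\<lambda>x. \<Sum>i<n. ip f (h i) * h i x) (h j) = ip f (h j)"
    using assms by (intro orthonormal_lincomb_ip) auto
  moreover have "(\<lambda>x. \<Sum>i<n. ip f (h i) * h i x) \<in> V"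
    using assms by (intro lincomb) (auto simp: orthonormalD)
  ultimately show ?thesis
    unfolding proj_residual_def using assms by (simp add: ip_diff orthonormalD)
qed

text \<open>A null residual means that \<open>f\<close> is in the span already, up to a null vector;
  otherwise the normalised residual is appended. The old vectors are kept as they are, because a
  family fixed earlier has to be extended later, and \<open>W\<close> keeps the new vectors inside a
  smaller space of regular functions.\<close>

lemma Gram_Schmidt_step:
  assumes "orthonormal n h" "\<And>i. i < n \<Longrightarrow> h i \<in> W" "f \<in> W" "W \<subseteq> V" "fun_subspace W"
  shows "\<exists>m\<ge>n. \<exists>h'. (\<forall>i<n. h' i = h i) \<and> orthonormal m h' \<and> (\<forall>i<m. h' i \<in> W)
           \<and> nrm (proj_residual m h' f) = 0"
proof (cases "nrm (proj_residual n h f) = 0")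
  case True
  then show ?thesis using assms by (intro exI[of _ n] exI[of _ h]) auto
next
  case False
  interpret W: fun_subspace W by fact
  define r where "r = proj_residual n h f"
  define h' where "h' = h(n := \<lambda>x. (1 / nrm r) * r x)"
  have f: "f \<in> V" using assms by auto
  have r: "r \<in> V" unfolding r_def by (rule proj_residual_in[OF assms(1) f])
  have rpos: "nrm r \<noteq> 0" using False by (simp add: r_def)
  have rW: "r \<in> W" unfolding r_def proj_residual_def using assms by (intro W.diff W.lincomb) auto
  have hn: "h' n \<in> V" using scale[OF r, of "1 / nrm r"] by (simp add: h'_def)
  have hn_ip: "ip (h' n) (h i) = 0" if "i < n" for i
    using that proj_residual_ip_zero[OF assms(1) f that] orthonormalD[OF assms(1) that] r
    using ip_scale[OF r, of "h i" "1 / nrm r"] by (simp add: h'_def r_def)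
  have hn1: "ip (h' n) (h' n) = 1"
    using nrm_sq[OF hn] nrm_scale[OF r, of "1 / nrm r"] rpos nrm_nonneg[OF r] by (simp add: h'_def)
  have on: "orthonormal (Suc n) h'"
    using assms(1) hn hn_ip hn1
    by (auto simp: orthonormal_def less_Suc_eq ip_sym h'_def)
  \<comment> \<open>\<open>f\<close> and its residual \<open>r\<close> differ by a combination of
    the old vectors, which are orthogonal to the new one. The new coefficient is therefore
    \<open>nrm r\<close>, and the squared residual drops by exactly
    \<open>(nrm r)\<^sup>2\<close>.\<close>
  have "ip f (h' n) = ip r (h' n)"
  proof -
    have "ip (\<lambda>x. \<Sum>i<n. ip f (h i) * h i x) (h' n) = 0"
      using hn_ip hn assms(1) by (subst ip_lincomb) (auto simp: orthonormalD ip_sym intro!: sum.neutral)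
    then show ?thesis
      unfolding r_def proj_residual_def
      using hn f assms(1) by (subst ip_diff) (auto intro!: lincomb simp: orthonormalD)
  qed
  also have "\<dots> = nrm r"
    using ip_scale_right[OF r r, of "1 / nrm r"] rpos nrm_sq[OF r, symmetric]
    by (simp add: h'_def power2_eq_square)
  finally have "(nrm (proj_residual (Suc n) h' f))\<^sup>2 = 0"
    using proj_residual_sq[OF on f] proj_residual_sq[OF assms(1) f] by (simp add: h'_def r_def)
  moreover have "h' i \<in> W" if "i < Suc n" for i
    using that assms(2) rW by (auto simp: h'_def less_Suc_eq intro: W.scale[of r "1 / nrm r", simplified])
  ultimately show ?thesis
    using on by (intro exI[of _ "Suc n"] conjI exI[of _ h']) (auto simp: h'_def)
qed

text \<open>Enlarging an orthonormal family can only increase the sum in Bessel's inequality, so a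
  residual that is null stays null while the remaining vectors are treated.\<close>

lemma Gram_Schmidt_extend:
  assumes "orthonormal n h" "\<And>i. i < n \<Longrightarrow> h i \<in> W" "set fs \<subseteq> W" "W \<subseteq> V" "fun_subspace W"
  shows "\<exists>m\<ge>n. \<exists>h'. (\<forall>i<n. h' i = h i) \<and> orthonormal m h' \<and> (\<forall>i<m. h' i \<in> W)
           \<and> (\<forall>f\<in>set fs. nrm (proj_residual m h' f) = 0)"
  using assms(3)
proof (induction fs)
  case Nil
  then show ?case using assms by auto
next
  case (Cons f fs)
  then obtain m h1 where h1: "m \<ge> n" "\<forall>i<n. h1 i = h i" "orthonormal m h1" "\<forall>i<m. h1 i \<in> W"
    "\<forall>f\<in>set fs. nrm (proj_residual m h1 f) = 0" by auto
  obtain k h2 where h2: "k \<ge> m" "\<forall>i<m. h2 i = h1 i" "orthonormal k h2" "\<forall>i<k. h2 i \<in> W"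
    "nrm (proj_residual k h2 f) = 0"
    using Gram_Schmidt_step[of m h1 W f] h1 Cons.prems assms(4,5) by auto
  have "nrm (proj_residual k h2 g) = 0" if "g \<in> set fs" for g
  proof -
    have g: "g \<in> V" using that Cons.prems assms(4) by auto
    have "(\<Sum>i<m. (ip g (h1 i))\<^sup>2) = (\<Sum>i<m. (ip g (h2 i))\<^sup>2)" using h2(2) by simp
    also have "\<dots> \<le> (\<Sum>i<k. (ip g (h2 i))\<^sup>2)" using h2(1) by (intro sum_mono2) auto
    finally have "(nrm (proj_residual k h2 g))\<^sup>2 \<le> (nrm (proj_residual m h1 g))\<^sup>2"
      using g h1(3) h2(3) by (simp add: proj_residual_sq)
    then show ?thesis using h1(5) that by simp
  qed
  then show ?case using h1 h2 by (intro exI[of _ k] conjI exI[of _ h2]) auto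
qed

text \<open>Near-minimisers of the distance are nearly orthogonal to the convex set, which forces the
  distance to vanish; this replaces Mazur's lemma.\<close>

lemma weak_limit_in_closure:
  assumes u: "u \<in> V" and T: "fun_subspace T" "T \<subseteq> V" and M: "\<And>n. nrm (\<lambda>x. s n x - u x) \<le> M"
    and s: "\<And>n::nat. s n \<in> T"
    and weak: "\<And>z. z \<in> V \<Longrightarrow> (\<lambda>n. ip z (\<lambda>x. s n x - u x)) \<longlonglongrightarrow> 0"
    and "0 < e"
  shows "\<exists>t\<in>T. nrm (\<lambda>x. u x - t x) < e"
proof (rule ccontr)
  assume neg: "\<not> ?thesis"
  interpret T: fun_subspace T by fact
  have sV: "s n \<in> V" and sd: "(\<lambda>x. s n x - u x) \<in> V" for n using s T u by (auto intro!: diff)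
  define D where "D = (\<lambda>t. ip (\<lambda>x. u x - t x) (\<lambda>x. u x - t x))"
  define \<delta> where "\<delta> = Inf (D ` T)"
  have ge: "e\<^sup>2 \<le> D t" if "t \<in> T" for t
  proof -
    have "e \<le> nrm (\<lambda>x. u x - t x)" using neg that by force
    then have "e\<^sup>2 \<le> (nrm (\<lambda>x. u x - t x))\<^sup>2" using \<open>0 < e\<close> by (intro power_mono) auto
    then show ?thesis using that T u unfolding D_def by (subst nrm_sq[symmetric]) (auto intro!: diff)
  qed
  have bdd: "bdd_below (D ` T)" using ge by (intro bdd_belowI2[of _ "e\<^sup>2"]) auto
  have \<delta>: "e\<^sup>2 \<le> \<delta>" unfolding \<delta>_def using ge T.zero by (intro cINF_greatest) auto
  have \<delta>_le: "\<delta> \<le> D t" if "t \<in> T" for t unfolding \<delta>_def using bdd that by (intro cINF_lower)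
  \<comment> \<open>A bound for the squared distance from any \<open>s n\<close> to any point of
    \<open>T\<close> whose squared distance from \<open>u\<close> is at most
    \<open>\<delta> + 1\<close>.\<close>
  define C where "C = (\<bar>M\<bar> + sqrt (\<delta> + 1))\<^sup>2"
  have Cpos: "0 < C"
  proof -
    have "0 \<le> \<delta>" using \<delta> zero_le_power2[of e] by linarith
    then show ?thesis unfolding C_def by (intro zero_less_power add_nonneg_pos) auto
  qed
  \<comment> \<open>Moving from a near-minimiser \<open>t\<close> by the fraction \<tau> towards
    \<open>s n\<close> stays in \<open>T\<close> and so cannot reach a squared distance below
    \<delta>. Expanding the square and letting \<open>n\<close> tend to infinity gives the
    inequality.\<close>
  have key: "2 * \<tau> * \<delta> \<le> \<tau>\<^sup>2 * C + \<epsilon>" if "0 < \<epsilon>" "\<epsilon> \<le> 1" "0 < \<tau>" for \<epsilon> \<tau>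
  proof -
    have "\<exists>d\<in>D ` T. d < \<delta> + \<epsilon>"
      using cInf_lessD[of "D ` T" "\<delta> + \<epsilon>"] T.zero that(1) unfolding \<delta>_def[symmetric] by auto
    then obtain t where t: "t \<in> T" "D t < \<delta> + \<epsilon>" by auto
    have tV: "t \<in> V" using t T by auto
    have ut: "(\<lambda>x. u x - t x) \<in> V" by (intro diff u tV)
    have st: "(\<lambda>x. s n x - t x) \<in> V" for n by (intro diff sV tV)
    have bnd: "ip (\<lambda>x. s n x - t x) (\<lambda>x. s n x - t x) \<le> C" for n
    proof -
      have "nrm (\<lambda>x. s n x - t x) \<le> nrm (\<lambda>x. s n x - u x) + nrm (\<lambda>x. u x - t x)"
        using triangle[OF sd[of n] ut] by (simp add: algebra_simps)
      also have "\<dots> \<le> \<bar>M\<bar> + sqrt (\<delta> + 1)"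
        using M[of n] t that unfolding D_def by (intro add_mono) (auto simp: ip_norm_def)
      finally have "(nrm (\<lambda>x. s n x - t x))\<^sup>2 \<le> C"
        unfolding C_def by (intro power_mono nrm_nonneg st)
      then show ?thesis by (simp add: nrm_sq st)
    qed
    have ineq: "2 * \<tau> * ip (\<lambda>x. u x - t x) (\<lambda>x. s n x - t x) \<le> \<tau>\<^sup>2 * C + \<epsilon>" for n
    proof -
      have "(\<lambda>x. t x + \<tau> * (s n x - t x)) \<in> T" by (intro T.add T.scale T.diff s t)
      then have "\<delta> \<le> D (\<lambda>x. t x + \<tau> * (s n x - t x))" by (rule \<delta>_le)
      also have "\<dots> = ip (\<lambda>x. (u x - t x) - \<tau> * (s n x - t x)) (\<lambda>x. (u x - t x) - \<tau> * (s n x - t x))"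
        by (simp add: D_def algebra_simps)
      also have "\<dots> = D t - 2 * \<tau> * ip (\<lambda>x. u x - t x) (\<lambda>x. s n x - t x)
          + \<tau>\<^sup>2 * ip (\<lambda>x. s n x - t x) (\<lambda>x. s n x - t x)"
        by (subst ip_diff_self) (auto simp: D_def ut st scale ip_scale ip_scale_right power2_eq_square)
      also have "\<dots> \<le> \<delta> + \<epsilon> - 2 * \<tau> * ip (\<lambda>x. u x - t x) (\<lambda>x. s n x - t x) + \<tau>\<^sup>2 * C"
        using t bnd that by (intro add_mono diff_mono mult_left_mono) auto
      finally show ?thesis by simp
    qed
    have "(\<lambda>n. 2 * \<tau> * (ip (\<lambda>x. u x - t x) (\<lambda>x. s n x - u x) + D t)) \<longlonglongrightarrow> 2 * \<tau> * (0 + D t)"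
      by (intro tendsto_intros weak ut)
    \<comment> \<open>Since \<open>s n - t\<close> is the sum of \<open>s n - u\<close> and
      \<open>u - t\<close>, weak convergence makes this inner product tend to
      \<open>D t\<close>.\<close>
    moreover have "ip (\<lambda>x. u x - t x) (\<lambda>x. s n x - u x) + D t = ip (\<lambda>x. u x - t x) (\<lambda>x. s n x - t x)" for n
      unfolding D_def by (subst ip_add_right[symmetric]) (auto simp: ut sd)
    ultimately have "2 * \<tau> * D t \<le> \<tau>\<^sup>2 * C + \<epsilon>"
      using ineq by (intro LIMSEQ_le_const2[of "\<lambda>n. 2 * \<tau> * (ip (\<lambda>x. u x - t x) (\<lambda>x. s n x - u x) + D t)"]) auto
    moreover have "2 * \<tau> * \<delta> \<le> 2 * \<tau> * D t" using \<delta>_le[OF t(1)] that by simp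
    ultimately show ?thesis by linarith
  qed
  have \<delta>pos: "0 < \<delta>" using \<delta> \<open>0 < e\<close> by (meson less_le_trans zero_less_power)
  \<comment> \<open>The minimiser of \<open>\<tau>\<^sup>2 * C - 2 * \<tau> * \<delta>\<close>. With
    it \<open>\<tau>\<^sup>2 * C\<close> equals \<open>\<tau> * \<delta>\<close>, so an \<epsilon>
    of at most half that size contradicts \<open>key\<close>.\<close>
  define \<tau> where "\<tau> = \<delta> / C"
  have \<tau>: "0 < \<tau>" using \<delta>pos Cpos by (simp add: \<tau>_def)
  have "\<tau>\<^sup>2 * C = \<tau> * \<delta>" using Cpos by (simp add: \<tau>_def power2_eq_square)
  moreover have "2 * \<tau> * \<delta> \<le> \<tau>\<^sup>2 * C + min 1 (\<tau> * \<delta> / 2)"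
    using \<tau> \<delta>pos by (intro key) auto
  moreover have "0 < \<tau> * \<delta>" using \<tau> \<delta>pos by simp
  moreover have "2 * \<tau> * \<delta> = 2 * (\<tau> * \<delta>)" by simp
  ultimately show False by (smt (verit) field_sum_of_halves)
qed

end

section \<open>Square integrable functions on a measure space\<close>

definition l2_fun :: "'a measure \<Rightarrow> ('a \<Rightarrow> real) set" where
  "l2_fun M = {f \<in> borel_measurable M. integrable M (\<lambda>x. (f x)\<^sup>2)}"

definition l2_ip :: "'a measure \<Rightarrow> ('a \<Rightarrow> real) \<Rightarrow> ('a \<Rightarrow> real) \<Rightarrow> real" where
  "l2_ip M f g = (LINT x|M. f x * g x)"

abbreviation l2_nrm :: "'a measure \<Rightarrow> ('a \<Rightarrow> real) \<Rightarrow> real" where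
  "l2_nrm M \<equiv> ip_norm (l2_ip M)"

lemma l2_fun_meas[measurable_dest]: "f \<in> l2_fun M \<Longrightarrow> f \<in> borel_measurable M"
  by (simp add: l2_fun_def)

lemma l2_fun_sq: "f \<in> l2_fun M \<Longrightarrow> integrable M (\<lambda>x. (f x)\<^sup>2)"
  by (simp add: l2_fun_def)

lemma l2_integrable_mult:
  assumes "f \<in> l2_fun M" "g \<in> l2_fun M" shows "integrable M (\<lambda>x. f x * g x)"
proof (rule Bochner_Integration.integrable_bound)
  show "integrable M (\<lambda>x. (f x)\<^sup>2 + (g x)\<^sup>2)" using assms by (simp add: l2_fun_def)
  show "(\<lambda>x. f x * g x) \<in> borel_measurable M" using assms by (auto simp: l2_fun_def)
  have "\<bar>a * b\<bar> \<le> a\<^sup>2 + b\<^sup>2" for a b :: real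
    using sum_squares_bound[of "\<bar>a\<bar>" "\<bar>b\<bar>"] mult_nonneg_nonneg[of "\<bar>a\<bar>" "\<bar>b\<bar>"]
    by (simp add: abs_mult del: mult_nonneg_nonneg)
  then show "AE x in M. norm (f x * g x) \<le> norm ((f x)\<^sup>2 + (g x)\<^sup>2)" by simp
qed

interpretation l2: psd_space "l2_fun M" "l2_ip M" for M :: "'a measure"
proof
  fix f g h :: "'a \<Rightarrow> real" and c :: real
  show "(\<lambda>x. 0) \<in> l2_fun M" by (simp add: l2_fun_def)
  assume f: "f \<in> l2_fun M"
  show "(\<lambda>x. c * f x) \<in> l2_fun M" using f by (auto simp: l2_fun_def power_mult_distrib)
  show "0 \<le> l2_ip M f f" by (auto simp: l2_ip_def intro!: integral_nonneg_AE)
  { assume h: "h \<in> l2_fun M" show "l2_ip M (\<lambda>x. c * f x) h = c * l2_ip M f h"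
      by (simp add: l2_ip_def mult.assoc) }
  assume g: "g \<in> l2_fun M"
  show "l2_ip M f g = l2_ip M g f" by (simp add: l2_ip_def mult.commute)
  have "integrable M (\<lambda>x. (f x)\<^sup>2 + (g x)\<^sup>2 + 2 * (f x * g x))"
    using f g l2_integrable_mult[OF f g] by (simp add: l2_fun_def)
  moreover have "(\<lambda>x. (f x + g x)\<^sup>2) = (\<lambda>x. (f x)\<^sup>2 + (g x)\<^sup>2 + 2 * (f x * g x))"
    by (simp add: power2_sum algebra_simps)
  ultimately show "(\<lambda>x. f x + g x) \<in> l2_fun M" using f g by (auto simp: l2_fun_def)
  assume h: "h \<in> l2_fun M"
  show "l2_ip M (\<lambda>x. f x + g x) h = l2_ip M f h + l2_ip M g h"
    using l2_integrable_mult[OF f h] l2_integrable_mult[OF g h] by (simp add: l2_ip_def distrib_right)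
qed

lemma l2_nrm_sq: "f \<in> l2_fun M \<Longrightarrow> (l2_nrm M f)\<^sup>2 = (LINT x|M. (f x)\<^sup>2)"
  by (simp add: l2.nrm_sq) (simp add: l2_ip_def power2_eq_square)

lemma l2_fun_bound:
  assumes "f \<in> l2_fun M" "g \<in> borel_measurable M" "AE x in M. \<bar>g x\<bar> \<le> \<bar>f x\<bar>"
  shows "g \<in> l2_fun M"
proof -
  have "integrable M (\<lambda>x. (g x)\<^sup>2)"
    using assms(2,3)
    by (intro Bochner_Integration.integrable_bound[OF l2_fun_sq[OF assms(1)]])
      (auto simp: abs_le_square_iff[symmetric] elim!: AE_mp)
  then show ?thesis using assms by (simp add: l2_fun_def)
qed

section \<open>Slices and contractions on a product of two measure spaces\<close>

context pair_sigma_finite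
begin

lemma l2_slice_fst:
  assumes "v \<in> l2_fun (M1 \<Otimes>\<^sub>M M2)"
  shows "AE x in M1. (\<lambda>y. v (x, y)) \<in> l2_fun M2"
proof -
  have [measurable]: "v \<in> borel_measurable (M1 \<Otimes>\<^sub>M M2)" by (rule l2_fun_meas[OF assms])
  have "AE x in M1. integrable M2 (\<lambda>y. (v (x, y))\<^sup>2)"
    using AE_integrable_fst'[OF l2_fun_sq[OF assms]] .
  with AE_space show ?thesis by eventually_elim (simp add: l2_fun_def)
qed

lemma l2_slice_snd:
  assumes "v \<in> l2_fun (M1 \<Otimes>\<^sub>M M2)"
  shows "AE y in M2. (\<lambda>x. v (x, y)) \<in> l2_fun M1"
proof -
  have [measurable]: "v \<in> borel_measurable (M1 \<Otimes>\<^sub>M M2)" by (rule l2_fun_meas[OF assms])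
  have "AE y in M2. integrable M1 (\<lambda>x. (v (x, y))\<^sup>2)"
    using AE_integrable_snd[of "\<lambda>x y. (v (x, y))\<^sup>2"] l2_fun_sq[OF assms] by (simp add: split_def)
  with AE_space show ?thesis by eventually_elim (simp add: l2_fun_def)
qed

lemma l2_nrm_fst:
  assumes "v \<in> l2_fun (M1 \<Otimes>\<^sub>M M2)"
  shows "(l2_nrm (M1 \<Otimes>\<^sub>M M2) v)\<^sup>2 = (LINT x|M1. (l2_nrm M2 (\<lambda>y. v (x, y)))\<^sup>2)"
    and "integrable M1 (\<lambda>x. (l2_nrm M2 (\<lambda>y. v (x, y)))\<^sup>2)"
proof -
  have eq: "(l2_nrm M2 (\<lambda>y. v (x, y)))\<^sup>2 = (LINT y|M2. (v (x, y))\<^sup>2)" for x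
    by (simp add: ip_norm_def l2_ip_def power2_eq_square[symmetric])
  show "(l2_nrm (M1 \<Otimes>\<^sub>M M2) v)\<^sup>2 = (LINT x|M1. (l2_nrm M2 (\<lambda>y. v (x, y)))\<^sup>2)"
    unfolding l2_nrm_sq[OF assms] eq using integral_fst'[OF l2_fun_sq[OF assms]] by simp
  show "integrable M1 (\<lambda>x. (l2_nrm M2 (\<lambda>y. v (x, y)))\<^sup>2)"
    unfolding eq using integrable_fst'[OF l2_fun_sq[OF assms]] by simp
qed

lemma l2_nrm_snd:
  assumes "v \<in> l2_fun (M1 \<Otimes>\<^sub>M M2)"
  shows "(l2_nrm (M1 \<Otimes>\<^sub>M M2) v)\<^sup>2 = (LINT y|M2. (l2_nrm M1 (\<lambda>x. v (x, y)))\<^sup>2)"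
    and "integrable M2 (\<lambda>y. (l2_nrm M1 (\<lambda>x. v (x, y)))\<^sup>2)"
proof -
  have eq: "(l2_nrm M1 (\<lambda>x. v (x, y)))\<^sup>2 = (LINT x|M1. (v (x, y))\<^sup>2)" for y
    by (simp add: ip_norm_def l2_ip_def power2_eq_square[symmetric])
  have int: "integrable (M1 \<Otimes>\<^sub>M M2) (case_prod (\<lambda>x y. (v (x, y))\<^sup>2))"
    using l2_fun_sq[OF assms] by (simp add: split_def)
  show "(l2_nrm (M1 \<Otimes>\<^sub>M M2) v)\<^sup>2 = (LINT y|M2. (l2_nrm M1 (\<lambda>x. v (x, y)))\<^sup>2)"
    unfolding l2_nrm_sq[OF assms] eq using integral_snd[OF int] by (simp add: split_def)
  show "integrable M2 (\<lambda>y. (l2_nrm M1 (\<lambda>x. v (x, y)))\<^sup>2)"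
    unfolding eq using integrable_snd[OF int] by simp
qed

text \<open>This lifts bounds for operators acting in one variable to the product space with the
  same constant: the slice estimate is squared and integrated over the other variable.\<close>

lemma l2_le_snd:
  assumes "v \<in> l2_fun (M1 \<Otimes>\<^sub>M M2)" "w \<in> l2_fun (M1 \<Otimes>\<^sub>M M2)" "0 \<le> C"
    and "AE y in M2. l2_nrm M1 (\<lambda>x. v (x, y)) \<le> C * l2_nrm M1 (\<lambda>x. w (x, y))"
  shows "l2_nrm (M1 \<Otimes>\<^sub>M M2) v \<le> C * l2_nrm (M1 \<Otimes>\<^sub>M M2) w"
proof (rule power2_le_imp_le)
  have "(l2_nrm (M1 \<Otimes>\<^sub>M M2) v)\<^sup>2 \<le> (LINT y|M2. C\<^sup>2 * (l2_nrm M1 (\<lambda>x. w (x, y)))\<^sup>2)"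
    unfolding l2_nrm_snd(1)[OF assms(1)]
  proof (rule integral_mono_AE)
    show "AE y in M2. (l2_nrm M1 (\<lambda>x. v (x, y)))\<^sup>2 \<le> C\<^sup>2 * (l2_nrm M1 (\<lambda>x. w (x, y)))\<^sup>2"
      using assms(4) l2_slice_snd[OF assms(1)]
      by eventually_elim (metis l2.nrm_nonneg power_mono power_mult_distrib)
  qed (auto simp: l2_nrm_snd(2) assms)
  also have "\<dots> = (C * l2_nrm (M1 \<Otimes>\<^sub>M M2) w)\<^sup>2"
    by (simp add: l2_nrm_snd(1)[OF assms(2)] power_mult_distrib)
  finally show "(l2_nrm (M1 \<Otimes>\<^sub>M M2) v)\<^sup>2 \<le> (C * l2_nrm (M1 \<Otimes>\<^sub>M M2) w)\<^sup>2" .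
qed (simp add: assms l2.nrm_nonneg)

lemma l2_le_fst:
  assumes "v \<in> l2_fun (M1 \<Otimes>\<^sub>M M2)" "w \<in> l2_fun (M1 \<Otimes>\<^sub>M M2)" "0 \<le> C"
    and "AE x in M1. l2_nrm M2 (\<lambda>y. v (x, y)) \<le> C * l2_nrm M2 (\<lambda>y. w (x, y))"
  shows "l2_nrm (M1 \<Otimes>\<^sub>M M2) v \<le> C * l2_nrm (M1 \<Otimes>\<^sub>M M2) w"
proof (rule power2_le_imp_le)
  have "(l2_nrm (M1 \<Otimes>\<^sub>M M2) v)\<^sup>2 \<le> (LINT x|M1. C\<^sup>2 * (l2_nrm M2 (\<lambda>y. w (x, y)))\<^sup>2)"
    unfolding l2_nrm_fst(1)[OF assms(1)]
  proof (rule integral_mono_AE)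
    show "AE x in M1. (l2_nrm M2 (\<lambda>y. v (x, y)))\<^sup>2 \<le> C\<^sup>2 * (l2_nrm M2 (\<lambda>y. w (x, y)))\<^sup>2"
      using assms(4) l2_slice_fst[OF assms(1)]
      by eventually_elim (metis l2.nrm_nonneg power_mono power_mult_distrib)
  qed (auto simp: l2_nrm_fst(2) assms)
  also have "\<dots> = (C * l2_nrm (M1 \<Otimes>\<^sub>M M2) w)\<^sup>2"
    by (simp add: l2_nrm_fst(1)[OF assms(2)] power_mult_distrib)
  finally show "(l2_nrm (M1 \<Otimes>\<^sub>M M2) v)\<^sup>2 \<le> (C * l2_nrm (M1 \<Otimes>\<^sub>M M2) w)\<^sup>2" .
qed (simp add: assms l2.nrm_nonneg)

lemma l2_tensor:
  assumes "f \<in> l2_fun M1" "g \<in> l2_fun M2"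
  shows "(\<lambda>z. f (fst z) * g (snd z)) \<in> l2_fun (M1 \<Otimes>\<^sub>M M2)"
proof -
  have [measurable]: "f \<in> borel_measurable M1" "g \<in> borel_measurable M2" using assms by (auto dest: l2_fun_meas)
  have "integrable (M1 \<Otimes>\<^sub>M M2) (\<lambda>z. (f (fst z) * g (snd z))\<^sup>2)"
  proof (rule Fubini_integrable)
    show "(\<lambda>z. (f (fst z) * g (snd z))\<^sup>2) \<in> borel_measurable (M1 \<Otimes>\<^sub>M M2)" by measurable
    show "integrable M1 (\<lambda>x. LINT y|M2. norm ((f (fst (x, y)) * g (snd (x, y)))\<^sup>2))"
      using l2_fun_sq[OF assms(1)] by (simp add: power_mult_distrib)
    show "AE x in M1. integrable M2 (\<lambda>y. (f (fst (x, y)) * g (snd (x, y)))\<^sup>2)"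
      using l2_fun_sq[OF assms(2)] by (simp add: power_mult_distrib)
  qed
  then show ?thesis by (simp add: l2_fun_def)
qed

text \<open>Cauchy-Schwarz on almost every slice dominates the squared contraction by a multiple of
  the squared slice norm, which is integrable.\<close>

lemma l2_contraction_snd:
  assumes "v \<in> l2_fun (M1 \<Otimes>\<^sub>M M2)" "g \<in> l2_fun M1"
  shows "(\<lambda>y. l2_ip M1 (\<lambda>x. v (x, y)) g) \<in> l2_fun M2"
proof -
  have [measurable]: "v \<in> borel_measurable (M1 \<Otimes>\<^sub>M M2)" "g \<in> borel_measurable M1"
    using assms by (auto dest: l2_fun_meas)
  have "(\<lambda>y. l2_ip M1 (\<lambda>x. v (x, y)) g) \<in> borel_measurable M2"
    unfolding l2_ip_def by measurable
  moreover have "integrable M2 (\<lambda>y. (l2_ip M1 (\<lambda>x. v (x, y)) g)\<^sup>2)"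
  proof (rule Bochner_Integration.integrable_bound)
    show "integrable M2 (\<lambda>y. (l2_nrm M1 g)\<^sup>2 * (l2_nrm M1 (\<lambda>x. v (x, y)))\<^sup>2)"
      using l2_nrm_snd(2)[OF assms(1)] by simp
    show "AE y in M2. norm ((l2_ip M1 (\<lambda>x. v (x, y)) g)\<^sup>2)
        \<le> norm ((l2_nrm M1 g)\<^sup>2 * (l2_nrm M1 (\<lambda>x. v (x, y)))\<^sup>2)"
      using l2_slice_snd[OF assms(1)]
    proof eventually_elim
      case (elim y)
      have "\<bar>l2_ip M1 (\<lambda>x. v (x, y)) g\<bar>\<^sup>2 \<le> (l2_nrm M1 (\<lambda>x. v (x, y)) * l2_nrm M1 g)\<^sup>2"
        using l2.Cauchy_Schwarz[OF elim assms(2)] by (intro power_mono) auto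
      then show ?case by (simp add: power_mult_distrib mult.commute)
    qed
    show "(\<lambda>y. (l2_ip M1 (\<lambda>x. v (x, y)) g)\<^sup>2) \<in> borel_measurable M2"
      unfolding l2_ip_def by measurable
  qed
  ultimately show ?thesis by (simp add: l2_fun_def)
qed

lemma l2_contraction_fst:
  assumes "v \<in> l2_fun (M1 \<Otimes>\<^sub>M M2)" "g \<in> l2_fun M2"
  shows "(\<lambda>x. l2_ip M2 (\<lambda>y. v (x, y)) g) \<in> l2_fun M1"
proof -
  have [measurable]: "v \<in> borel_measurable (M1 \<Otimes>\<^sub>M M2)" "g \<in> borel_measurable M2"
    using assms by (auto dest: l2_fun_meas)
  have "(\<lambda>x. l2_ip M2 (\<lambda>y. v (x, y)) g) \<in> borel_measurable M1"
    unfolding l2_ip_def by measurable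
  moreover have "integrable M1 (\<lambda>x. (l2_ip M2 (\<lambda>y. v (x, y)) g)\<^sup>2)"
  proof (rule Bochner_Integration.integrable_bound)
    show "integrable M1 (\<lambda>x. (l2_nrm M2 g)\<^sup>2 * (l2_nrm M2 (\<lambda>y. v (x, y)))\<^sup>2)"
      using l2_nrm_fst(2)[OF assms(1)] by simp
    show "AE x in M1. norm ((l2_ip M2 (\<lambda>y. v (x, y)) g)\<^sup>2)
        \<le> norm ((l2_nrm M2 g)\<^sup>2 * (l2_nrm M2 (\<lambda>y. v (x, y)))\<^sup>2)"
      using l2_slice_fst[OF assms(1)]
    proof eventually_elim
      case (elim x)
      have "\<bar>l2_ip M2 (\<lambda>y. v (x, y)) g\<bar>\<^sup>2 \<le> (l2_nrm M2 (\<lambda>y. v (x, y)) * l2_nrm M2 g)\<^sup>2"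
        using l2.Cauchy_Schwarz[OF elim assms(2)] by (intro power_mono) auto
      then show ?case by (simp add: power_mult_distrib mult.commute)
    qed
    show "(\<lambda>x. (l2_ip M2 (\<lambda>y. v (x, y)) g)\<^sup>2) \<in> borel_measurable M1"
      unfolding l2_ip_def by measurable
  qed
  ultimately show ?thesis by (simp add: l2_fun_def)
qed

end

section \<open>Coefficient vectors and the Landweber iteration\<close>

definition vip :: "nat \<Rightarrow> (nat \<Rightarrow> real) \<Rightarrow> (nat \<Rightarrow> real) \<Rightarrow> real" where
  "vip p c d = (\<Sum>m<p. c m * d m)"

interpretation vec: psd_space UNIV "vip p" for p
  by unfold_locales
    (auto simp: vip_def algebra_simps sum.distrib sum_distrib_left intro!: sum_nonneg)

abbreviation vnrm :: "nat \<Rightarrow> (nat \<Rightarrow> real) \<Rightarrow> real" where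
  "vnrm p \<equiv> ip_norm (vip p)"

lemma vnrm_sq: "(vnrm p c)\<^sup>2 = (\<Sum>m<p. (c m)\<^sup>2)"
  by (simp add: vec.nrm_sq) (simp add: vip_def power2_eq_square)

text \<open>With \<open>L c = \<Sum>\<^sub>m c\<^sub>m a\<^sub>m\<close> and its adjoint \<open>L\<^sup>*\<close>, the Landweber iteration for \<open>L L\<^sup>*\<close> gives the
  finite rank operators \<open>1 - (1 - \<kappa> L L\<^sup>*)\<^sup>n = L (q n) L\<^sup>*\<close>, where \<open>q n\<close> is a polynomial in \<open>L\<^sup>* L\<close>;
  \<open>resid n\<close> is \<open>(1 - \<kappa> L L\<^sup>*)\<^sup>n\<close> and \<open>vres n\<close> is \<open>(1 - \<kappa> L\<^sup>* L)\<^sup>n\<close>.\<close>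

locale landweber = psd_space V ip for V :: "('a \<Rightarrow> real) set" and ip +
  fixes p :: nat and a :: "nat \<Rightarrow> 'a \<Rightarrow> real" and \<kappa> S :: real
  assumes a_in: "m < p \<Longrightarrow> a m \<in> V"
    and S: "(\<Sum>m<p. ip (a m) (a m)) \<le> S"
    and \<kappa>: "0 < \<kappa>" "\<kappa> * S \<le> 1"
begin

text \<open>\<open>syn\<close> is the operator \<open>L\<close> and \<open>ana\<close> its adjoint.
  Accordingly \<open>vstep\<close> is \<open>1 - \<kappa> L\<^sup>* L\<close> on coefficients, and
  \<open>fstep\<close> is its counterpart on functions, with the two factors interchanged.\<close>

definition syn :: "(nat \<Rightarrow> real) \<Rightarrow> 'a \<Rightarrow> real" where
  "syn c = (\<lambda>x. \<Sum>m<p. c m * a m x)"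

definition ana :: "('a \<Rightarrow> real) \<Rightarrow> nat \<Rightarrow> real" where
  "ana f = (\<lambda>m. ip f (a m))"

definition vstep :: "(nat \<Rightarrow> real) \<Rightarrow> nat \<Rightarrow> real" where
  "vstep c = (\<lambda>m. c m - \<kappa> * ana (syn c) m)"

definition fstep :: "('a \<Rightarrow> real) \<Rightarrow> 'a \<Rightarrow> real" where
  "fstep f = (\<lambda>x. f x - \<kappa> * syn (ana f) x)"

text \<open>Horner's scheme for the geometric sum of
  \<open>\<kappa> (1 - \<kappa> L\<^sup>* L)\<^sup>k\<close> over \<open>k < n\<close>. Each of the
  \<open>n\<close> terms has norm at most \<kappa>, whence \<open>q_bound\<close>.\<close>

primrec q :: "nat \<Rightarrow> (nat \<Rightarrow> real) \<Rightarrow> nat \<Rightarrow> real" where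
  "q 0 c = (\<lambda>m. 0)"
| "q (Suc n) c = (\<lambda>m. \<kappa> * c m + vstep (q n c) m)"

definition resid :: "nat \<Rightarrow> ('a \<Rightarrow> real) \<Rightarrow> 'a \<Rightarrow> real" where
  "resid n f = (\<lambda>x. f x - syn (q n (ana f)) x)"

definition vres :: "nat \<Rightarrow> (nat \<Rightarrow> real) \<Rightarrow> nat \<Rightarrow> real" where
  "vres n c = (\<lambda>m. c m - q n (ana (syn c)) m)"

lemma syn_in [simp]: "syn c \<in> V"
  unfolding syn_def by (intro lincomb a_in)

lemma syn_diff: "syn (\<lambda>m. c m - d m) = (\<lambda>x. syn c x - syn d x)"
  by (simp add: syn_def left_diff_distrib sum_subtractf)

lemma syn_add: "syn (\<lambda>m. c m + d m) = (\<lambda>x. syn c x + syn d x)"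
  by (simp add: syn_def distrib_right sum.distrib)

lemma syn_scale: "syn (\<lambda>m. k * c m) = (\<lambda>x. k * syn c x)"
  by (simp add: syn_def sum_distrib_left mult_ac)

lemma ana_diff: "f \<in> V \<Longrightarrow> g \<in> V \<Longrightarrow> m < p \<Longrightarrow> ana (\<lambda>x. f x - g x) m = ana f m - ana g m"
  by (simp add: ana_def ip_diff a_in)

lemma ana_scale: "f \<in> V \<Longrightarrow> m < p \<Longrightarrow> ana (\<lambda>x. k * f x) m = k * ana f m"
  by (simp add: ana_def ip_scale a_in)

lemma ana_add: "f \<in> V \<Longrightarrow> g \<in> V \<Longrightarrow> m < p \<Longrightarrow> ana (\<lambda>x. f x + g x) m = ana f m + ana g m"
  by (simp add: ana_def ip_add a_in)

lemma ip_syn: "f \<in> V \<Longrightarrow> ip f (syn c) = vip p c (ana f)"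
  unfolding syn_def vip_def ana_def by (intro ip_lincomb_right a_in)

text \<open>Vectors of length \<open>p\<close> are represented by sequences of which only the first
  \<open>p\<close> entries count. The form \<open>vip p\<close> is therefore only semidefinite, and
  identities between vectors are claimed for \<open>m < p\<close>.\<close>

lemma vip_cong: "(\<And>m. m < p \<Longrightarrow> c m = c' m) \<Longrightarrow> (\<And>m. m < p \<Longrightarrow> d m = d' m) \<Longrightarrow> vip p c d = vip p c' d'"
  by (simp add: vip_def)

lemma syn_cong: "(\<And>m. m < p \<Longrightarrow> c m = d m) \<Longrightarrow> syn c = syn d"
  by (simp add: syn_def)

text \<open>The operator norm is at most the Hilbert-Schmidt norm, whose square is bounded by
  \<open>S\<close>.\<close>

lemma syn_bound: "ip (syn c) (syn c) \<le> S * vip p c c"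
proof -
  have "ip (syn c) (syn c) = (nrm (\<lambda>x. \<Sum>m<p. c m * a m x))\<^sup>2"
    by (simp add: nrm_sq syn_def[symmetric])
  also have "\<dots> \<le> (\<Sum>m<p. (c m)\<^sup>2) * (\<Sum>m<p. ip (a m) (a m))"
    by (rule nrm_lincomb_le) (rule a_in)
  also have "\<dots> \<le> (\<Sum>m<p. (c m)\<^sup>2) * S" by (intro mult_left_mono S sum_nonneg) auto
  finally show ?thesis by (simp add: vip_def power2_eq_square mult.commute)
qed

lemma ana_bound: assumes "f \<in> V" shows "vip p (ana f) (ana f) \<le> S * ip f f"
proof -
  have "(ana f m)\<^sup>2 \<le> ip f f * ip (a m) (a m)" if "m < p" for m
  proof -
    have "\<bar>ip f (a m)\<bar>\<^sup>2 \<le> (nrm f * nrm (a m))\<^sup>2"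
      by (intro power_mono Cauchy_Schwarz assms a_in that) auto
    then show ?thesis by (simp add: ana_def power_mult_distrib nrm_sq assms a_in that)
  qed
  then have "vip p (ana f) (ana f) \<le> (\<Sum>m<p. ip f f * ip (a m) (a m))"
    unfolding vip_def by (intro sum_mono) (auto simp: power2_eq_square)
  also have "\<dots> \<le> ip f f * S"
    unfolding sum_distrib_left[symmetric] by (intro mult_left_mono S ip_nonneg assms)
  finally show ?thesis by (simp add: mult.commute)
qed

text \<open>In the squared norm after one step, the condition \<open>\<kappa> * S \<le> 1\<close>
  lets the quadratic term consume at most half of the linear gain \<open>2 * \<kappa> * X\<close>.
  The surviving half is what \<open>vres_energy\<close> sums up.\<close>

lemma step_arith: assumes "0 \<le> X" "Y \<le> S * X" shows "- 2 * \<kappa> * X + \<kappa>\<^sup>2 * Y \<le> - \<kappa> * X"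
proof -
  have "\<kappa>\<^sup>2 * Y \<le> \<kappa>\<^sup>2 * (S * X)" using assms by (intro mult_left_mono) auto
  also have "\<dots> = \<kappa> * X * (\<kappa> * S)" by (simp add: power2_eq_square)
  also have "\<dots> \<le> \<kappa> * X * 1" using assms \<kappa> by (intro mult_left_mono) auto
  finally show ?thesis by (simp add: algebra_simps)
qed

lemma fstep_in [simp]: "f \<in> V \<Longrightarrow> fstep f \<in> V"
  unfolding fstep_def by (intro diff scale) auto

lemma fstep_nonexp: assumes "f \<in> V" shows "ip (fstep f) (fstep f) \<le> ip f f"
proof -
  let ?X = "vip p (ana f) (ana f)"
  have "ip (fstep f) (fstep f) = ip f f - 2 * \<kappa> * ?X + \<kappa>\<^sup>2 * ip (syn (ana f)) (syn (ana f))"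
    unfolding fstep_def using assms
    by (subst ip_diff_self) (auto simp: scale ip_scale ip_scale_right ip_syn power2_eq_square)
  moreover have "- 2 * \<kappa> * ?X + \<kappa>\<^sup>2 * ip (syn (ana f)) (syn (ana f)) \<le> - \<kappa> * ?X"
    by (intro step_arith vec.ip_nonneg syn_bound) auto
  moreover have "0 \<le> \<kappa> * ?X" using \<kappa> by (intro mult_nonneg_nonneg vec.ip_nonneg) auto
  ultimately show ?thesis by linarith
qed

lemma vip_ana_syn: "vip p c (ana (syn d)) = ip (syn d) (syn c)"
  by (simp add: ip_syn)

lemma vstep_energy: "vip p (vstep c) (vstep c) \<le> vip p c c - \<kappa> * ip (syn c) (syn c)"
proof -
  let ?X = "ip (syn c) (syn c)"
  have "vip p (vstep c) (vstep c) = vip p c c - 2 * \<kappa> * ?X + \<kappa>\<^sup>2 * vip p (ana (syn c)) (ana (syn c))"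
    unfolding vstep_def
    by (subst vec.ip_diff_self)
      (auto simp: vec.ip_scale vec.ip_scale_right vip_ana_syn power2_eq_square)
  moreover have "- 2 * \<kappa> * ?X + \<kappa>\<^sup>2 * vip p (ana (syn c)) (ana (syn c)) \<le> - \<kappa> * ?X"
    by (intro step_arith ip_nonneg ana_bound) auto
  ultimately show ?thesis by linarith
qed

lemma vstep_sym: "vip p (vstep c) d = vip p c (vstep d)"
  unfolding vstep_def
  by (simp add: vec.ip_diff vec.ip_diff_right vec.ip_scale vec.ip_scale_right)
    (metis UNIV_I ip_sym syn_in vec.ip_sym vip_ana_syn)

lemma vstep_diff: "m < p \<Longrightarrow> vstep (\<lambda>m. c m - d m) m = vstep c m - vstep d m"
  by (simp add: vstep_def syn_diff ana_diff algebra_simps)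

lemma vstep_add: "m < p \<Longrightarrow> vstep (\<lambda>m. c m + d m) m = vstep c m + vstep d m"
  by (simp add: vstep_def syn_add ana_add algebra_simps)

lemma vstep_scale: "m < p \<Longrightarrow> vstep (\<lambda>m. k * c m) m = k * vstep c m"
  by (simp add: vstep_def syn_scale ana_scale algebra_simps)

lemma vstep_cong: "(\<And>m. m < p \<Longrightarrow> c m = d m) \<Longrightarrow> m < p \<Longrightarrow> vstep c m = vstep d m"
  using syn_cong[of c d] by (simp add: vstep_def)

lemma q_cong: "(\<And>m. m < p \<Longrightarrow> c m = d m) \<Longrightarrow> m < p \<Longrightarrow> q n c m = q n d m"
proof (induction n arbitrary: m)
  case (Suc n)
  then show ?case using vstep_cong[of "q n c" "q n d" m] by simp
qed simp

lemma q_add: "m < p \<Longrightarrow> q n (\<lambda>m. c m + d m) m = q n c m + q n d m"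
proof (induction n arbitrary: m)
  case (Suc n)
  have "vstep (q n (\<lambda>m. c m + d m)) m = vstep (\<lambda>m. q n c m + q n d m) m"
    using Suc by (intro vstep_cong) auto
  then show ?case using Suc.prems by (simp add: vstep_add algebra_simps)
qed simp

lemma q_scale: "m < p \<Longrightarrow> q n (\<lambda>m. k * c m) m = k * q n c m"
proof (induction n arbitrary: m)
  case (Suc n)
  have "vstep (q n (\<lambda>m. k * c m)) m = vstep (\<lambda>m. k * q n c m) m"
    using Suc by (intro vstep_cong) auto
  then show ?case using Suc.prems by (simp add: vstep_scale algebra_simps)
qed simp

lemma vstep_nonexp: "vnrm p (vstep c) \<le> vnrm p c"
proof -
  have "0 \<le> \<kappa> * ip (syn c) (syn c)" using \<kappa> ip_nonneg[of "syn c"] by simp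
  then show ?thesis using vstep_energy[of c] by (simp add: ip_norm_def)
qed

lemma q_bound: "vnrm p (q n c) \<le> \<kappa> * n * vnrm p c"
proof (induction n)
  case 0
  then show ?case by (simp add: vec.nrm_zero)
next
  case (Suc n)
  have "vnrm p (q (Suc n) c) \<le> vnrm p (\<lambda>m. \<kappa> * c m) + vnrm p (vstep (q n c))"
    using vec.triangle[of "\<lambda>m. \<kappa> * c m" "vstep (q n c)" p] by simp
  also have "\<dots> \<le> \<kappa> * vnrm p c + vnrm p (q n c)"
    using \<kappa> vstep_nonexp by (simp add: vec.nrm_scale)
  finally show ?case using Suc by (simp add: algebra_simps)
qed

text \<open>Multiplying out \<open>fstep\<close> after \<open>1 - L q L\<^sup>*\<close> produces
  \<open>\<kappa> + vstep q\<close> between \<open>L\<close> and its adjoint, which is the recursion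
  of \<open>q\<close>.\<close>

lemma resid_Suc: assumes "f \<in> V" shows "resid (Suc n) f = fstep (resid n f)"
proof -
  let ?r = "q n (ana f)"
  have "syn (ana (\<lambda>x. f x - syn ?r x)) = syn (\<lambda>m. ana f m - ana (syn ?r) m)"
    using assms by (intro syn_cong) (simp add: ana_diff)
  then show ?thesis
    unfolding resid_def fstep_def
    by (simp add: vstep_def syn_add syn_diff syn_scale algebra_simps)
qed

lemma resid_0: "resid 0 f = f"
  by (simp add: resid_def syn_def)

lemma resid_in [simp]: "f \<in> V \<Longrightarrow> resid n f \<in> V"
  unfolding resid_def by (intro diff) auto

lemma resid_nonexp: "f \<in> V \<Longrightarrow> nrm (resid n f) \<le> nrm f"
proof (induction n)
  case (Suc n)
  have "nrm (resid (Suc n) f) \<le> nrm (resid n f)"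
    using fstep_nonexp[of "resid n f"] Suc.prems by (simp add: ip_norm_def resid_Suc)
  with Suc show ?case by simp
qed (simp add: resid_0)

lemma resid_add: assumes "f \<in> V" "g \<in> V"
  shows "resid n (\<lambda>x. f x + g x) = (\<lambda>x. resid n f x + resid n g x)"
proof -
  have "q n (ana (\<lambda>x. f x + g x)) m = q n (ana f) m + q n (ana g) m" if "m < p" for m
    using q_cong[of "ana (\<lambda>x. f x + g x)" "\<lambda>m. ana f m + ana g m" m n] assms that
    by (simp add: ana_add q_add)
  then have "syn (q n (ana (\<lambda>x. f x + g x))) = syn (\<lambda>m. q n (ana f) m + q n (ana g) m)"
    by (intro syn_cong) auto
  then show ?thesis by (simp add: resid_def syn_add algebra_simps)
qed

lemma resid_scale: assumes "f \<in> V"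
  shows "resid n (\<lambda>x. k * f x) = (\<lambda>x. k * resid n f x)"
proof -
  have "q n (ana (\<lambda>x. k * f x)) m = k * q n (ana f) m" if "m < p" for m
    using q_cong[of "ana (\<lambda>x. k * f x)" "\<lambda>m. k * ana f m" m n] assms that
    by (simp add: ana_scale q_scale)
  then have "syn (q n (ana (\<lambda>x. k * f x))) = syn (\<lambda>m. k * q n (ana f) m)"
    by (intro syn_cong) auto
  then show ?thesis by (simp add: resid_def syn_scale algebra_simps)
qed

lemma resid_sum:
  "finite I \<Longrightarrow> (\<And>i. i \<in> I \<Longrightarrow> f i \<in> V) \<Longrightarrow> resid n (\<lambda>x. \<Sum>i\<in>I. f i x) = (\<lambda>x. \<Sum>i\<in>I. resid n (f i) x)"
proof (induction I rule: finite_induct)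
  case empty
  then show ?case using resid_scale[of "\<lambda>x. 0" n 0] zero by simp
next
  case (insert i I)
  then show ?case using resid_add[of "f i" "\<lambda>x. \<Sum>i\<in>I. f i x" n] by (simp add: sum)
qed

text \<open>The intertwining relation: on the range of \<open>L\<close> the residual operator can be
  traded for its counterpart on coefficients.\<close>

lemma resid_syn: "resid n (syn c) = syn (vres n c)"
  by (simp add: resid_def vres_def syn_diff)

lemma vres_Suc: assumes "m < p" shows "vres (Suc n) c m = vstep (vres n c) m"
  using assms vstep_diff[OF assms, of c "q n (ana (syn c))"]
  by (simp add: vres_def) (simp add: vstep_def)

text \<open>Symmetry lets the operator on coefficients be moved from the values \<open>f m y\<close>
  to the derivatives \<open>d m x\<close>, which is how it commutes with differentiation. The
  induction uses that \<open>vres n\<close> commutes with \<open>vstep\<close>, both being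
  polynomials in \<open>L\<^sup>* L\<close>.\<close>

lemma vres_sym: "vip p (vres n c) d = vip p c (vres n d)"
proof (induction n arbitrary: d)
  case 0
  then show ?case by (simp add: vres_def)
next
  case (Suc n)
  have comm: "vres n (vstep d) m = vstep (vres n d) m" if "m < p" for m
    using that
  proof (induction n arbitrary: m)
    case (Suc n)
    then show ?case using vstep_cong[of "vres n (vstep d)" "vstep (vres n d)" m]
        vstep_cong[of "vres (Suc n) d" "vstep (vres n d)" m] by (simp add: vres_Suc)
  qed (simp add: vres_def)
  have "vip p (vres (Suc n) c) d = vip p (vstep (vres n c)) d"
    by (intro vip_cong) (auto simp: vres_Suc)
  also have "\<dots> = vip p c (vres n (vstep d))" by (simp add: vstep_sym Suc)
  also have "\<dots> = vip p c (vres (Suc n) d)"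
    by (intro vip_cong) (auto simp: vres_Suc comm)
  finally show ?case .
qed

text \<open>The energy inequality of a single step, telescoped. The sum of the squared residuals is
  bounded in terms of \<open>c\<close> alone, whatever the number of vectors
  \<open>a m\<close>.\<close>

lemma vres_energy: "vip p (vres n c) (vres n c) + (\<Sum>k<n. \<kappa> * ip (syn (vres k c)) (syn (vres k c))) \<le> vip p c c"
proof (induction n)
  case 0
  then show ?case by (simp add: vres_def)
next
  case (Suc n)
  have "vip p (vres (Suc n) c) (vres (Suc n) c) = vip p (vstep (vres n c)) (vstep (vres n c))"
    by (intro vip_cong) (auto simp: vres_Suc)
  then show ?case using vstep_energy[of "vres n c"] Suc by simp
qed

lemma vres_nonexp: "vnrm p (vres n c) \<le> vnrm p c"
proof -
  have "0 \<le> (\<Sum>k<n. \<kappa> * ip (syn (vres k c)) (syn (vres k c)))"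
    using \<kappa> by (intro sum_nonneg mult_nonneg_nonneg ip_nonneg) auto
  then show ?thesis using vres_energy[of n c] by (simp add: ip_norm_def)
qed

text \<open>The squared residuals decrease along the iteration, so the one after \<open>n\<close>
  steps is at most each of the \<open>n\<close> terms that \<open>vres_energy\<close> sums. Decay at
  this rate is available on the range of \<open>L\<close>, since the bound is by the preimage
  \<open>c\<close>.\<close>

lemma resid_syn_decay: "n * \<kappa> * (nrm (resid n (syn c)))\<^sup>2 \<le> vip p c c"
proof -
  define E where "E k = ip (syn (vres k c)) (syn (vres k c))" for k
  have "E (Suc k) \<le> E k" for k
    using fstep_nonexp[of "resid k (syn c)"] unfolding E_def resid_syn[symmetric]
    by (simp add: resid_Suc)
  then have dec: "E n \<le> E k" if "k \<le> n" for k
    using that by (rule lift_Suc_antimono_le)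
  have "n * \<kappa> * E n = (\<Sum>k<n. \<kappa> * E n)" by simp
  also have "\<dots> \<le> (\<Sum>k<n. \<kappa> * E k)" using \<kappa> dec by (intro sum_mono mult_left_mono) auto
  also have "\<dots> \<le> vip p c c"
    using vres_energy[of n c] vec.ip_nonneg[of "vres n c" p] by (simp add: E_def)
  finally show ?thesis by (simp add: nrm_sq E_def resid_syn)
qed

text \<open>Every coefficient is an inner product with a fixed function, so the finite rank operator
  takes the form of a sum of \<open>ip h (g m) * a m\<close>. In this form it can be applied to the
  slices of a function of several variables.\<close>

lemma q_representation: "\<exists>g. (\<forall>m<p. g m \<in> V) \<and> (\<forall>m<p. \<forall>f\<in>V. q n (ana f) m = ip f (g m))"
proof (induction n)
  case 0
  have "ip f (\<lambda>x. 0) = 0" if "f \<in> V" for f using ip_zero[OF that] ip_sym[OF that zero] by simp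
  then show ?case by (intro exI[of _ "\<lambda>m x. 0"]) (auto simp: zero)
next
  case (Suc n)
  then obtain g where g: "\<And>m. m < p \<Longrightarrow> g m \<in> V" "\<And>m f. m < p \<Longrightarrow> f \<in> V \<Longrightarrow> q n (ana f) m = ip f (g m)"
    by auto
  \<comment> \<open>The recursion of \<open>q\<close> transposed to the representing functions, with
    the Gram matrix of the \<open>a m\<close> in the role of \<open>L\<^sup>* L\<close>.\<close>
  define g' where "g' m = (\<lambda>x. \<kappa> * a m x + (g m x - \<kappa> * (\<Sum>l<p. ip (a l) (a m) * g l x)))" for m
  have in1: "(\<lambda>x. \<Sum>l<p. ip (a l) (a m) * g l x) \<in> V" for m by (intro lincomb g)
  have in2: "(\<lambda>x. g m x - \<kappa> * (\<Sum>l<p. ip (a l) (a m) * g l x)) \<in> V" if "m < p" for m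
    by (intro diff scale in1 g that)
  have "q (Suc n) (ana f) m = ip f (g' m)" if "m < p" "f \<in> V" for m f
  proof -
    have "ana (syn (q n (ana f))) m = (\<Sum>l<p. q n (ana f) l * ip (a l) (a m))"
      unfolding ana_def syn_def by (intro ip_lincomb a_in that)
    also have "\<dots> = ip f (\<lambda>x. \<Sum>l<p. ip (a l) (a m) * g l x)"
      using that g by (subst ip_lincomb_right) (auto simp: mult.commute)
    finally have "q (Suc n) (ana f) m
        = \<kappa> * ip f (a m) + (ip f (g m) - \<kappa> * ip f (\<lambda>x. \<Sum>l<p. ip (a l) (a m) * g l x))"
      using that by (simp add: vstep_def g) (simp add: ana_def)
    also have "\<dots> = ip f (g' m)"
      unfolding g'_def using that in1[of m] in2[of m] g a_in
      by (simp add: ip_add_right ip_diff_right ip_scale_right scale)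
    finally show ?thesis .
  qed
  moreover have "g' m \<in> V" if "m < p" for m
    unfolding g'_def using that by (intro add scale in2 a_in)
  ultimately show ?case by (intro exI[of _ g']) auto
qed

end

section \<open>Fourier expansions on slices and the truncated operator\<close>

context pair_sigma_finite
begin

lemma l2_tensor_nrm:
  assumes "f \<in> l2_fun M1" "g \<in> l2_fun M2"
  shows "l2_nrm (M1 \<Otimes>\<^sub>M M2) (\<lambda>z. f (fst z) * g (snd z)) = l2_nrm M1 f * l2_nrm M2 g"
proof -
  have "(l2_nrm (M1 \<Otimes>\<^sub>M M2) (\<lambda>z. f (fst z) * g (snd z)))\<^sup>2
      = (LINT y|M2. (l2_nrm M1 (\<lambda>x. g y * f x))\<^sup>2)"
    using l2_nrm_snd(1)[OF l2_tensor[OF assms]] by (simp add: mult.commute)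
  also have "\<dots> = (LINT y|M2. (g y)\<^sup>2 * (l2_nrm M1 f)\<^sup>2)"
    by (simp add: l2.nrm_scale assms power_mult_distrib)
  also have "\<dots> = (l2_nrm M1 f * l2_nrm M2 g)\<^sup>2"
    using l2_nrm_sq[OF assms(2)] by (simp add: power_mult_distrib mult.commute)
  finally show ?thesis using l2.nrm_nonneg[OF assms(1)] l2.nrm_nonneg[OF assms(2)]
      l2.nrm_nonneg[OF l2_tensor[OF assms]] by (simp add: power2_eq_iff_nonneg)
qed

text \<open>For almost every \<open>x\<close> the values \<open>a m x\<close> are the Fourier
  coefficients of the slice at \<open>x\<close>. The integrated inequality bounds the
  Hilbert-Schmidt norm independently of \<open>p\<close>, so that \<kappa> can be fixed before the
  number of vectors is known.\<close>

lemma Bessel_slices: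
  assumes v: "v \<in> l2_fun (M1 \<Otimes>\<^sub>M M2)" and on: "l2.orthonormal M2 p f"
    and a: "\<And>m. m < p \<Longrightarrow> a m \<in> l2_fun M1"
    and aeq: "\<And>m. m < p \<Longrightarrow> AE x in M1. a m x = l2_ip M2 (\<lambda>y. v (x, y)) (f m)"
  shows "AE x in M1. (\<Sum>m<p. (a m x)\<^sup>2) \<le> (l2_nrm M2 (\<lambda>y. v (x, y)))\<^sup>2"
    and "(\<Sum>m<p. l2_ip M1 (a m) (a m)) \<le> (l2_nrm (M1 \<Otimes>\<^sub>M M2) v)\<^sup>2"
proof -
  have "AE x in M1. \<forall>m\<in>{..<p}. a m x = l2_ip M2 (\<lambda>y. v (x, y)) (f m)"
    using aeq by (intro AE_finite_allI) auto
  then show le: "AE x in M1. (\<Sum>m<p. (a m x)\<^sup>2) \<le> (l2_nrm M2 (\<lambda>y. v (x, y)))\<^sup>2"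
    using l2_slice_fst[OF v]
  proof eventually_elim
    case (elim x)
    then show ?case using l2.Bessel[OF on elim(2)] by (simp add: l2.nrm_sq)
  qed
  have "(\<Sum>m<p. l2_ip M1 (a m) (a m)) = (LINT x|M1. (\<Sum>m<p. (a m x)\<^sup>2))"
    unfolding l2_ip_def using a by (subst Bochner_Integration.integral_sum)
      (auto simp: power2_eq_square[symmetric] l2_fun_sq)
  also have "\<dots> \<le> (LINT x|M1. (l2_nrm M2 (\<lambda>y. v (x, y)))\<^sup>2)"
    using le a by (intro integral_mono_AE l2_nrm_fst(2)[OF v]) (auto simp: l2_fun_sq)
  finally show "(\<Sum>m<p. l2_ip M1 (a m) (a m)) \<le> (l2_nrm (M1 \<Otimes>\<^sub>M M2) v)\<^sup>2"
    by (simp add: l2_nrm_fst(1)[OF v])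
qed

lemma l2_tensor_sum:
  assumes "\<And>m. m < (p::nat) \<Longrightarrow> a m \<in> l2_fun M1" "\<And>m. m < p \<Longrightarrow> f m \<in> l2_fun M2"
  shows "(\<lambda>z. \<Sum>m<p. a m (fst z) * f m (snd z)) \<in> l2_fun (M1 \<Otimes>\<^sub>M M2)"
  using assms by (intro l2.sum l2_tensor) auto

text \<open>Slice by slice the coefficients \<open>a m x\<close> give the orthogonal projection onto
  the span of the \<open>f m\<close>, and by \<open>null\<close> the competitor lies in that span up
  to a null function.\<close>

lemma projection_slices_le:
  assumes v: "v \<in> l2_fun (M1 \<Otimes>\<^sub>M M2)" and on: "l2.orthonormal M2 p f"
    and a: "\<And>m. m < p \<Longrightarrow> a m \<in> l2_fun M1"
    and aeq: "\<And>m. m < p \<Longrightarrow> AE x in M1. a m x = l2_ip M2 (\<lambda>y. v (x, y)) (f m)"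
    and \<psi>: "\<And>l. l < (n::nat) \<Longrightarrow> \<psi> l \<in> l2_fun M1" and \<rho>: "\<And>l. l < n \<Longrightarrow> \<rho> l \<in> l2_fun M2"
    and null: "\<And>l. l < n \<Longrightarrow> l2_nrm M2 (l2.proj_residual M2 p f (\<rho> l)) = 0"
  shows "l2_nrm (M1 \<Otimes>\<^sub>M M2) (\<lambda>z. v z - (\<Sum>m<p. a m (fst z) * f m (snd z)))
      \<le> l2_nrm (M1 \<Otimes>\<^sub>M M2) (\<lambda>z. v z - (\<Sum>l<n. \<psi> l (fst z) * \<rho> l (snd z)))"
proof -
  let ?R = "l2.proj_residual M2 p f"
  have f: "f m \<in> l2_fun M2" if "m < p" for m using l2.orthonormalD[OF on that] .
  have "AE x in M1. \<forall>m\<in>{..<p}. a m x = l2_ip M2 (\<lambda>y. v (x, y)) (f m)"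
    using aeq by (intro AE_finite_allI) auto
  then have "AE x in M1. l2_nrm M2 (\<lambda>y. v (x, y) - (\<Sum>m<p. a m x * f m y))
      \<le> 1 * l2_nrm M2 (\<lambda>y. v (x, y) - (\<Sum>l<n. \<psi> l x * \<rho> l y))"
    using l2_slice_fst[OF v]
  proof eventually_elim
    case (elim x)
    define w where "w = (\<lambda>y. v (x, y))"
    define z where "z = (\<lambda>y. \<Sum>l<n. \<psi> l x * \<rho> l y)"
    have w: "w \<in> l2_fun M2" using elim by (simp add: w_def)
    have z: "z \<in> l2_fun M2" unfolding z_def by (intro l2.lincomb \<rho>)
    have wz: "(\<lambda>y. w y - z y) \<in> l2_fun M2" by (intro l2.diff w z)
    have ipz: "l2_ip M2 z (f m) = (\<Sum>l<n. \<psi> l x * l2_ip M2 (\<rho> l) (f m))" if "m < p" for m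
      unfolding z_def by (intro l2.ip_lincomb \<rho> f that)
    \<comment> \<open>The residual is linear, so that of a slice of the competitor is a combination
      of the null residuals of the \<open>\<rho> l\<close>.\<close>
    have Rz: "?R z = (\<lambda>y. \<Sum>l<n. \<psi> l x * ?R (\<rho> l) y)"
    proof
      fix y
      have "(\<Sum>m<p. l2_ip M2 z (f m) * f m y) = (\<Sum>m<p. \<Sum>l<n. \<psi> l x * (l2_ip M2 (\<rho> l) (f m) * f m y))"
        by (intro sum.cong) (auto simp: ipz sum_distrib_right mult.assoc)
      also have "\<dots> = (\<Sum>l<n. \<psi> l x * (\<Sum>m<p. l2_ip M2 (\<rho> l) (f m) * f m y))"
        by (subst sum.swap) (simp add: sum_distrib_left)
      finally show "?R z y = (\<Sum>l<n. \<psi> l x * ?R (\<rho> l) y)"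
        by (simp add: l2.proj_residual_def right_diff_distrib sum_subtractf) (simp add: z_def)
    qed
    have "l2_nrm M2 (?R z) \<le> (\<Sum>l<n. l2_nrm M2 (\<lambda>y. \<psi> l x * ?R (\<rho> l) y))"
      unfolding Rz by (rule l2.nrm_sum_le) (auto intro!: l2.scale l2.proj_residual_in on \<rho>)
    also have "\<dots> = 0"
      using null by (intro sum.neutral) (auto simp: l2.nrm_scale l2.proj_residual_in[OF on] \<rho>)
    finally have Rz0: "l2_nrm M2 (?R z) \<le> 0" .
    have split: "?R w = (\<lambda>y. ?R (\<lambda>y. w y - z y) y + ?R z y)"
    proof
      fix y
      have "(\<Sum>m<p. l2_ip M2 (\<lambda>y. w y - z y) (f m) * f m y)
          = (\<Sum>m<p. l2_ip M2 w (f m) * f m y) - (\<Sum>m<p. l2_ip M2 z (f m) * f m y)"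
        by (simp add: sum_subtractf[symmetric] l2.ip_diff w z f left_diff_distrib)
      then show "?R w y = ?R (\<lambda>y. w y - z y) y + ?R z y"
        by (simp add: l2.proj_residual_def)
    qed
    have "l2_nrm M2 (?R w) \<le> l2_nrm M2 (?R (\<lambda>y. w y - z y)) + l2_nrm M2 (?R z)"
      unfolding split by (intro l2.triangle l2.proj_residual_in on w z wz)
    also have "\<dots> \<le> l2_nrm M2 (\<lambda>y. w y - z y)"
      using l2.proj_residual_le[OF on wz] Rz0 by simp
    finally show ?case using elim by (simp add: w_def z_def l2.proj_residual_def)
  qed
  then have "l2_nrm (M1 \<Otimes>\<^sub>M M2) (\<lambda>z. v z - (\<Sum>m<p. a m (fst z) * f m (snd z)))
      \<le> 1 * l2_nrm (M1 \<Otimes>\<^sub>M M2) (\<lambda>z. v z - (\<Sum>l<n. \<psi> l (fst z) * \<rho> l (snd z)))"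
    by (intro l2_le_fst l2.diff v l2_tensor_sum a f \<psi> \<rho>) auto
  then show ?thesis by simp
qed

end

text \<open>The first factor carries the distinguished coordinate, and \<open>D\<close> will be the
  derivative of \<open>u\<close> in it. \<open>C f\<close> and \<open>Cd f\<close> are chosen
  representatives of the contractions of \<open>u\<close> and \<open>D\<close>; they agree with the
  integrals only almost everywhere. \<open>F\<close> is the space of admissible \<open>f\<close>,
  later spanned by tensor products of test functions.\<close>

locale contraction_pair = pair_sigma_finite M1 M2
  for M1 :: "'a measure" and M2 :: "'b measure" +
  fixes u D :: "'a \<times> 'b \<Rightarrow> real" and F :: "('b \<Rightarrow> real) set"
    and C Cd :: "('b \<Rightarrow> real) \<Rightarrow> 'a \<Rightarrow> real"
  assumes u: "u \<in> l2_fun (M1 \<Otimes>\<^sub>M M2)" and D: "D \<in> l2_fun (M1 \<Otimes>\<^sub>M M2)"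
    and F: "F \<subseteq> l2_fun M2" "fun_subspace F"
    and C: "f \<in> F \<Longrightarrow> C f \<in> l2_fun M1"
    and C_eq: "f \<in> F \<Longrightarrow> AE x in M1. C f x = l2_ip M2 (\<lambda>y. u (x, y)) f"
    and Cd: "f \<in> F \<Longrightarrow> Cd f \<in> l2_fun M1"
    and Cd_eq: "f \<in> F \<Longrightarrow> AE x in M1. Cd f x = l2_ip M2 (\<lambda>y. D (x, y)) f"
    and dense: "0 < e \<Longrightarrow> \<exists>(n::nat) \<psi> \<rho>. (\<forall>l<n. \<psi> l \<in> l2_fun M1 \<and> \<rho> l \<in> F) \<and>
      l2_nrm (M1 \<Otimes>\<^sub>M M2) (\<lambda>z. u z - (\<Sum>l<n. \<psi> l (fst z) * \<rho> l (snd z))) < e"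
begin

abbreviation "P \<equiv> M1 \<Otimes>\<^sub>M M2"

text \<open>Orthonormalising the right factors of a good tensor approximation, on top of the given
  \<open>h\<close>, makes the Fourier expansion of \<open>u\<close> at least as good as that
  approximation.\<close>

lemma orthonormal_approximation:
  assumes "l2.orthonormal M2 r h" "\<And>i. i < r \<Longrightarrow> h i \<in> F" "0 < e"
  shows "\<exists>p\<ge>r. \<exists>f. (\<forall>i<r. f i = h i) \<and> l2.orthonormal M2 p f \<and> (\<forall>i<p. f i \<in> F) \<and>
    l2_nrm P (\<lambda>z. u z - (\<Sum>m<p. C (f m) (fst z) * f m (snd z))) < e"
proof -
  obtain n :: nat and \<psi> \<rho> where *: "(\<forall>l<n. \<psi> l \<in> l2_fun M1 \<and> \<rho> l \<in> F) \<and>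
    l2_nrm P (\<lambda>z. u z - (\<Sum>l<n. \<psi> l (fst z) * \<rho> l (snd z))) < e"
    using dense[OF assms(3)] by (elim exE)
  then have \<rho>: "\<And>l. l < n \<Longrightarrow> \<psi> l \<in> l2_fun M1" "\<And>l. l < n \<Longrightarrow> \<rho> l \<in> F"
    "l2_nrm P (\<lambda>z. u z - (\<Sum>l<n. \<psi> l (fst z) * \<rho> l (snd z))) < e"
    by simp_all
  have sub: "set (map \<rho> [0..<n]) \<subseteq> F" using \<rho>(2) by auto
  obtain p f where f: "p \<ge> r" "\<forall>i<r. f i = h i" "l2.orthonormal M2 p f" "\<forall>i<p. f i \<in> F"
    "\<forall>g\<in>set (map \<rho> [0..<n]). l2_nrm M2 (l2.proj_residual M2 p f g) = 0"
    using l2.Gram_Schmidt_extend[OF assms(1,2) sub F] by blast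
  have "l2_nrm P (\<lambda>z. u z - (\<Sum>m<p. C (f m) (fst z) * f m (snd z)))
      \<le> l2_nrm P (\<lambda>z. u z - (\<Sum>l<n. \<psi> l (fst z) * \<rho> l (snd z)))"
    using f F \<rho> by (intro projection_slices_le u C C_eq) auto
  with \<rho>(3) f show ?thesis by (intro exI[of _ p] conjI exI[of _ f]) auto
qed

text \<open>Both estimates are made for all \<open>v\<close> near \<open>u\<close>, because the
  operator will be applied to finite tensor sums approximating \<open>u\<close>. The tolerance
  \<delta> comes last and may depend on \<open>p\<close>, \<open>f\<close> and
  \<open>g\<close>.\<close>

theorem truncation:
  assumes "0 < \<eta>"
  shows "\<exists>p f g \<delta>. 0 < \<delta> \<and> (\<forall>m<(p::nat). f m \<in> F \<and> g m \<in> l2_fun M1) \<and>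
    (\<forall>h\<in>l2_fun M1. l2_nrm M1 (\<lambda>x. \<Sum>m<p. l2_ip M1 h (g m) * C (f m) x) \<le> 2 * l2_nrm M1 h) \<and>
    (\<forall>v\<in>l2_fun P. l2_nrm P (\<lambda>z. v z - u z) < \<delta> \<longrightarrow>
       l2_nrm P (\<lambda>z. v z - (\<Sum>m<p. C (f m) (fst z) * l2_ip M1 (\<lambda>x. v (x, snd z)) (g m))) < \<eta> \<and>
       l2_nrm P (\<lambda>z. \<Sum>m<p. Cd (f m) (fst z) * l2_ip M1 (\<lambda>x. v (x, snd z)) (g m)) \<le> 3 * l2_nrm P D)"
proof -
  define S where "S = (l2_nrm P u)\<^sup>2"
  \<comment> \<open>The summand 1 excludes division by zero when \<open>u\<close> is a null
    function.\<close>
  define \<kappa> where "\<kappa> = 1 / (1 + S)"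
  have S0: "0 \<le> S" by (simp add: S_def)
  have \<kappa>: "0 < \<kappa>" "\<kappa> * S \<le> 1" using S0 by (auto simp: \<kappa>_def field_simps)
  have D0: "0 \<le> l2_nrm P D" by (rule l2.nrm_nonneg[OF D])
  have emptyon: "l2.orthonormal M2 0 f" for f by (simp add: l2.orthonormal_def)
  \<comment> \<open>The error \<eta> has three shares of \<open>\<eta> / 4\<close>: the distance
    from \<open>v\<close> to \<open>u\<close>, the distance from \<open>u\<close> to this expansion,
    and the residual of the expansion.\<close>
  obtain r h where h: "l2.orthonormal M2 r h" "\<And>i. i < r \<Longrightarrow> h i \<in> F"
    "l2_nrm P (\<lambda>z. u z - (\<Sum>m<r. C (h m) (fst z) * h m (snd z))) < \<eta> / 4"
    using orthonormal_approximation[OF emptyon, where e = "\<eta> / 4"] assms by auto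
  \<comment> \<open>Each of the \<open>r\<close> terms of the expansion leaves a residual of at most
    \<open>1 / sqrt (n * \<kappa>)\<close>; this \<open>n\<close> makes their sum at most
    \<open>\<eta> / 4\<close>.\<close>
  obtain n :: nat where n: "real r ^ 2 / (\<kappa> * (\<eta> / 4)\<^sup>2) < n"
    using reals_Archimedean2 by blast
  have n0: "0 < n"
  proof -
    have "0 \<le> real r ^ 2 / (\<kappa> * (\<eta> / 4)\<^sup>2)" using \<kappa> by simp
    then show ?thesis using n by linarith
  qed
  \<comment> \<open>On an error of norm \<open>2 * \<nu>\<close> the derivative grows by at most the
    factor \<open>\<kappa> * n * l2_nrm P u\<close> times the norm of \<open>D\<close>; with this
    \<nu> the result is at most the norm of \<open>D\<close>.\<close>
  define \<nu> where "\<nu> = 1 / (2 * (1 + \<kappa> * n * l2_nrm P u))"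
  have u0: "0 \<le> l2_nrm P u" by (rule l2.nrm_nonneg[OF u])
  have kn: "0 \<le> \<kappa> * n * l2_nrm P u" using \<kappa> u0 by simp
  have \<nu>: "0 < \<nu>" using kn by (auto simp: \<nu>_def intro!: divide_pos_pos)
  have \<nu>1: "\<kappa> * n * l2_nrm P u * (2 * \<nu>) \<le> 1" using kn by (simp add: \<nu>_def field_simps)
  \<comment> \<open>The family extends \<open>h\<close>, so the main part \<open>zr\<close> stays
    the same and \<open>n\<close> remains a valid choice, although the operator now involves all
    \<open>p\<close> contractions.\<close>
  obtain p f where f: "p \<ge> r" "\<And>i. i < r \<Longrightarrow> f i = h i" "l2.orthonormal M2 p f"
    "\<And>i. i < p \<Longrightarrow> f i \<in> F"
    "l2_nrm P (\<lambda>z. u z - (\<Sum>m<p. C (f m) (fst z) * f m (snd z))) < \<nu>"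
    using orthonormal_approximation[OF h(1,2) \<nu>] by auto
  have fL: "f m \<in> l2_fun M2" if "m < p" for m using f(4)[OF that] F(1) by auto
  define a where "a = (\<lambda>m. C (f m))"
  define d where "d = (\<lambda>m. Cd (f m))"
  have a: "a m \<in> l2_fun M1" if "m < p" for m unfolding a_def using f(4)[OF that] by (rule C)
  have d: "d m \<in> l2_fun M1" if "m < p" for m unfolding d_def using f(4)[OF that] by (rule Cd)
  have aS: "(\<Sum>m<p. l2_ip M1 (a m) (a m)) \<le> S"
    unfolding S_def using f by (intro Bessel_slices(2)[OF u f(3)] a) (auto simp: a_def intro: C_eq)
  have dS: "(\<Sum>m<p. l2_ip M1 (d m) (d m)) \<le> (l2_nrm P D)\<^sup>2"
    using f by (intro Bessel_slices(2)[OF D f(3)] d) (auto simp: d_def intro: Cd_eq)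
  have dAE: "AE x in M1. (\<Sum>m<p. (d m x)\<^sup>2) \<le> (l2_nrm M2 (\<lambda>y. D (x, y)))\<^sup>2"
    using f by (intro Bessel_slices(1)[OF D f(3)] d) (auto simp: d_def intro: Cd_eq)
  interpret lw: landweber "l2_fun M1" "l2_ip M1" p a \<kappa> S
    by unfold_locales (use a aS \<kappa> in auto)
  obtain g where g: "\<And>m. m < p \<Longrightarrow> g m \<in> l2_fun M1"
    "\<And>m w. m < p \<Longrightarrow> w \<in> l2_fun M1 \<Longrightarrow> lw.q n (lw.ana w) m = l2_ip M1 w (g m)"
    using lw.q_representation[of n] by auto
  have Aop: "(\<lambda>x. \<Sum>m<p. l2_ip M1 w (g m) * a m x) = (\<lambda>x. w x - lw.resid n w x)"
    if "w \<in> l2_fun M1" for w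
    by (simp add: lw.resid_def lw.syn_def g(2)[OF _ that])
  have bound: "l2_nrm M1 (\<lambda>x. \<Sum>m<p. l2_ip M1 w (g m) * a m x) \<le> 2 * l2_nrm M1 w"
    if "w \<in> l2_fun M1" for w
    unfolding Aop[OF that]
    using l2.triangle_diff[OF that lw.resid_in[OF that, of n]] lw.resid_nonexp[OF that, of n] by simp
  define uN where "uN = (\<lambda>z. \<Sum>m<p. a m (fst z) * f m (snd z))"
  have uN: "uN \<in> l2_fun P" unfolding uN_def by (intro l2_tensor_sum a fL)
  define zr where "zr = (\<lambda>z. \<Sum>m<r. a m (fst z) * f m (snd z))"
  have rp: "m < p" if "m < r" for m using that f(1) by simp
  have zr: "zr \<in> l2_fun P" unfolding zr_def by (intro l2_tensor_sum a fL rp)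
  have zr_eq: "zr = (\<lambda>z. \<Sum>m<r. C (h m) (fst z) * h m (snd z))"
    unfolding zr_def a_def by (simp add: f(2))
  define \<delta> where "\<delta> = min (\<eta> / 4) \<nu>"
  have \<delta>: "0 < \<delta>" using \<nu> assms by (simp add: \<delta>_def)
  have fnrm: "l2_nrm M2 (f i) = 1" if "i < p" for i
    using l2.orthonormal_ip[OF f(3) that that] by (simp add: ip_norm_def)
  have res_small: "l2_nrm P (\<lambda>z. \<Sum>i<r. lw.resid n (a i) (fst z) * f i (snd z)) \<le> \<eta> / 4"
  proof -
    have "l2_nrm M1 (lw.resid n (a i)) \<le> sqrt (1 / (n * \<kappa>))" if "i < p" for i
    proof -
      \<comment> \<open>\<open>a i\<close> is the image of the \<open>i\<close>-th unit vector,
        whose norm is 1.\<close>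
      define c where "c = (\<lambda>m. if m = i then 1 else 0 :: real)"
      have "(\<Sum>m<p. c m * a m x) = a i x" for x
      proof -
        have "(\<Sum>m<p. c m * a m x) = (\<Sum>m<p. if m = i then a i x else 0)"
          by (intro sum.cong) (auto simp: c_def)
        then show ?thesis using that by simp
      qed
      then have "lw.syn c = a i" by (simp add: lw.syn_def)
      moreover have "vip p c c = 1"
      proof -
        have "vip p c c = (\<Sum>m<p. if m = i then 1 else 0)"
          unfolding vip_def by (intro sum.cong) (auto simp: c_def)
        then show ?thesis using that by simp
      qed
      ultimately have "n * \<kappa> * (l2_nrm M1 (lw.resid n (a i)))\<^sup>2 \<le> 1"
        using lw.resid_syn_decay[of n c] by simp
      then have "(l2_nrm M1 (lw.resid n (a i)))\<^sup>2 \<le> 1 / (n * \<kappa>)"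
        using n0 \<kappa> by (simp add: field_simps)
      then show ?thesis by (rule real_le_rsqrt)
    qed
    then have le: "l2_nrm P (\<lambda>z. lw.resid n (a i) (fst z) * f i (snd z)) \<le> sqrt (1 / (n * \<kappa>))" if "i < p" for i
      using that by (subst l2_tensor_nrm) (auto simp: fnrm a fL)
    have "l2_nrm P (\<lambda>z. \<Sum>i<r. lw.resid n (a i) (fst z) * f i (snd z))
        \<le> (\<Sum>i<r. l2_nrm P (\<lambda>z. lw.resid n (a i) (fst z) * f i (snd z)))"
      using rp by (intro l2.nrm_sum_le l2_tensor lw.resid_in a fL) auto
    also have "\<dots> \<le> (\<Sum>i<r. sqrt (1 / (n * \<kappa>)))" by (intro sum_mono le rp) auto
    also have "\<dots> = sqrt ((real r)\<^sup>2 / (n * \<kappa>))" by (simp add: real_sqrt_divide)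
    also have "\<dots> \<le> sqrt ((\<eta> / 4)\<^sup>2)"
    proof (rule real_sqrt_le_mono)
      have "(real r)\<^sup>2 < n * (\<kappa> * (\<eta> / 4)\<^sup>2)"
        using n \<kappa> assms by (subst (asm) pos_divide_less_eq) (auto intro!: mult_pos_pos)
      then show "(real r)\<^sup>2 / (n * \<kappa>) \<le> (\<eta> / 4)\<^sup>2"
        using n0 \<kappa> by (subst pos_divide_le_eq) (auto simp: mult_ac)
    qed
    also have "\<dots> = \<eta> / 4" using assms by simp
    finally show ?thesis .
  qed
  have main: "l2_nrm P (\<lambda>z. v z - (\<Sum>m<p. a m (fst z) * l2_ip M1 (\<lambda>x. v (x, snd z)) (g m))) < \<eta>
      \<and> l2_nrm P (\<lambda>z. \<Sum>m<p. d m (fst z) * l2_ip M1 (\<lambda>x. v (x, snd z)) (g m)) \<le> 3 * l2_nrm P D"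
    if v: "v \<in> l2_fun P" and vu: "l2_nrm P (\<lambda>z. v z - u z) < \<delta>" for v
  proof
    have con: "(\<lambda>y. l2_ip M1 (\<lambda>x. w (x, y)) (g m)) \<in> l2_fun M2" if "w \<in> l2_fun P" "m < p" for w m
      using that by (intro l2_contraction_snd g)
    have Rin: "(\<lambda>z. w z - (\<Sum>m<p. a m (fst z) * l2_ip M1 (\<lambda>x. w (x, snd z)) (g m))) \<in> l2_fun P"
      if "w \<in> l2_fun P" for w
      using that by (intro l2.diff l2_tensor_sum a con)
    have Rslice: "w (x, y) - (\<Sum>m<p. a m x * l2_ip M1 (\<lambda>x. w (x, y)) (g m)) = lw.resid n (\<lambda>x. w (x, y)) x"
      if "(\<lambda>x. w (x, y)) \<in> l2_fun M1" for w :: "'a \<times> 'b \<Rightarrow> real" and x y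
      using fun_cong[OF Aop[OF that], of x] by (simp add: mult.commute)
    \<comment> \<open>On the small part \<open>w\<close> the residual operator is nonexpansive, and
      on \<open>zr\<close> it is small by the choice of \<open>n\<close>.\<close>
    define w where "w = (\<lambda>z. v z - zr z)"
    have w: "w \<in> l2_fun P" unfolding w_def by (intro l2.diff v zr)
    have w_small: "l2_nrm P w < \<eta> / 2"
    proof -
      have "l2_nrm P w \<le> l2_nrm P (\<lambda>z. v z - u z) + l2_nrm P (\<lambda>z. u z - zr z)"
        using l2.triangle[OF l2.diff[OF v u] l2.diff[OF u zr]] by (simp add: w_def)
      then show ?thesis using vu h(3) by (simp add: zr_eq \<delta>_def)
    qed
    define Rw where "Rw = (\<lambda>z. w z - (\<Sum>m<p. a m (fst z) * l2_ip M1 (\<lambda>x. w (x, snd z)) (g m)))"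
    define Rz where "Rz = (\<lambda>z. \<Sum>i<r. lw.resid n (a i) (fst z) * f i (snd z))"
    have Rw: "Rw \<in> l2_fun P" unfolding Rw_def by (rule Rin[OF w])
    have Rz: "Rz \<in> l2_fun P" unfolding Rz_def by (intro l2_tensor_sum lw.resid_in a fL rp)
    have "AE y in M2. l2_nrm M1 (\<lambda>x. Rw (x, y)) \<le> 1 * l2_nrm M1 (\<lambda>x. w (x, y))"
      using l2_slice_snd[OF w]
    proof eventually_elim
      case (elim y)
      then show ?case using Rslice[OF elim] lw.resid_nonexp[OF elim, of n] by (simp add: Rw_def)
    qed
    then have Rw_le: "l2_nrm P Rw \<le> 1 * l2_nrm P w" by (intro l2_le_snd Rw w) simp_all
    have zs: "(\<lambda>x. zr (x, y)) = (\<lambda>x. \<Sum>i<r. f i y * a i x)" for y by (simp add: zr_def mult.commute)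
    have zsL: "(\<lambda>x. zr (x, y)) \<in> l2_fun M1" for y unfolding zs by (intro l2.lincomb a rp)
    have zsR: "lw.resid n (\<lambda>x. zr (x, y)) = (\<lambda>x. Rz (x, y))" for y
    proof -
      have "lw.resid n (\<lambda>x. \<Sum>i<r. f i y * a i x) = (\<lambda>x. \<Sum>i<r. lw.resid n (\<lambda>x. f i y * a i x) x)"
        by (intro lw.resid_sum l2.scale a rp) auto
      also have "\<dots> = (\<lambda>x. \<Sum>i<r. f i y * lw.resid n (a i) x)"
        by (intro ext sum.cong) (auto simp: lw.resid_scale a rp)
      finally show ?thesis unfolding zs by (simp add: Rz_def mult.commute)
    qed
    have "AE y in M2. l2_nrm M1 (\<lambda>x. (\<lambda>z. v z - (\<Sum>m<p. a m (fst z) * l2_ip M1 (\<lambda>x. v (x, snd z)) (g m))) (x, y))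
        \<le> 1 * l2_nrm M1 (\<lambda>x. (\<lambda>z. Rw z + Rz z) (x, y))"
      using l2_slice_snd[OF v] l2_slice_snd[OF w]
    proof eventually_elim
      case (elim y)
      have "(\<lambda>x. v (x, y)) = (\<lambda>x. w (x, y) + zr (x, y))" by (simp add: w_def)
      then have "lw.resid n (\<lambda>x. v (x, y)) = (\<lambda>x. lw.resid n (\<lambda>x. w (x, y)) x + lw.resid n (\<lambda>x. zr (x, y)) x)"
        using lw.resid_add[OF elim(2) zsL] by simp
      then show ?case
        using Rslice[OF elim(1)] Rslice[OF elim(2)] by (simp add: Rw_def zsR)
    qed
    then have "l2_nrm P (\<lambda>z. v z - (\<Sum>m<p. a m (fst z) * l2_ip M1 (\<lambda>x. v (x, snd z)) (g m)))
        \<le> 1 * l2_nrm P (\<lambda>z. Rw z + Rz z)"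
      by (intro l2_le_snd Rin v l2.add Rw Rz) auto
    also have "\<dots> \<le> l2_nrm P Rw + l2_nrm P Rz" using l2.triangle[OF Rw Rz] by simp
    also have "\<dots> < \<eta>" using Rw_le w_small res_small assms by (simp add: Rz_def)
    finally show "l2_nrm P (\<lambda>z. v z - (\<Sum>m<p. a m (fst z) * l2_ip M1 (\<lambda>x. v (x, snd z)) (g m))) < \<eta>" .

    \<comment> \<open>For the derivative \<open>v\<close> is split differently. The slices of
      \<open>uN\<close> are values of \<open>syn\<close>, where the operator passes exactly to the
      coefficients; the rest \<open>e\<close> is small enough to absorb a factor that grows with
      \<open>n\<close>.\<close>
    define e where "e = (\<lambda>z. v z - uN z)"
    have e: "e \<in> l2_fun P" unfolding e_def by (intro l2.diff v uN)
    have e_small: "l2_nrm P e \<le> 2 * \<nu>"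
    proof -
      have "l2_nrm P e \<le> l2_nrm P (\<lambda>z. v z - u z) + l2_nrm P (\<lambda>z. u z - uN z)"
        using l2.triangle[OF l2.diff[OF v u] l2.diff[OF u uN]] by (simp add: e_def)
      then show ?thesis using vu f(5) by (simp add: uN_def a_def \<delta>_def)
    qed
    have Ein: "(\<lambda>z. \<Sum>m<p. d m (fst z) * l2_ip M1 (\<lambda>x. w (x, snd z)) (g m)) \<in> l2_fun P"
      if "w \<in> l2_fun P" for w using that by (intro l2_tensor_sum d con)
    define E1 where "E1 = (\<lambda>z. \<Sum>m<p. d m (fst z) * l2_ip M1 (\<lambda>x. uN (x, snd z)) (g m))"
    define E2 where "E2 = (\<lambda>z. \<Sum>m<p. d m (fst z) * l2_ip M1 (\<lambda>x. e (x, snd z)) (g m))"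
    have E1: "E1 \<in> l2_fun P" unfolding E1_def by (rule Ein[OF uN])
    have E2: "E2 \<in> l2_fun P" unfolding E2_def by (rule Ein[OF e])
    have us: "(\<lambda>x. uN (x, y)) = lw.syn (\<lambda>m. f m y)" for y
      by (simp add: uN_def lw.syn_def mult.commute)
    \<comment> \<open>On \<open>uN\<close> the coefficients are \<open>1 - vres n\<close> applied to
      the vector of the \<open>f m y\<close>. By symmetry this operator acts on the vector of the
      \<open>d m x\<close> instead, whose norm it at most doubles.\<close>
    have E1_eq: "E1 (x, y) = (\<Sum>m<p. (d m x - lw.vres n (\<lambda>m. d m x) m) * f m y)" for x y
    proof -
      let ?f = "\<lambda>m. f m y" and ?d = "\<lambda>m. d m x"
      have "E1 (x, y) = (\<Sum>m<p. d m x * (f m y - lw.vres n ?f m))"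
        by (simp add: E1_def us g(2)[symmetric] lw.vres_def)
      also have "\<dots> = vip p ?d ?f - vip p ?d (lw.vres n ?f)"
        by (simp add: vip_def right_diff_distrib sum_subtractf)
      also have "\<dots> = vip p ?d ?f - vip p (lw.vres n ?d) ?f" by (simp add: lw.vres_sym)
      also have "\<dots> = (\<Sum>m<p. (d m x - lw.vres n ?d m) * f m y)"
        by (simp add: vip_def left_diff_distrib sum_subtractf)
      finally show ?thesis .
    qed
    have "AE x in M1. l2_nrm M2 (\<lambda>y. E1 (x, y)) \<le> 2 * l2_nrm M2 (\<lambda>y. D (x, y))"
      using dAE l2_slice_fst[OF D]
    proof eventually_elim
      case (elim x)
      let ?d = "\<lambda>m. d m x"
      have "l2_nrm M2 (\<lambda>y. E1 (x, y)) = vnrm p (\<lambda>m. ?d m - lw.vres n ?d m)"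
        unfolding E1_eq using l2.orthonormal_lincomb_ip_self[OF f(3), of "\<lambda>m. ?d m - lw.vres n ?d m"]
        by (simp add: ip_norm_def vip_def power2_eq_square)
      also have "\<dots> \<le> 2 * vnrm p ?d"
        using vec.triangle_diff[of ?d "lw.vres n ?d" p] lw.vres_nonexp[of n ?d] by simp
      also have "vnrm p ?d \<le> l2_nrm M2 (\<lambda>y. D (x, y))"
      proof (rule power2_le_imp_le)
        show "(vnrm p ?d)\<^sup>2 \<le> (l2_nrm M2 (\<lambda>y. D (x, y)))\<^sup>2" unfolding vnrm_sq by (rule elim(1))
        show "0 \<le> l2_nrm M2 (\<lambda>y. D (x, y))" by (rule l2.nrm_nonneg[OF elim(2)])
      qed
      finally show ?case by simp
    qed
    then have E1_le: "l2_nrm P E1 \<le> 2 * l2_nrm P D" by (intro l2_le_fst E1 D) simp_all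
    \<comment> \<open>The crude factor: \<open>q n\<close> contributes \<open>\<kappa> * n\<close>,
      the inner products with the \<open>a m\<close> contribute the norm of \<open>u\<close>, and
      the combination of the \<open>d m\<close> contributes the norm of \<open>D\<close>.\<close>
    let ?K = "l2_nrm P D * (\<kappa> * n * l2_nrm P u)"
    have "AE y in M2. l2_nrm M1 (\<lambda>x. E2 (x, y)) \<le> ?K * l2_nrm M1 (\<lambda>x. e (x, y))"
      using l2_slice_snd[OF e]
    proof eventually_elim
      case (elim y)
      let ?c = "lw.q n (lw.ana (\<lambda>x. e (x, y)))"
      have eq: "(\<lambda>x. E2 (x, y)) = (\<lambda>x. \<Sum>m<p. ?c m * d m x)"
        by (simp add: E2_def g(2)[OF _ elim] mult.commute)
      have "(l2_nrm M1 (\<lambda>x. E2 (x, y)))\<^sup>2 \<le> (\<Sum>m<p. (?c m)\<^sup>2) * (\<Sum>m<p. l2_ip M1 (d m) (d m))"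
        unfolding eq by (intro l2.nrm_lincomb_le d)
      also have "\<dots> \<le> (vnrm p ?c)\<^sup>2 * (l2_nrm P D)\<^sup>2"
        unfolding vnrm_sq by (intro mult_left_mono dS sum_nonneg) auto
      finally have "l2_nrm M1 (\<lambda>x. E2 (x, y)) \<le> vnrm p ?c * l2_nrm P D"
        using power2_le_imp_le[of "l2_nrm M1 (\<lambda>x. E2 (x, y))" "vnrm p ?c * l2_nrm P D"]
          mult_nonneg_nonneg[OF vec.nrm_nonneg[OF UNIV_I] D0] by (simp add: power_mult_distrib)
      also have "\<dots> \<le> (\<kappa> * n * vnrm p (lw.ana (\<lambda>x. e (x, y)))) * l2_nrm P D"
        by (intro mult_right_mono lw.q_bound D0)
      finally have le: "l2_nrm M1 (\<lambda>x. E2 (x, y)) \<le> (\<kappa> * n * vnrm p (lw.ana (\<lambda>x. e (x, y)))) * l2_nrm P D" .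
      have "vnrm p (lw.ana (\<lambda>x. e (x, y))) \<le> l2_nrm P u * l2_nrm M1 (\<lambda>x. e (x, y))"
      proof (rule power2_le_imp_le)
        show "(vnrm p (lw.ana (\<lambda>x. e (x, y))))\<^sup>2 \<le> (l2_nrm P u * l2_nrm M1 (\<lambda>x. e (x, y)))\<^sup>2"
          using lw.ana_bound[OF elim] by (simp add: power_mult_distrib vec.nrm_sq l2.nrm_sq elim S_def)
        show "0 \<le> l2_nrm P u * l2_nrm M1 (\<lambda>x. e (x, y))"
          by (intro mult_nonneg_nonneg u0 l2.nrm_nonneg[OF elim])
      qed
      then have "(\<kappa> * n * vnrm p (lw.ana (\<lambda>x. e (x, y)))) * l2_nrm P D
          \<le> (\<kappa> * n * (l2_nrm P u * l2_nrm M1 (\<lambda>x. e (x, y)))) * l2_nrm P D"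
        using \<kappa> by (intro mult_right_mono mult_left_mono D0) auto
      with le show ?case by (simp add: mult_ac)
    qed
    then have "l2_nrm P E2 \<le> ?K * l2_nrm P e"
      by (intro l2_le_snd E2 e mult_nonneg_nonneg[OF D0 kn])
    also have "\<dots> \<le> ?K * (2 * \<nu>)"
      by (intro mult_left_mono e_small mult_nonneg_nonneg D0 kn)
    also have "\<dots> = l2_nrm P D * (\<kappa> * n * l2_nrm P u * (2 * \<nu>))" by simp
    also have "\<dots> \<le> l2_nrm P D * 1" by (intro mult_left_mono \<nu>1 D0)
    finally have E2_le': "l2_nrm P E2 \<le> l2_nrm P D" by simp
    have "AE y in M2. l2_nrm M1 (\<lambda>x. (\<lambda>z. \<Sum>m<p. d m (fst z) * l2_ip M1 (\<lambda>x. v (x, snd z)) (g m)) (x, y))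
        \<le> 1 * l2_nrm M1 (\<lambda>x. (\<lambda>z. E1 z + E2 z) (x, y))"
      using l2_slice_snd[OF e]
    proof eventually_elim
      case (elim y)
      have "(\<lambda>x. v (x, y)) = (\<lambda>x. uN (x, y) + e (x, y))" by (simp add: e_def)
      moreover have "(\<lambda>x. uN (x, y)) \<in> l2_fun M1" by (simp add: us)
      ultimately have "l2_ip M1 (\<lambda>x. v (x, y)) (g m)
          = l2_ip M1 (\<lambda>x. uN (x, y)) (g m) + l2_ip M1 (\<lambda>x. e (x, y)) (g m)" if "m < p" for m
        using elim g(1)[OF that] by (simp add: l2.ip_add)
      then show ?case by (simp add: E1_def E2_def distrib_left sum.distrib)
    qed
    then have "l2_nrm P (\<lambda>z. \<Sum>m<p. d m (fst z) * l2_ip M1 (\<lambda>x. v (x, snd z)) (g m))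
        \<le> 1 * l2_nrm P (\<lambda>z. E1 z + E2 z)"
      by (intro l2_le_snd Ein v l2.add E1 E2) auto
    also have "\<dots> \<le> l2_nrm P E1 + l2_nrm P E2" using l2.triangle[OF E1 E2] by simp
    finally show "l2_nrm P (\<lambda>z. \<Sum>m<p. d m (fst z) * l2_ip M1 (\<lambda>x. v (x, snd z)) (g m)) \<le> 3 * l2_nrm P D"
      using E1_le E2_le' by simp
  qed
  show ?thesis
    using \<delta> f(4) g(1) bound main unfolding a_def d_def by (intro exI[of _ p] exI[of _ f] exI[of _ g] exI[of _ \<delta>]) auto
qed

end

subsection \<open>Smooth functions\<close>

lemma partial_eq: "(f has_derivative f') (at x) \<Longrightarrow> partial b f x = f' b"
  using frechet_derivative_at[of f f' x] by (simp add: partial_def)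

lemma has_derivative_frechet: "f differentiable (at x) \<Longrightarrow> (f has_derivative (\<lambda>b. partial b f x)) (at x)"
  using frechet_derivative_works[of f "at x"] by (simp add: partial_def)

lemma times_cont_diff_SucD: "times_cont_diff (Suc n) f \<Longrightarrow> times_cont_diff n f"
proof (induction n arbitrary: f)
  case 0
  then show ?case
    by (auto intro!: continuous_at_imp_continuous_on differentiable_imp_continuous_within)
next
  case (Suc n)
  then show ?case by (metis times_cont_diff.simps(2))
qed

lemma times_cont_diff_const: "times_cont_diff n (\<lambda>x. c)"
proof (induction n arbitrary: c)
  case (Suc n)
  have "partial b (\<lambda>x. c) = (\<lambda>x. 0)" for b :: 'a
    by (rule ext) (simp add: partial_eq[of _ "\<lambda>_. 0"])
  then show ?case using Suc by simp
qed simp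

lemma times_cont_diff_add:
  "times_cont_diff n f \<Longrightarrow> times_cont_diff n g \<Longrightarrow> times_cont_diff n (\<lambda>x. f x + g x)"
proof (induction n arbitrary: f g)
  case (Suc n)
  have "partial b (\<lambda>x. f x + g x) = (\<lambda>x. partial b f x + partial b g x)" for b
    using Suc.prems by (intro ext partial_eq[where f' = "\<lambda>b. partial b f _ + partial b g _"]
        has_derivative_add has_derivative_frechet) auto
  then show ?case using Suc by simp
qed (simp add: continuous_on_add)

lemma times_cont_diff_mult:
  "times_cont_diff n f \<Longrightarrow> times_cont_diff n g \<Longrightarrow> times_cont_diff n (\<lambda>x. f x * g x)"
proof (induction n arbitrary: f g)
  case (Suc n)
  have eq: "partial b (\<lambda>x. f x * g x) = (\<lambda>x. f x * partial b g x + partial b f x * g x)" for b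
    using Suc.prems
    by (intro ext partial_eq[where f' = "\<lambda>b. f _ * partial b g _ + partial b f _ * g _"]
        has_derivative_mult has_derivative_frechet) auto
  have "times_cont_diff n f" "times_cont_diff n g" using Suc.prems by (blast intro: times_cont_diff_SucD)+
  then show ?case using Suc by (auto simp: eq intro!: times_cont_diff_add)
qed (simp add: continuous_on_mult)

lemma times_cont_diff_prod:
  "finite I \<Longrightarrow> (\<And>i. i \<in> I \<Longrightarrow> times_cont_diff n (f i)) \<Longrightarrow> times_cont_diff n (\<lambda>x. \<Prod>i\<in>I. f i x)"
  by (induction I rule: finite_induct) (auto intro: times_cont_diff_const times_cont_diff_mult)

lemma times_cont_diff_affine:
  fixes f :: "real \<Rightarrow> real"
  shows "times_cont_diff n f \<Longrightarrow> times_cont_diff n (\<lambda>x. f (x \<bullet> v + e))"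
proof (induction n arbitrary: f)
  case 0
  then show ?case by (auto intro!: continuous_intros continuous_on_compose2[of UNIV f])
next
  case (Suc n)
  have d: "((\<lambda>x. f (x \<bullet> v + e)) has_derivative (\<lambda>b. (b \<bullet> v) * partial 1 f (x \<bullet> v + e))) (at x)" for x
  proof -
    have d: "(f has_derivative (\<lambda>t. partial t f (x \<bullet> v + e))) (at (x \<bullet> v + e))"
      using Suc.prems by (intro has_derivative_frechet) auto
    have "partial t f (x \<bullet> v + e) = t * partial 1 f (x \<bullet> v + e)" for t
      using linear_scale[OF has_derivative_linear[OF d], of t 1] by simp
    then have "(\<lambda>t. partial t f (x \<bullet> v + e)) = (\<lambda>t. t * partial 1 f (x \<bullet> v + e))" by (rule ext)
    with d have "(f has_derivative (\<lambda>t. t * partial 1 f (x \<bullet> v + e))) (at (x \<bullet> v + e))" by (simp only:)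
    moreover have "((\<lambda>x. x \<bullet> v + e) has_derivative (\<lambda>b. b \<bullet> v)) (at x)"
      by (auto intro!: derivative_eq_intros)
    ultimately show ?thesis
      using has_derivative_compose[of "\<lambda>x. x \<bullet> v + e" "\<lambda>b. b \<bullet> v" x UNIV f] by simp
  qed
  have "partial b (\<lambda>x. f (x \<bullet> v + e)) = (\<lambda>x. (b \<bullet> v) * partial 1 f (x \<bullet> v + e))" for b
    by (rule ext) (rule partial_eq[OF d])
  moreover have "(\<lambda>x. f (x \<bullet> v + e)) differentiable (at x)" for x
    using d[of x] by (auto simp: differentiable_def)
  moreover have "times_cont_diff n (\<lambda>x. (b \<bullet> v) * partial 1 f (x \<bullet> v + e))" for b
    using Suc.prems by (intro times_cont_diff_mult times_cont_diff_const Suc.IH) simp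
  ultimately show ?case by simp
qed

lemma slice_has_derivative:
  assumes "f differentiable (at (w + t *\<^sub>R v))"
  shows "((\<lambda>t::real. f (w + t *\<^sub>R v)) has_derivative (\<lambda>s. s * partial v f (w + t *\<^sub>R v))) (at t)"
proof -
  have d: "(f has_derivative (\<lambda>b. partial b f (w + t *\<^sub>R v))) (at (w + t *\<^sub>R v))"
    using assms by (rule has_derivative_frechet)
  have "((\<lambda>t. w + t *\<^sub>R v) has_derivative (\<lambda>s. s *\<^sub>R v)) (at t)"
    by (auto intro!: derivative_eq_intros)
  then have "((\<lambda>t::real. f (w + t *\<^sub>R v)) has_derivative (\<lambda>s. partial (s *\<^sub>R v) f (w + t *\<^sub>R v))) (at t)"
    using has_derivative_compose[of "\<lambda>t. w + t *\<^sub>R v" "\<lambda>s. s *\<^sub>R v" t UNIV f] d by simp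
  then show ?thesis using linear_scale[OF has_derivative_linear[OF d]] by simp
qed

lemma partial_slice:
  assumes "f differentiable (at (w + t *\<^sub>R v))"
  shows "partial 1 (\<lambda>t::real. f (w + t *\<^sub>R v)) t = partial v f (w + t *\<^sub>R v)"
  using partial_eq[OF slice_has_derivative[OF assms], of 1] by simp

lemma times_cont_diff_slice:
  assumes "v \<in> Basis"
  shows "times_cont_diff n f \<Longrightarrow> times_cont_diff n (\<lambda>t::real. f (w + t *\<^sub>R v))"
proof (induction n arbitrary: f)
  case 0
  then show ?case by (auto intro!: continuous_intros continuous_on_compose2[of UNIV f])
next
  case (Suc n)
  have "(\<lambda>t::real. f (w + t *\<^sub>R v)) differentiable (at t)" for t
    using slice_has_derivative[of f w t v] Suc.prems by (auto simp: differentiable_def)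
  moreover have "partial 1 (\<lambda>t::real. f (w + t *\<^sub>R v)) = (\<lambda>t. partial v f (w + t *\<^sub>R v))"
    using Suc.prems by (intro ext partial_slice) auto
  ultimately show ?case using Suc assms by auto
qed

section \<open>Bumps and test functions\<close>

definition flat_exp :: "nat \<Rightarrow> real \<Rightarrow> real" where
  "flat_exp k t = (if 0 < t then exp (- 1 / t) / t ^ k else 0)"

lemma flat_exp_tendsto_0: "(flat_exp k \<longlongrightarrow> 0) (at 0)"
proof -
  have "((\<lambda>x::real. x ^ k / exp x) \<longlongrightarrow> 0) at_top" by (rule tendsto_power_div_exp_0)
  then have "((\<lambda>t::real. (inverse t) ^ k / exp (inverse t)) \<longlongrightarrow> 0) (at_right 0)"
    by (rule filterlim_compose[OF _ filterlim_inverse_at_top_right])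
  moreover have "\<forall>\<^sub>F t in at_right 0. (inverse t) ^ k / exp (inverse t) = flat_exp k t"
    unfolding eventually_at_right_field
    by (intro exI[of _ 1]) (auto simp: flat_exp_def exp_minus field_simps)
  ultimately have "(flat_exp k \<longlongrightarrow> 0) (at_right 0)" by (blast intro: Lim_transform_eventually)
  moreover have "(flat_exp k \<longlongrightarrow> 0) (at_left 0)"
    by (rule Lim_transform_eventually[OF tendsto_const])
      (auto simp: flat_exp_def eventually_at_left_field intro!: exI[of _ "-1"])
  ultimately show ?thesis by (simp add: filterlim_at_split)
qed

text \<open>The powers of \<open>t\<close> in the denominator make the family closed under
  differentiation up to linear combinations, so smoothness follows by one induction for all
  \<open>k\<close>.\<close>

lemma flat_exp_deriv:
  "(flat_exp k has_real_derivative (flat_exp (k + 2) t - k * flat_exp (k + 1) t)) (at t)"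
proof -
  consider "0 < t" | "t < 0" | "t = 0" by linarith
  then show ?thesis
  proof cases
    case 1
    have "((\<lambda>t. exp (- 1 / t) / t ^ k) has_real_derivative (flat_exp (k + 2) t - k * flat_exp (k + 1) t)) (at t)"
    proof -
      have "((\<lambda>t. exp (- 1 / t)) has_real_derivative exp (- 1 / t) / t\<^sup>2) (at t)"
        using 1 by (auto intro!: derivative_eq_intros simp: power2_eq_square)
      moreover have "t ^ k \<noteq> 0" using 1 by simp
      ultimately show ?thesis
        by (rule DERIV_cong[OF DERIV_divide[OF _ DERIV_pow]]) (use 1 in \<open>cases k; simp add: flat_exp_def field_simps power2_eq_square\<close>)
    qed
    then show ?thesis
      by (rule has_field_derivative_transform_within_open[of _ _ _ "{0<..}"]) (use 1 in \<open>auto simp: flat_exp_def\<close>)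
  next
    case 2
    have "((\<lambda>t. 0) has_real_derivative (flat_exp (k + 2) t - k * flat_exp (k + 1) t)) (at t)"
      using 2 by (auto simp: flat_exp_def)
    then show ?thesis
      by (rule has_field_derivative_transform_within_open[of _ _ _ "{..<0}"]) (use 2 in \<open>auto simp: flat_exp_def\<close>)
  next
    case 3
    have "((\<lambda>h. flat_exp (k + 1) h) \<longlongrightarrow> 0) (at 0)" by (rule flat_exp_tendsto_0)
    \<comment> \<open>The difference quotient at 0 is the next member of the family. At
      \<open>h = 0\<close> both sides are 0 by the convention for division.\<close>
    moreover have "flat_exp (k + 1) h = (flat_exp k (0 + h) - flat_exp k 0) / h" for h
      by (auto simp: flat_exp_def)
    ultimately have "((\<lambda>h. (flat_exp k (0 + h) - flat_exp k 0) / h) \<longlongrightarrow> 0) (at 0)" by simp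
    then show ?thesis using 3 by (simp add: DERIV_def flat_exp_def)
  qed
qed

lemma times_cont_diff_flat_exp: "times_cont_diff n (flat_exp k)"
proof (induction n arbitrary: k)
  case 0
  have "isCont (flat_exp k) x" for x using flat_exp_deriv by (rule DERIV_isCont)
  then show ?case by (simp add: continuous_at_imp_continuous_on)
next
  case (Suc n)
  have d: "(flat_exp k has_derivative (\<lambda>h. h * (flat_exp (k + 2) t - k * flat_exp (k + 1) t))) (at t)" for t
    by (rule has_derivative_eq_rhs[OF flat_exp_deriv[of k t, unfolded has_field_derivative_def]]) auto
  have "partial 1 (flat_exp k) = (\<lambda>t. flat_exp (k + 2) t + (- real k) * flat_exp (k + 1) t)"
    using partial_eq[OF d, of 1] by (intro ext) simp
  moreover have "flat_exp k differentiable (at t)" for t using d[of t] by (auto simp: differentiable_def)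
  moreover have "times_cont_diff n (\<lambda>t. flat_exp (k + 2) t + (- real k) * flat_exp (k + 1) t)"
    by (intro times_cont_diff_add times_cont_diff_mult times_cont_diff_const Suc)
  ultimately show ?case by simp
qed

text \<open>For \<open>n > 0\<close> it is positive exactly on the open interval from
  \<open>a + 1 / n\<close> to \<open>c - 1 / n\<close>, and as \<open>n\<close> grows it tends to
  the indicator of \<open>{a<..<c}\<close>. For \<open>n = 0\<close> both factors vanish.\<close>

definition bump :: "real \<Rightarrow> real \<Rightarrow> nat \<Rightarrow> real \<Rightarrow> real" where
  "bump a c n t = flat_exp 0 (n * (t - a) - 1) * flat_exp 0 (n * (c - t) - 1)"

lemma test_functionsI:
  assumes "\<And>n. times_cont_diff n \<phi>" "compact K" "K \<subseteq> \<Omega>" "\<And>x. x \<notin> K \<Longrightarrow> \<phi> x = 0"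
  shows "\<phi> \<in> test_functions \<Omega>"
proof -
  have "closure {x. \<phi> x \<noteq> 0} \<subseteq> K"
    using assms by (intro closure_minimal compact_imp_closed) auto
  moreover from this have "compact (closure {x. \<phi> x \<noteq> 0})"
    using compact_imp_bounded[OF assms(2)] by (auto simp: compact_eq_bounded_closed dest: bounded_subset)
  ultimately show ?thesis using assms by (auto simp: test_functions_def)
qed

lemma test_functionsE:
  assumes "\<phi> \<in> test_functions \<Omega>"
  obtains K where "compact K" "K \<subseteq> \<Omega>" "\<And>x. x \<notin> K \<Longrightarrow> \<phi> x = 0"
proof
  show "compact (closure {x. \<phi> x \<noteq> 0})" "closure {x. \<phi> x \<noteq> 0} \<subseteq> \<Omega>"
    using assms by (auto simp: test_functions_def)
  show "\<phi> x = 0" if "x \<notin> closure {x. \<phi> x \<noteq> 0}" for x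
    using that closure_subset[of "{x. \<phi> x \<noteq> 0}"] by auto
qed

lemma test_functions_smooth: "\<phi> \<in> test_functions \<Omega> \<Longrightarrow> times_cont_diff n \<phi>"
  by (simp add: test_functions_def)

lemma test_functions_zero_outside: "\<phi> \<in> test_functions \<Omega> \<Longrightarrow> x \<notin> \<Omega> \<Longrightarrow> \<phi> x = 0"
  by (meson subsetD test_functionsE)

lemma test_functions_continuous: "\<phi> \<in> test_functions \<Omega> \<Longrightarrow> continuous_on UNIV \<phi>"
  using test_functions_smooth[of \<phi> \<Omega> 0] by simp

lemma test_functions_differentiable: "\<phi> \<in> test_functions \<Omega> \<Longrightarrow> \<phi> differentiable (at x)"
  using test_functions_smooth[of \<phi> \<Omega> 1] by simp

lemma test_functions_partial:
  assumes "\<phi> \<in> test_functions \<Omega>" "b \<in> Basis"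
  shows "partial b \<phi> \<in> test_functions \<Omega>"
proof -
  obtain K where K: "compact K" "K \<subseteq> \<Omega>" "\<And>x. x \<notin> K \<Longrightarrow> \<phi> x = 0"
    by (rule test_functionsE[OF assms(1)]) (rule that)
  show ?thesis
  proof (rule test_functionsI[OF _ K(1,2)])
    show "times_cont_diff n (partial b \<phi>)" for n
      using test_functions_smooth[OF assms(1), of "Suc n"] assms(2) by simp
    show "partial b \<phi> x = 0" if "x \<notin> K" for x
    proof -
      have "(\<phi> has_derivative (\<lambda>_. 0)) (at x)"
        by (rule has_derivative_transform_within_open[of "\<lambda>_. 0" _ _ _ "- K"])
          (use K that compact_imp_closed in auto)
      then show ?thesis by (simp add: partial_eq)
    qed
  qed
qed

lemma bump_test_function:
  assumes "{a<..<c} \<subseteq> I" shows "bump a c n \<in> test_functions I"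
proof (rule test_functionsI)
  show "times_cont_diff k (bump a c n)" for k
  proof -
    have "times_cont_diff k (\<lambda>t. flat_exp 0 (t \<bullet> n + (- n * a - 1)) * flat_exp 0 (t \<bullet> (- n) + (n * c - 1)))"
      by (intro times_cont_diff_mult times_cont_diff_affine times_cont_diff_flat_exp)
    then show ?thesis by (simp add: bump_def[abs_def] algebra_simps)
  qed
  \<comment> \<open>For \<open>n = 0\<close> the formula would give the closed interval from
    \<open>a\<close> to \<open>c\<close>, as \<open>1 / 0 = 0\<close>, which need not lie in
    \<open>I\<close>; the bump is then zero and the empty set serves.\<close>
  let ?K = "if n = 0 then {} else {a + 1 / n..c - 1 / n}"
  show "compact ?K" by simp
  show "?K \<subseteq> I"
  proof (cases "n = 0")
    case False
    then have p: "0 < 1 / real n" by simp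
    have "{a + 1 / n..c - 1 / n} \<subseteq> {a<..<c}"
      unfolding subset_iff atLeastAtMost_iff greaterThanLessThan_iff using p by (intro allI) linarith
    with False assms show ?thesis by auto
  qed simp
  show "bump a c n t = 0" if "t \<notin> ?K" for t
    using that by (cases "n = 0") (auto simp: bump_def flat_exp_def field_simps)
qed

lemma flat_exp_0_le: "0 \<le> flat_exp 0 t" "flat_exp 0 t \<le> 1"
  by (auto simp: flat_exp_def)

lemma bump_bounds: "0 \<le> bump a c n t" "bump a c n t \<le> indicator {a<..<c} t"
proof -
  show "0 \<le> bump a c n t" by (simp add: bump_def flat_exp_0_le)
  show "bump a c n t \<le> indicator {a<..<c} t"
  proof (cases "t \<in> {a<..<c}")
    case True
    then show ?thesis by (auto simp: bump_def intro!: mult_le_one flat_exp_0_le)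
  next
    case False
    have "flat_exp 0 (real n * s - 1) = 0" if "s \<le> 0" for s :: real
      using that mult_nonneg_nonpos[of "real n" s] by (simp add: flat_exp_def)
    moreover have "t - a \<le> 0 \<or> c - t \<le> 0" using False by auto
    ultimately have "bump a c n t = 0"
      unfolding bump_def by (metis mult_zero_left mult_zero_right)
    then show ?thesis by simp
  qed
qed

lemma flat_exp_scaled_tendsto: assumes "0 < (s::real)" shows "(\<lambda>n. flat_exp 0 (real n * s - 1)) \<longlonglongrightarrow> 1"
proof -
  have lim: "filterlim (\<lambda>n. real n * s - 1) at_top sequentially"
    using filterlim_tendsto_add_at_top[OF tendsto_const[of "-1"]
        filterlim_at_top_mult_tendsto_pos[OF tendsto_const[of s] assms filterlim_real_sequentially]]
    by (simp add: algebra_simps)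
  then have "(\<lambda>n. exp (- 1 / (real n * s - 1))) \<longlonglongrightarrow> exp 0"
    by (intro tendsto_exp tendsto_divide_0[OF tendsto_const] filterlim_at_top_imp_at_infinity)
  moreover have "\<forall>\<^sub>F n in sequentially. exp (- 1 / (real n * s - 1)) = flat_exp 0 (real n * s - 1)"
    using lim[unfolded filterlim_at_top_dense, rule_format, of 0]
    by eventually_elim (simp add: flat_exp_def)
  ultimately have "(\<lambda>n. flat_exp 0 (real n * s - 1)) \<longlonglongrightarrow> exp 0" by (rule Lim_transform_eventually)
  then show ?thesis by simp
qed

lemma bump_tendsto: "(\<lambda>n. bump a c n t) \<longlonglongrightarrow> indicator {a<..<c} t"
proof (cases "t \<in> {a<..<c}")
  case True
  then have "(\<lambda>n. bump a c n t) \<longlonglongrightarrow> 1 * 1"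
    unfolding bump_def by (intro tendsto_mult flat_exp_scaled_tendsto) auto
  then show ?thesis using True by simp
next
  case False
  then have "bump a c n t = 0" for n using bump_bounds[of a c n t] by simp
  then show ?thesis using False by simp
qed

lemma test_functions_l2: fixes \<phi> :: "'a::euclidean_space \<Rightarrow> real"
  assumes "\<phi> \<in> test_functions \<Omega>" shows "\<phi> \<in> l2_fun lborel"
proof -
  obtain K where K: "compact K" "K \<subseteq> \<Omega>" "\<And>x. x \<notin> K \<Longrightarrow> \<phi> x = 0"
    by (rule test_functionsE[OF assms]) (rule that)
  have m: "\<phi> \<in> borel_measurable lborel"
    using borel_measurable_continuous_onI[OF test_functions_continuous[OF assms]] by simp
  have "compact (\<phi> ` K)"
    using continuous_on_subset[OF test_functions_continuous[OF assms]] K(1)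
    by (intro compact_continuous_image) auto
  then have "bounded (\<phi> ` K)" by (rule compact_imp_bounded)
  then obtain B where B: "\<And>x. x \<in> K \<Longrightarrow> \<bar>\<phi> x\<bar> \<le> B"
    unfolding bounded_iff by auto
  have "integrable lborel (indicator K :: 'a \<Rightarrow> real)"
    using emeasure_compact_finite[OF K(1)] borel_closed[OF compact_imp_closed[OF K(1)]]
    by (intro integrable_real_indicator) auto
  then have "(\<lambda>x. B * indicator K x) \<in> l2_fun lborel"
    using borel_closed[OF compact_imp_closed[OF K(1)]]
    by (intro l2.scale) (auto simp: l2_fun_def power2_eq_square indicator_inter_arith[symmetric])
  then show ?thesis
    by (rule l2_fun_bound[OF _ m]) (use B K in \<open>auto simp: indicator_def split: if_splits intro!: AE_I2 order_trans[OF B abs_ge_self]\<close>)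
qed

subsection \<open>Density of tensor products of test functions\<close>

lemma fun_span_subspace: "fun_subspace (fun_span S)"
proof
  show "(\<lambda>x. 0) \<in> fun_span S" unfolding fun_span_def by (auto intro!: exI[of _ 0])
next
  fix f g assume "f \<in> fun_span S" "g \<in> fun_span S"
  then obtain n m :: nat and c s d t where f: "\<forall>i<n. s i \<in> S" "f = (\<lambda>x. \<Sum>i<n. c i * s i x)"
    and g: "\<forall>i<m. t i \<in> S" "g = (\<lambda>x. \<Sum>i<m. d i * t i x)"
    unfolding fun_span_def by blast
  define e where "e i = (if i < n then c i else d (i - n))" for i
  define r where "r i = (if i < n then s i else t (i - n))" for i
  have "(\<Sum>i<n + m. e i * r i x) = f x + g x" for x
  proof -
    have "(\<Sum>i<n + m. e i * r i x) = (\<Sum>i<n. e i * r i x) + (\<Sum>i<m. e (n + i) * r (n + i) x)"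
      by (induction m) auto
    then show ?thesis by (simp add: f(2) g(2) e_def r_def)
  qed
  moreover have "\<forall>i<n + m. r i \<in> S" using f g by (auto simp: r_def)
  ultimately show "(\<lambda>x. f x + g x) \<in> fun_span S"
    unfolding fun_span_def by (intro CollectI exI[of _ "n + m"] exI[of _ e] exI[of _ r]) auto
next
  fix f and k :: real assume "f \<in> fun_span S"
  then obtain n :: nat and c s where f: "\<forall>i<n. s i \<in> S" "f = (\<lambda>x. \<Sum>i<n. c i * s i x)"
    unfolding fun_span_def by blast
  then show "(\<lambda>x. k * f x) \<in> fun_span S"
    unfolding fun_span_def
    by (intro CollectI exI[of _ n] exI[of _ "\<lambda>i. k * c i"] exI[of _ s]) (auto simp: sum_distrib_left mult.assoc)
qed

lemma fun_span_incl: assumes "f \<in> S" shows "f \<in> fun_span S"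
  unfolding fun_span_def using assms
  by (intro CollectI exI[of _ 1] exI[of _ "\<lambda>_. 1"] exI[of _ "\<lambda>_. f"]) auto

lemma fun_span_subset: assumes "S \<subseteq> V" "fun_subspace V" shows "fun_span S \<subseteq> V"
proof -
  interpret fun_subspace V by fact
  show ?thesis unfolding fun_span_def using assms(1) by (auto intro!: lincomb)
qed

section \<open>Closure in a seminorm\<close>

context psd_space
begin

definition nclosure :: "('a \<Rightarrow> real) set \<Rightarrow> ('a \<Rightarrow> real) set" where
  "nclosure S = {w \<in> V. \<forall>e>0. \<exists>p\<in>S. nrm (\<lambda>x. w x - p x) < e}"

lemma nclosure_incl: "S \<subseteq> V \<Longrightarrow> S \<subseteq> nclosure S"
  unfolding nclosure_def using nrm_zero by force

lemma nclosure_subspace: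
  assumes "S \<subseteq> V" "fun_subspace S" shows "fun_subspace (nclosure S)"
proof -
  interpret S: fun_subspace S by fact
  show ?thesis
  proof
    show "(\<lambda>x. 0) \<in> nclosure S" using nclosure_incl[OF assms(1)] S.zero by auto
  next
    fix f g assume f: "f \<in> nclosure S" and g: "g \<in> nclosure S"
    have fg: "f \<in> V" "g \<in> V" using f g by (auto simp: nclosure_def)
    have "\<exists>p\<in>S. nrm (\<lambda>x. f x + g x - p x) < e" if "0 < e" for e
    proof -
      have "0 < e / 2" using that by simp
      then obtain p q where p: "p \<in> S" "nrm (\<lambda>x. f x - p x) < e / 2" and q: "q \<in> S" "nrm (\<lambda>x. g x - q x) < e / 2"
        using f g unfolding nclosure_def by blast
      have "nrm (\<lambda>x. (f x - p x) + (g x - q x)) \<le> nrm (\<lambda>x. f x - p x) + nrm (\<lambda>x. g x - q x)"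
        using p q assms(1) fg by (intro triangle diff) auto
      then show ?thesis using p q by (intro bexI[of _ "\<lambda>x. p x + q x"] S.add) (auto simp: algebra_simps)
    qed
    then show "(\<lambda>x. f x + g x) \<in> nclosure S" using fg by (auto simp: nclosure_def add)
  next
    fix f and c :: real assume f: "f \<in> nclosure S"
    have fV: "f \<in> V" using f by (auto simp: nclosure_def)
    have "\<exists>p\<in>S. nrm (\<lambda>x. c * f x - p x) < e" if "0 < e" for e
    proof -
      have "0 < e / (1 + \<bar>c\<bar>)" using that by (simp add: add_pos_nonneg)
      then obtain p where p: "p \<in> S" "nrm (\<lambda>x. f x - p x) < e / (1 + \<bar>c\<bar>)"
        using f unfolding nclosure_def by blast
      have fp: "(\<lambda>x. f x - p x) \<in> V" using p assms(1) fV by (intro diff) auto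
      have "nrm (\<lambda>x. c * f x - c * p x) = \<bar>c\<bar> * nrm (\<lambda>x. f x - p x)"
        using nrm_scale[OF fp, of c] by (simp add: algebra_simps)
      also have "\<dots> \<le> (1 + \<bar>c\<bar>) * nrm (\<lambda>x. f x - p x)" using nrm_nonneg[OF fp] by (simp add: algebra_simps)
      also have "\<dots> < e" using p(2) by (simp add: field_simps add_pos_nonneg)
      finally show ?thesis using p by (intro bexI[of _ "\<lambda>x. c * p x"] S.scale) auto
    qed
    then show "(\<lambda>x. c * f x) \<in> nclosure S" using fV by (auto simp: nclosure_def scale)
  qed
qed

lemma nclosure_closed:
  assumes "S \<subseteq> V" "w \<in> V" "\<And>n. f n \<in> nclosure S" "(\<lambda>n. nrm (\<lambda>x. w x - f n x)) \<longlonglongrightarrow> 0"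
  shows "w \<in> nclosure S"
  unfolding nclosure_def
proof (intro CollectI conjI assms(2) allI impI)
  fix e :: real assume "0 < e"
  then obtain n where n: "nrm (\<lambda>x. w x - f n x) < e / 2"
    using order_tendstoD(2)[OF assms(4), of "e / 2"] by (auto simp: eventually_sequentially)
  have fV: "f n \<in> V" using assms(3) by (auto simp: nclosure_def)
  obtain p where p: "p \<in> S" "nrm (\<lambda>x. f n x - p x) < e / 2"
    using assms(3)[of n] \<open>0 < e\<close> unfolding nclosure_def by (auto dest!: spec[of _ "e / 2"])
  have "nrm (\<lambda>x. (w x - f n x) + (f n x - p x)) \<le> nrm (\<lambda>x. w x - f n x) + nrm (\<lambda>x. f n x - p x)"
    using p assms fV by (intro triangle diff) auto
  then show "\<exists>p\<in>S. nrm (\<lambda>x. w x - p x) < e" using n p by (intro bexI[of _ p]) auto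
qed

end

lemma l2_dominated:
  assumes g: "g \<in> l2_fun M" and f: "\<And>n. f n \<in> borel_measurable M" and w: "w \<in> borel_measurable M"
    and le: "\<And>n x. x \<in> space M \<Longrightarrow> \<bar>f n x\<bar> \<le> g x" and lim: "\<And>x. x \<in> space M \<Longrightarrow> (\<lambda>n. f n x) \<longlonglongrightarrow> w x"
  shows "w \<in> l2_fun M" "\<And>n. f n \<in> l2_fun M" "(\<lambda>n. l2_nrm M (\<lambda>x. w x - f n x)) \<longlonglongrightarrow> 0"
proof -
  have wle: "\<bar>w x\<bar> \<le> g x" if "x \<in> space M" for x
    by (rule LIMSEQ_le_const2[OF tendsto_rabs[OF lim[OF that]]]) (use le that in auto)
  show wL: "w \<in> l2_fun M"
    by (rule l2_fun_bound[OF g w]) (rule AE_I2, metis abs_ge_self order_trans wle)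
  show fL: "f n \<in> l2_fun M" for n
    by (rule l2_fun_bound[OF g f]) (rule AE_I2, metis abs_ge_self order_trans le)
  have "(\<lambda>n. LINT x|M. (w x - f n x)\<^sup>2) \<longlonglongrightarrow> (LINT x|M. 0)"
  proof (rule integral_dominated_convergence)
    show "integrable M (\<lambda>x. 4 * (g x)\<^sup>2)" using g by (simp add: l2_fun_sq)
    show "AE x in M. (\<lambda>n. (w x - f n x)\<^sup>2) \<longlonglongrightarrow> 0"
    proof (rule AE_I2)
      fix x assume "x \<in> space M"
      then have "(\<lambda>n. (w x - f n x)\<^sup>2) \<longlonglongrightarrow> (w x - w x)\<^sup>2" by (intro tendsto_intros lim)
      then show "(\<lambda>n. (w x - f n x)\<^sup>2) \<longlonglongrightarrow> 0" by simp
    qed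
    show "AE x in M. norm ((w x - f n x)\<^sup>2) \<le> 4 * (g x)\<^sup>2" for n
    proof (rule AE_I2)
      fix x assume x: "x \<in> space M"
      have "\<bar>w x - f n x\<bar> \<le> \<bar>2 * g x\<bar>" using wle[OF x] le[OF x, of n] by linarith
      then have "(w x - f n x)\<^sup>2 \<le> (2 * g x)\<^sup>2" by (rule abs_le_square_iff[THEN iffD1])
      then show "norm ((w x - f n x)\<^sup>2) \<le> 4 * (g x)\<^sup>2" by (simp add: power_mult_distrib)
    qed
  qed (use f w in auto)
  then have "(\<lambda>n. sqrt (LINT x|M. (w x - f n x)\<^sup>2)) \<longlonglongrightarrow> sqrt 0" by (intro tendsto_real_sqrt) simp
  then show "(\<lambda>n. l2_nrm M (\<lambda>x. w x - f n x)) \<longlonglongrightarrow> 0"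
    by (simp add: ip_norm_def l2_ip_def power2_eq_square)
qed

section \<open>Density, from bumps to boxes, Borel sets and functions\<close>

definition tensor_tests :: "('a::euclidean_space \<Rightarrow> real set) \<Rightarrow> ('a \<Rightarrow> real) set" where
  "tensor_tests I = {\<lambda>x. \<Prod>b\<in>Basis. \<psi> b (x \<bullet> b) |\<psi>. \<forall>b\<in>Basis. \<psi> b \<in> test_functions (I b)}"

lemma tensor_test_function:
  assumes "\<And>b. b \<in> Basis \<Longrightarrow> \<psi> b \<in> test_functions (I b)"
  shows "(\<lambda>x::'a::euclidean_space. \<Prod>b\<in>Basis. \<psi> b (x \<bullet> b)) \<in> test_functions {x. \<forall>b\<in>Basis. x \<bullet> b \<in> I b}"
proof -
  have "\<forall>b\<in>Basis. \<exists>K. compact K \<and> K \<subseteq> I b \<and> (\<forall>t. t \<notin> K \<longrightarrow> \<psi> b t = 0)"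
    using test_functionsE[OF assms] by metis
  then obtain K where K: "\<And>b. b \<in> Basis \<Longrightarrow> compact (K b)" "\<And>b. b \<in> Basis \<Longrightarrow> K b \<subseteq> I b"
    "\<And>b t. b \<in> Basis \<Longrightarrow> t \<notin> K b \<Longrightarrow> \<psi> b t = 0" by metis
  define KK where "KK = {x::'a. \<forall>b\<in>Basis. x \<bullet> b \<in> K b}"
  have "closed KK"
  proof -
    have "KK = (\<Inter>b\<in>Basis. (\<lambda>x. x \<bullet> b) -` K b)" by (auto simp: KK_def)
    moreover have "closed ((\<lambda>x. x \<bullet> b) -` K b)" if "b \<in> Basis" for b :: 'a
      using compact_imp_closed[OF K(1)[OF that]] by (intro continuous_closed_vimage) (auto intro!: continuous_intros)
    ultimately show ?thesis by auto
  qed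
  moreover have "bounded KK"
  proof -
    have "\<forall>b\<in>Basis. \<exists>B. \<forall>t\<in>K b. \<bar>t\<bar> \<le> B"
      using compact_imp_bounded[OF K(1)] unfolding bounded_iff by simp
    then obtain B where B: "\<And>b t. b \<in> Basis \<Longrightarrow> t \<in> K b \<Longrightarrow> \<bar>t\<bar> \<le> B b" by metis
    have "norm x \<le> (\<Sum>b\<in>Basis. B b)" if "x \<in> KK" for x
    proof -
      have "norm x \<le> (\<Sum>b\<in>Basis. \<bar>x \<bullet> b\<bar>)" by (rule norm_le_l1)
      also have "\<dots> \<le> (\<Sum>b\<in>Basis. B b)" using that by (intro sum_mono B) (auto simp: KK_def)
      finally show ?thesis .
    qed
    then show ?thesis unfolding bounded_iff by blast
  qed
  ultimately have "compact KK" by (simp add: compact_eq_bounded_closed)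
  then show ?thesis
  proof (rule test_functionsI[rotated])
    show "KK \<subseteq> {x. \<forall>b\<in>Basis. x \<bullet> b \<in> I b}" using K(2) by (auto simp: KK_def)
    show "(\<Prod>b\<in>Basis. \<psi> b (x \<bullet> b)) = 0" if "x \<notin> KK" for x
      using that K(3) by (auto simp: KK_def)
    show "times_cont_diff n (\<lambda>x::'a. \<Prod>b\<in>Basis. \<psi> b (x \<bullet> b))" for n
    proof (intro times_cont_diff_prod)
      show "times_cont_diff n (\<lambda>x. \<psi> b (x \<bullet> b))" if "b \<in> Basis" for b
        using times_cont_diff_affine[OF test_functions_smooth[OF assms[OF that]], of n b 0] by simp
    qed simp
  qed
qed

definition coord_product :: "('a::euclidean_space \<Rightarrow> real set) \<Rightarrow> 'a set" where
  "coord_product I = {x. \<forall>b\<in>Basis. x \<bullet> b \<in> I b}"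

lemma tensor_tests_subset: "tensor_tests I \<subseteq> test_functions (coord_product I)"
  using tensor_test_function[where I = I] by (auto simp: tensor_tests_def coord_product_def)

lemma tensor_tests_l2: "fun_span (tensor_tests I) \<subseteq> l2_fun lborel"
  using tensor_tests_subset test_functions_l2 by (intro fun_span_subset l2.fun_subspace_axioms) auto

context
  fixes I :: "'a::euclidean_space \<Rightarrow> real set"
  assumes open_I: "\<And>b. b \<in> Basis \<Longrightarrow> open (I b)"
begin

abbreviation "cl \<equiv> l2.nclosure lborel (fun_span (tensor_tests I))"

lemma cl_subspace: "fun_subspace cl"
  by (intro l2.nclosure_subspace tensor_tests_l2 fun_span_subspace)

text \<open>Closedness under dominated pointwise limits; every later enlargement of the class of
  functions in \<open>cl\<close> rests on such a limit.\<close>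

lemma cl_dominated:
  assumes "g \<in> l2_fun lborel" "\<And>n. f n \<in> cl" "w \<in> borel_measurable lborel"
    "\<And>n x. \<bar>f n x\<bar> \<le> g x" "\<And>x. (\<lambda>n. f n x) \<longlonglongrightarrow> w x"
  shows "w \<in> cl"
proof -
  have "f n \<in> l2_fun lborel" for n using assms(2)[of n] by (simp add: l2.nclosure_def)
  then have m: "f n \<in> borel_measurable lborel" for n by (rule l2_fun_meas)
  show ?thesis
    by (rule l2.nclosure_closed[OF tensor_tests_l2 l2_dominated(1)[OF assms(1) m assms(3-5)] assms(2)
        l2_dominated(3)[OF assms(1) m assms(3-5)]])
qed

lemma indicator_l2:
  assumes "A \<in> sets borel" "emeasure lborel A < \<infinity>"
  shows "(indicator A :: 'a \<Rightarrow> real) \<in> l2_fun lborel"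
  using integrable_real_indicator[of A lborel] assms
  by (simp add: l2_fun_def power2_eq_square indicator_inter_arith[symmetric])

lemma indicator_box_cl:
  assumes "box a c \<subseteq> coord_product I"
  shows "(indicator (box a c) :: 'a \<Rightarrow> real) \<in> cl"
proof (cases "box a c = {}")
  case True
  then show ?thesis using fun_subspace.zero[OF cl_subspace] by (simp add: indicator_def[abs_def])
next
  case False
  then obtain x0 where x0: "x0 \<in> box a c" by auto
  have sub: "{a \<bullet> b<..<c \<bullet> b} \<subseteq> I b" if b: "b \<in> Basis" for b
  proof
    fix t assume t: "t \<in> {a \<bullet> b<..<c \<bullet> b}"
    \<comment> \<open>As the box is nonempty, each \<open>t\<close> between the bounds is a
      coordinate of a point of the box, obtained by moving \<open>x0\<close> along
      \<open>b\<close>.\<close>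
    define x where "x = x0 + (t - x0 \<bullet> b) *\<^sub>R b"
    have xb: "x \<bullet> b' = (if b' = b then t else x0 \<bullet> b')" if "b' \<in> Basis" for b'
      using that b by (auto simp: x_def inner_add_left inner_Basis)
    then have "x \<in> box a c" using x0 t by (auto simp: mem_box)
    then have "x \<bullet> b \<in> I b" using assms b by (auto simp: coord_product_def)
    then show "t \<in> I b" using xb[OF b] by simp
  qed
  have ind: "indicator (box a c) x = (\<Prod>b\<in>Basis. indicator {a \<bullet> b<..<c \<bullet> b} (x \<bullet> b) :: real)" for x
  proof (cases "x \<in> box a c")
    case False
    then obtain b where "b \<in> Basis" "x \<bullet> b \<notin> {a \<bullet> b<..<c \<bullet> b}" by (auto simp: mem_box)
    then have "(\<Prod>b\<in>Basis. indicator {a \<bullet> b<..<c \<bullet> b} (x \<bullet> b) :: real) = 0"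
      by (intro prod_zero bexI[of _ b]) (simp_all add: indicator_def)
    then show ?thesis using False by simp
  qed (auto simp: mem_box)
  define f where "f n x = (\<Prod>b\<in>Basis. bump (a \<bullet> b) (c \<bullet> b) n (x \<bullet> b))" for n x
  have ft: "f n \<in> tensor_tests I" for n
    unfolding tensor_tests_def f_def[abs_def]
    by (intro CollectI exI[of _ "\<lambda>b. bump (a \<bullet> b) (c \<bullet> b) n"]) (auto intro!: bump_test_function sub)
  show ?thesis
  proof (rule cl_dominated[where f = f and g = "indicator (box a c)"])
    show "indicator (box a c) \<in> l2_fun lborel" by (rule indicator_l2) (auto simp: emeasure_lborel_box_eq)
    show "f n \<in> cl" for n
      using l2.nclosure_incl[OF tensor_tests_l2] fun_span_incl[OF ft] by blast
    show "\<bar>f n x\<bar> \<le> indicator (box a c) x" for n x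
      unfolding ind f_def abs_prod by (intro prod_mono) (auto simp: bump_bounds abs_of_nonneg)
    show "(\<lambda>n. f n x) \<longlonglongrightarrow> indicator (box a c) x" for x
      unfolding ind f_def by (intro tendsto_prod bump_tendsto)
  qed auto
qed

text \<open>A Dynkin argument: boxes are stable under intersection and generate the Borel sets.
  Intersecting with one fixed box keeps all measures finite, so complements are differences in
  \<open>cl\<close> and countable unions are dominated limits.\<close>

lemma indicator_Int_box_cl:
  assumes "box a c \<subseteq> coord_product I" "B \<in> sets borel"
  shows "(indicator (B \<inter> box a c) :: 'a \<Rightarrow> real) \<in> cl"
proof -
  interpret cl: fun_subspace cl by (rule cl_subspace)
  let ?G = "range (\<lambda>(a, b). box a b :: 'a set)"
  have sets: "sigma_sets UNIV ?G = sets borel" by (subst borel_eq_box) simp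
  have "Int_stable ?G" by (auto simp: Int_stable_def box_Int_box)
  moreover have "?G \<subseteq> Pow UNIV" by auto
  moreover have "B \<in> sigma_sets UNIV ?G" using assms(2) by (simp add: sets)
  ultimately show ?thesis
  proof (induction B rule: sigma_sets_induct_disjoint)
    case (basic A)
    then obtain a' c' where "A = box a' c'" by auto
    then obtain a'' c'' where eq: "A \<inter> box a c = box a'' c''" by (auto simp: box_Int_box)
    then have "box a'' c'' \<subseteq> coord_product I" using assms(1) by blast
    then show ?case unfolding eq by (rule indicator_box_cl)
  next
    case empty
    then show ?case using cl.zero by (simp add: indicator_def[abs_def])
  next
    case (compl A)
    have "indicator ((UNIV - A) \<inter> box a c) = (\<lambda>x. indicator (box a c) x - indicator (A \<inter> box a c) x :: real)"
      by (auto simp: fun_eq_iff indicator_def)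
    then show ?case using cl.diff[OF indicator_box_cl[OF assms(1)] compl(2)] by simp
  next
    case (union A)
    have A: "A i \<in> sets borel" for i using union(2) sets by auto
    show ?case
    proof (rule cl_dominated[where f = "\<lambda>n. indicator ((\<Union>i<n. A i) \<inter> box a c)"
          and g = "indicator (box a c)"])
      show "indicator (box a c) \<in> l2_fun lborel" by (rule indicator_l2) (auto simp: emeasure_lborel_box_eq)
      show "indicator ((\<Union>i<n. A i) \<inter> box a c) \<in> cl" for n
      proof -
        have "indicator ((\<Union>i<n. A i) \<inter> box a c) = (\<lambda>x. \<Sum>i<n. indicator (A i \<inter> box a c) x :: real)"
        proof
          fix x
          have "indicator (\<Union>i\<in>{..<n}. A i) x = (\<Sum>i<n. indicator (A i) x :: real)"
            using union(1) by (intro indicator_UN_disjoint) (auto simp: disjoint_family_on_def)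
          then show "indicator ((\<Union>i<n. A i) \<inter> box a c) x = (\<Sum>i<n. indicator (A i \<inter> box a c) x :: real)"
            by (simp add: indicator_inter_arith sum_distrib_right)
        qed
        then show ?thesis using union(3) by (auto intro!: cl.sum)
      qed
      show "(\<lambda>n. indicator ((\<Union>i<n. A i) \<inter> box a c) x :: real) \<longlonglongrightarrow> indicator ((\<Union>i. A i) \<inter> box a c) x" for x
        unfolding indicator_inter_arith by (intro tendsto_mult tendsto_const LIMSEQ_indicator_UN)
      show "\<bar>indicator ((\<Union>i<n. A i) \<inter> box a c) x\<bar> \<le> (indicator (box a c) x :: real)" for n x
        by (auto simp: indicator_def)
      show "(indicator ((\<Union>i. A i) \<inter> box a c) :: 'a \<Rightarrow> real) \<in> borel_measurable lborel"
        using A by (intro borel_measurable_indicator) auto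
    qed
  qed
qed

lemma open_coord_product: "open (coord_product I)"
proof -
  have "coord_product I = (\<Inter>b\<in>Basis. (\<lambda>x. x \<bullet> b) -` I b)" by (auto simp: coord_product_def)
  moreover have "open ((\<lambda>x. x \<bullet> b) -` I b)" if "b \<in> Basis" for b :: 'a
    using open_I[OF that] by (intro continuous_open_vimage) (auto intro!: continuous_intros)
  ultimately show ?thesis by auto
qed

text \<open>The open product is a countable union of boxes. \<open>B\<close> is exhausted by its
  parts in the first \<open>n\<close> of them, each new box contributing only what the earlier ones
  have missed.\<close>

lemma indicator_cl:
  assumes "B \<in> sets borel" "B \<subseteq> coord_product I" "emeasure lborel B < \<infinity>"
  shows "(indicator B :: 'a \<Rightarrow> real) \<in> cl"
proof -
  interpret cl: fun_subspace cl by (rule cl_subspace)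
  obtain \<D> where \<D>: "countable \<D>" "\<D> \<subseteq> Pow (coord_product I)" "\<And>X. X \<in> \<D> \<Longrightarrow> \<exists>a b. X = box a b"
    "\<Union>\<D> = coord_product I" by (rule open_countable_Union_open_box[OF open_coord_product]) (rule that)
  show ?thesis
  proof (cases "\<D> = {}")
    case True
    then have "B = {}" using \<D>(4) assms(2) by auto
    then show ?thesis using cl.zero by (simp add: indicator_def[abs_def])
  next
    case False
    define R where "R = from_nat_into \<D>"
    have R: "R i \<in> \<D>" for i unfolding R_def by (rule from_nat_into[OF False])
    have UR: "(\<Union>i. R i) = coord_product I"
      unfolding R_def using range_from_nat_into[OF False \<D>(1)] \<D>(4) by simp
    have Rb: "\<exists>a c. R i = box a c \<and> box a c \<subseteq> coord_product I" for i
      using \<D>(3)[OF R[of i]] subsetD[OF \<D>(2) R[of i]] by auto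
    then have Rm: "R i \<in> sets borel" for i by (metis borel_open open_box)
    show ?thesis
    proof (rule cl_dominated[where f = "\<lambda>n. indicator (B \<inter> (\<Union>i<n. R i))" and g = "indicator B"])
      show "indicator B \<in> l2_fun lborel" by (rule indicator_l2) (use assms in auto)
      show "indicator (B \<inter> (\<Union>i<n. R i)) \<in> cl" for n
      proof (induction n)
        case 0
        then show ?case using cl.zero by (simp add: indicator_def[abs_def])
      next
        case (Suc n)
        obtain a c where ac: "R n = box a c" "box a c \<subseteq> coord_product I" using Rb by blast
        have "indicator (B \<inter> (\<Union>i<Suc n. R i))
          = (\<lambda>x. indicator (B \<inter> (\<Union>i<n. R i)) x + indicator ((B - (\<Union>i<n. R i)) \<inter> R n) x :: real)"
          by (auto simp: fun_eq_iff indicator_def lessThan_Suc)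
        moreover have "(indicator ((B - (\<Union>i<n. R i)) \<inter> R n) :: 'a \<Rightarrow> real) \<in> cl"
          unfolding ac(1) using assms(1) Rm by (intro indicator_Int_box_cl ac(2)) auto
        ultimately show ?case using cl.add[OF Suc] by simp
      qed
      show "(\<lambda>n. indicator (B \<inter> (\<Union>i<n. R i)) x :: real) \<longlonglongrightarrow> indicator B x" for x
      proof -
        have "(\<lambda>n. indicator B x * indicator (\<Union>i<n. R i) x :: real) \<longlonglongrightarrow> indicator B x * indicator (\<Union>i. R i) x"
          by (intro tendsto_mult tendsto_const LIMSEQ_indicator_UN)
        then show ?thesis
          unfolding indicator_inter_arith[symmetric] UR using assms(2) by (simp add: Int_absorb2)
      qed
      show "\<bar>indicator (B \<inter> (\<Union>i<n. R i)) x\<bar> \<le> (indicator B x :: real)" for n x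
        by (auto simp: indicator_def)
      show "(indicator B :: 'a \<Rightarrow> real) \<in> borel_measurable lborel" using assms(1) by simp
    qed
  qed
qed

text \<open>The standard induction on nonnegative measurable functions. Square integrability and
  vanishing outside the product are premises inside the induction, since the parts inherit them from
  the whole by lying below it.\<close>

lemma nonneg_cl:
  assumes "w \<in> l2_fun lborel" "\<And>x. 0 \<le> w x" "\<And>x. x \<notin> coord_product I \<Longrightarrow> w x = 0"
  shows "w \<in> cl"
proof -
  interpret cl: fun_subspace cl by (rule cl_subspace)
  have "w \<in> borel_measurable lborel" using assms(1) by (auto simp: l2_fun_def)
  from this assms(2) have "w \<in> l2_fun lborel \<longrightarrow> (\<forall>x. x \<notin> coord_product I \<longrightarrow> w x = 0) \<longrightarrow> w \<in> cl"
  proof (induction w rule: borel_measurable_induct_real)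
    case (set A)
    show ?case
    proof (intro impI)
      assume A: "(indicator A :: 'a \<Rightarrow> real) \<in> l2_fun lborel"
        and 0: "\<forall>x. x \<notin> coord_product I \<longrightarrow> indicator A x = (0::real)"
      have "A \<subseteq> coord_product I" using 0 by (auto simp: indicator_def split: if_splits)
      moreover have "emeasure lborel A < \<infinity>"
        using l2_fun_sq[OF A] by (simp add: power2_eq_square indicator_inter_arith[symmetric] integrable_indicator_iff)
      ultimately show "(indicator A :: 'a \<Rightarrow> real) \<in> cl" using set by (intro indicator_cl) auto
    qed
  next
    case (mult u c)
    show ?case
    proof (cases "c = 0")
      case True
      then show ?thesis using cl.zero by simp
    next
      case False
      show ?thesis
      proof (intro impI)
        assume "(\<lambda>x. c * u x) \<in> l2_fun lborel" "\<forall>x. x \<notin> coord_product I \<longrightarrow> c * u x = 0"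
        then have "u \<in> l2_fun lborel" "\<forall>x. x \<notin> coord_product I \<longrightarrow> u x = 0"
          using False l2.scale[of "\<lambda>x. c * u x" lborel "1 / c"] by auto
        then show "(\<lambda>x. c * u x) \<in> cl" using mult by (intro cl.scale) auto
      qed
    qed
  next
    case (add u v)
    show ?case
    proof (intro impI)
      assume L: "(\<lambda>x. v x + u x) \<in> l2_fun lborel" and 0: "\<forall>x. x \<notin> coord_product I \<longrightarrow> v x + u x = 0"
      have "u \<in> l2_fun lborel" "v \<in> l2_fun lborel"
        using add by (auto intro!: l2_fun_bound[OF L] AE_I2)
      moreover have "u x = 0 \<and> v x = 0" if "x \<notin> coord_product I" for x
        using add.hyps(2)[of x] add.hyps(4)[of x] 0 that by (auto simp: add_nonneg_eq_0_iff)
      ultimately show "(\<lambda>x. v x + u x) \<in> cl" using add by (intro cl.add) auto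
    qed
  next
    case (seq U)
    show ?case
    proof (intro impI)
      assume L: "w \<in> l2_fun lborel" and 0: "\<forall>x. x \<notin> coord_product I \<longrightarrow> w x = 0"
      have le: "U i x \<le> w x" for i x
        using seq.hyps(3,4) by (intro incseq_le) (auto simp: incseq_def le_fun_def)
      show "w \<in> cl"
      proof (rule cl_dominated[OF L])
        show "U i \<in> cl" for i
        proof -
          have "U i \<in> l2_fun lborel"
            using seq.hyps(1,2) le assms(2) by (intro l2_fun_bound[OF L] AE_I2) (auto simp: abs_of_nonneg)
          moreover have "U i x = 0" if "x \<notin> coord_product I" for x
            using 0 that le[of i x] seq.hyps(2)[of i x] by (intro antisym) auto
          ultimately show ?thesis using seq.IH by auto
        qed
        show "\<bar>U i x\<bar> \<le> w x" for i x using seq.hyps(2) le by (simp add: abs_of_nonneg)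
      qed (use seq L in \<open>auto simp: l2_fun_def\<close>)
    qed
  qed
  with assms show ?thesis by blast
qed

theorem tensor_tests_dense:
  assumes "w \<in> l2_fun lborel" "\<And>x. x \<notin> coord_product I \<Longrightarrow> w x = 0"
  shows "w \<in> cl"
proof -
  interpret cl: fun_subspace cl by (rule cl_subspace)
  have "w \<in> borel_measurable lborel" using assms(1) by (auto simp: l2_fun_def)
  then have "(\<lambda>x. max 0 (w x)) \<in> cl" "(\<lambda>x. max 0 (- w x)) \<in> cl"
    using assms(2) by (intro nonneg_cl l2_fun_bound[OF assms(1)] AE_I2; simp; fail)+
  from cl.diff[OF this] show ?thesis by (simp add: max_def if_distrib cong: if_cong)
qed

end

lemma (in psd_space) nclosure_orthogonal:
  assumes "S \<subseteq> V" "w \<in> nclosure S" "\<And>p. p \<in> S \<Longrightarrow> ip w p = 0"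
  shows "nrm w = 0"
proof (rule ccontr)
  have w: "w \<in> V" using assms(2) by (auto simp: nclosure_def)
  assume "nrm w \<noteq> 0"
  then have pos: "0 < nrm w" using nrm_nonneg[OF w] by simp
  then obtain p where p: "p \<in> S" "nrm (\<lambda>x. w x - p x) < nrm w" using assms(2) by (auto simp: nclosure_def)
  have pV: "p \<in> V" using p assms(1) by auto
  have "(nrm w)\<^sup>2 = ip w (\<lambda>x. w x - p x)" using assms(3)[OF p(1)] w pV by (simp add: nrm_sq ip_diff_right)
  also have "\<dots> \<le> nrm w * nrm (\<lambda>x. w x - p x)" using Cauchy_Schwarz[OF w diff[OF w pV]] by simp
  also have "\<dots> < nrm w * nrm w" using p(2) pos by simp
  finally show False by (simp add: power2_eq_square)
qed

subsection \<open>Separating one coordinate\<close>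

abbreviation other_coords :: "'d::finite \<Rightarrow> ('d \<Rightarrow> real) measure" where
  "other_coords j \<equiv> \<Pi>\<^sub>M k\<in>UNIV - {j}. lborel"

text \<open>The entry of \<open>snd z\<close> at \<open>j\<close> is ignored, so the full coordinate
  function \<open>($) x\<close> may take the place of a function on the remaining indices.\<close>

definition insert_coord :: "'d::finite \<Rightarrow> real \<times> ('d \<Rightarrow> real) \<Rightarrow> real ^ 'd" where
  "insert_coord j z = (\<chi> k. if k = j then fst z else snd z k)"

lemma insert_coord_nth: "insert_coord j z $ k = (if k = j then fst z else snd z k)"
  by (simp add: insert_coord_def)

interpretation lborel_product: product_sigma_finite "\<lambda>k. lborel :: real measure"
  by standard

interpretation coord: pair_sigma_finite "lborel :: real measure" "other_coords j" for j :: "'d::finite"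
  by (intro pair_sigma_finite.intro sigma_finite_lborel lborel_product.sigma_finite) simp

lemma insert_coord_measurable [measurable]:
  fixes j :: "'d::finite"
  shows "insert_coord j \<in> (lborel \<Otimes>\<^sub>M other_coords j) \<rightarrow>\<^sub>M borel"
proof -
  have "(\<lambda>z. if k = j then fst z else snd z k) \<in> borel_measurable ((lborel :: real measure) \<Otimes>\<^sub>M other_coords j)" for k
  proof (cases "k = j")
    case False
    then have "(\<lambda>z. snd z k) \<in> borel_measurable ((lborel :: real measure) \<Otimes>\<^sub>M other_coords j)"
      using measurable_compose[OF measurable_snd measurable_component_singleton[of k "UNIV - {j}" "\<lambda>_. lborel"]]
      by simp
    with False show ?thesis by simp
  qed simp
  then have "(\<lambda>z. \<Sum>k\<in>UNIV. (if k = j then fst z else snd z k) *\<^sub>R (axis k 1 :: real ^ 'd))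
      \<in> borel_measurable ((lborel :: real measure) \<Otimes>\<^sub>M other_coords j)" by measurable
  moreover have "insert_coord j z = (\<Sum>k\<in>UNIV. (if k = j then fst z else snd z k) *\<^sub>R (axis k 1 :: real ^ 'd))" for z
  proof (rule vec_eq_iff[THEN iffD2], rule allI)
    fix i
    define c where "c k = (if k = j then fst z else snd z k)" for k
    have "(\<Sum>k\<in>UNIV. c k *\<^sub>R (axis k 1 :: real ^ 'd)) $ i = (\<Sum>k\<in>UNIV. if k = i then c i else 0)"
      unfolding sum_component by (intro sum.cong) (auto simp: axis_def)
    then show "insert_coord j z $ i = (\<Sum>k\<in>UNIV. (if k = j then fst z else snd z k) *\<^sub>R (axis k 1 :: real ^ 'd)) $ i"
      by (simp add: c_def insert_coord_nth)
  qed
  ultimately show ?thesis by (simp add: fun_eq_iff[symmetric] cong: measurable_cong)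
qed

lemma prod_Basis_vec:
  fixes f :: "real ^ 'd::finite \<Rightarrow> 'b::comm_monoid_mult"
  shows "(\<Prod>b\<in>Basis. f b) = (\<Prod>k\<in>UNIV. f (axis k 1))"
proof -
  have "inj (\<lambda>k. axis k 1 :: real ^ 'd)" by (auto simp: inj_def axis_eq_axis)
  from prod.reindex[OF this, of f] show ?thesis by (simp add: o_def Basis_vec_def UNION_singleton_eq_range)
qed

text \<open>The preimage of a box is a product of intervals, so both measures give it the product of
  the side lengths, which characterises Lebesgue measure. This makes the results on products of two
  measure spaces available on \<open>real ^ 'd\<close>.\<close>

lemma distr_insert_coord: "distr (lborel \<Otimes>\<^sub>M other_coords j) borel (insert_coord j) = (lborel :: (real ^ 'd::finite) measure)"
proof (rule sym, rule lborel_eqI)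
  fix l u :: "real ^ 'd"
  assume "\<And>b. b \<in> Basis \<Longrightarrow> l \<bullet> b \<le> u \<bullet> b"
  then have le: "l $ k \<le> u $ k" for k by (simp add: cart_eq_inner_axis axis_in_Basis_iff)
  let ?B = "\<Pi>\<^sub>E k\<in>UNIV - {j}. {l $ k<..<u $ k}"
  have "emeasure (distr (lborel \<Otimes>\<^sub>M other_coords j) borel (insert_coord j)) (box l u)
      = emeasure (lborel \<Otimes>\<^sub>M other_coords j) ({l $ j<..<u $ j} \<times> ?B)"
  proof (subst emeasure_distr)
    have "insert_coord j -` box l u \<inter> space (lborel \<Otimes>\<^sub>M other_coords j) = {l $ j<..<u $ j} \<times> ?B"
    proof (intro set_eqI)
      fix z :: "real \<times> ('d \<Rightarrow> real)"
      have "insert_coord j z \<in> box l u \<longleftrightarrow>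
          (\<forall>k. l $ k < insert_coord j z $ k \<and> insert_coord j z $ k < u $ k)"
        by (simp add: mem_box_cart)
      also have "\<dots> \<longleftrightarrow> fst z \<in> {l $ j<..<u $ j} \<and> (\<forall>k. k \<noteq> j \<longrightarrow> snd z k \<in> {l $ k<..<u $ k})"
        by (auto simp: insert_coord_nth)
      finally show "z \<in> insert_coord j -` box l u \<inter> space (lborel \<Otimes>\<^sub>M other_coords j)
          \<longleftrightarrow> z \<in> {l $ j<..<u $ j} \<times> ?B"
        by (cases z) (auto simp: space_pair_measure space_PiM PiE_def Pi_def)
    qed
    then show "emeasure (lborel \<Otimes>\<^sub>M other_coords j) (insert_coord j -` box l u \<inter> space (lborel \<Otimes>\<^sub>M other_coords j))
       = emeasure (lborel \<Otimes>\<^sub>M other_coords j) ({l $ j<..<u $ j} \<times> ?B)" by simp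
  qed auto
  also have "\<dots> = emeasure lborel {l $ j<..<u $ j} * emeasure (other_coords j) ?B"
    by (intro coord.M2.emeasure_pair_measure_Times) (auto intro!: sets_PiM_I_finite)
  also have "emeasure (other_coords j) ?B = (\<Prod>k\<in>UNIV - {j}. emeasure lborel {l $ k<..<u $ k})"
    by (intro lborel_product.emeasure_PiM) auto
  also have "emeasure lborel {l $ j<..<u $ j} * \<dots> = (\<Prod>k\<in>UNIV. emeasure lborel {l $ k<..<u $ k})"
    by (rule prod.remove[symmetric]) auto
  also have "\<dots> = (\<Prod>k\<in>UNIV. ennreal (u $ k - l $ k))" using le by simp
  also have "\<dots> = ennreal (\<Prod>k\<in>UNIV. u $ k - l $ k)" using le by (intro prod_ennreal) auto
  also have "(\<Prod>k\<in>UNIV. u $ k - l $ k) = (\<Prod>b\<in>Basis. (u - l) \<bullet> b)"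
    by (simp add: prod_Basis_vec cart_eq_inner_axis inner_diff_left)
  finally show "emeasure (distr (lborel \<Otimes>\<^sub>M other_coords j) borel (insert_coord j)) (box l u)
      = ennreal (\<Prod>b\<in>Basis. (u - l) \<bullet> b)" .
qed simp

lemma l2_fun_insert_coord:
  assumes "w \<in> borel_measurable (lborel :: (real ^ 'd::finite) measure)"
  shows "w \<in> l2_fun lborel \<longleftrightarrow> (\<lambda>z. w (insert_coord j z)) \<in> l2_fun (lborel \<Otimes>\<^sub>M other_coords j)"
proof -
  have [measurable]: "w \<in> borel_measurable borel" using assms by simp
  have "integrable (distr (lborel \<Otimes>\<^sub>M other_coords j) borel (insert_coord j)) (\<lambda>x. (w x)\<^sup>2)
      \<longleftrightarrow> integrable (lborel \<Otimes>\<^sub>M other_coords j) (\<lambda>z. (w (insert_coord j z))\<^sup>2)"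
    by (rule integrable_distr_eq) auto
  then show ?thesis by (simp add: l2_fun_def distr_insert_coord)
qed

lemma l2_ip_insert_coord:
  fixes v w :: "real ^ 'd::finite \<Rightarrow> real"
  assumes "v \<in> borel_measurable lborel" "w \<in> borel_measurable lborel"
  shows "l2_ip lborel v w
    = l2_ip (lborel \<Otimes>\<^sub>M other_coords j) (\<lambda>z. v (insert_coord j z)) (\<lambda>z. w (insert_coord j z))"
proof -
  have [measurable]: "w \<in> borel_measurable borel" "v \<in> borel_measurable borel" using assms by simp_all
  have "(LINT x|distr (lborel \<Otimes>\<^sub>M other_coords j) borel (insert_coord j). v x * w x)
      = (LINT z|(lborel \<Otimes>\<^sub>M other_coords j). v (insert_coord j z) * w (insert_coord j z))"
    by (rule integral_distr) auto
  then show ?thesis by (simp add: l2_ip_def distr_insert_coord)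
qed

lemma l2_nrm_insert_coord:
  fixes w :: "real ^ 'd::finite \<Rightarrow> real"
  assumes "w \<in> borel_measurable lborel"
  shows "l2_nrm lborel w = l2_nrm (lborel \<Otimes>\<^sub>M other_coords j) (\<lambda>z. w (insert_coord j z))"
  using l2_ip_insert_coord[OF assms assms] by (simp add: ip_norm_def)

text \<open>For a bounded sequence, weak convergence need only be tested on a dense set. It will be
  applied to differences of derivatives, which are accessible through test functions only.\<close>

lemma (in psd_space) weak_null_nclosure:
  assumes "S \<subseteq> V" "z \<in> nclosure S" and w: "\<And>n. w n \<in> V" "\<And>n::nat. nrm (w n) \<le> M"
    and lim: "\<And>p. p \<in> S \<Longrightarrow> (\<lambda>n. ip p (w n)) \<longlonglongrightarrow> 0"
  shows "(\<lambda>n. ip z (w n)) \<longlonglongrightarrow> 0"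
proof (rule LIMSEQ_I)
  fix r :: real assume r: "0 < r"
  have z: "z \<in> V" using assms(2) by (auto simp: nclosure_def)
  have "0 < r / (2 * (\<bar>M\<bar> + 1))" using r by (simp add: add_nonneg_pos)
  then obtain p where p: "p \<in> S" "nrm (\<lambda>x. z x - p x) < r / (2 * (\<bar>M\<bar> + 1))"
    using assms(2) unfolding nclosure_def by blast
  have pV: "p \<in> V" using p assms(1) by auto
  have zp: "(\<lambda>x. z x - p x) \<in> V" by (intro diff z pV)
  obtain N where N: "\<And>n. n \<ge> N \<Longrightarrow> \<bar>ip p (w n)\<bar> < r / 2"
    using LIMSEQ_D[OF lim[OF p(1)], of "r / 2"] r by auto
  have "\<bar>ip z (w n)\<bar> < r" if "n \<ge> N" for n
  proof -
    have "\<bar>ip (\<lambda>x. z x - p x) (w n)\<bar> \<le> nrm (\<lambda>x. z x - p x) * nrm (w n)"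
      by (rule Cauchy_Schwarz[OF zp w(1)])
    also have "\<dots> \<le> r / (2 * (\<bar>M\<bar> + 1)) * (\<bar>M\<bar> + 1)"
      using p(2) w(2)[of n] nrm_nonneg[OF zp] nrm_nonneg[OF w(1)[of n]] by (intro mult_mono) auto
    also have "\<dots> = r / 2" using add_nonneg_pos[of "\<bar>M\<bar>" 1] by (simp add: field_simps)
    finally have "\<bar>ip z (w n) - ip p (w n)\<bar> \<le> r / 2" by (simp add: ip_diff z pV w)
    with N[OF that] show ?thesis by linarith
  qed
  then show "\<exists>N. \<forall>n\<ge>N. norm (ip z (w n) - 0) < r" by auto
qed

lemma (in psd_space) ip_null_cong:
  assumes "f \<in> V" "g \<in> V" "h \<in> V" "nrm (\<lambda>x. f x - g x) = 0"
  shows "ip f h = ip g h"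
  using Cauchy_Schwarz[OF diff[OF assms(1,2)] assms(3)] assms by (simp add: ip_diff)

subsection \<open>Weak derivatives\<close>

text \<open>Extension by zero turns norms and inner products on \<Omega> into those of the whole
  space, so that a single space \<open>l2_fun lborel\<close> serves for all domains.\<close>

definition cut :: "'a set \<Rightarrow> ('a \<Rightarrow> real) \<Rightarrow> 'a \<Rightarrow> real" where
  "cut \<Omega> f = (\<lambda>x. indicator \<Omega> x * f x)"

lemma cut_add: "cut \<Omega> (\<lambda>x. f x + g x) = (\<lambda>x. cut \<Omega> f x + cut \<Omega> g x)"
  by (simp add: cut_def distrib_left)

lemma cut_diff: "cut \<Omega> (\<lambda>x. f x - g x) = (\<lambda>x. cut \<Omega> f x - cut \<Omega> g x)"
  by (simp add: cut_def right_diff_distrib)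

lemma cut_scale: "cut \<Omega> (\<lambda>x. c * f x) = (\<lambda>x. c * cut \<Omega> f x)"
  by (simp add: cut_def mult_ac)

lemma cut_outside: "x \<notin> \<Omega> \<Longrightarrow> cut \<Omega> f x = 0"
  by (simp add: cut_def)

lemma cut_inside: "x \<in> \<Omega> \<Longrightarrow> cut \<Omega> f x = f x"
  by (simp add: cut_def)

lemma cut_ident: "(\<And>x. x \<notin> \<Omega> \<Longrightarrow> f x = 0) \<Longrightarrow> cut \<Omega> f = f"
  by (auto simp: cut_def fun_eq_iff indicator_def)

lemma L2_iff: "f \<in> L2 \<Omega> \<longleftrightarrow> cut \<Omega> f \<in> l2_fun lborel"
proof -
  have "(\<lambda>x. indicator \<Omega> x *\<^sub>R (f x)\<^sup>2) = (\<lambda>x. (cut \<Omega> f x)\<^sup>2)"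
    by (auto simp: cut_def indicator_def fun_eq_iff)
  then show ?thesis
    by (simp add: L2_def l2_fun_def set_borel_measurable_def set_integrable_def) (simp add: cut_def)
qed

lemma L2_inner_cut: "L2_inner \<Omega> f g = l2_ip lborel (cut \<Omega> f) (cut \<Omega> g)"
  unfolding L2_inner_def l2_ip_def set_lebesgue_integral_def
  by (rule Bochner_Integration.integral_cong) (auto simp: cut_def indicator_def)

lemma has_weak_partial_iff:
  "has_weak_partial \<Omega> b f g \<longleftrightarrow>
    (\<forall>\<phi>\<in>test_functions \<Omega>. l2_ip lborel (cut \<Omega> f) (partial b \<phi>) = - l2_ip lborel (cut \<Omega> g) \<phi>)"
  by (simp add: has_weak_partial_def set_lebesgue_integral_def l2_ip_def cut_def mult.assoc)

lemma L2_subspace: "fun_subspace (L2 \<Omega>)"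
  by unfold_locales (auto simp: L2_iff cut_add cut_scale l2.add l2.scale l2.zero cut_def[of \<Omega> "\<lambda>x. 0"])

lemma test_functions_L2: "\<phi> \<in> test_functions \<Omega> \<Longrightarrow> \<phi> \<in> L2 \<Omega>"
  using cut_ident[of \<Omega> \<phi>] test_functions_zero_outside[of \<phi> \<Omega>] test_functions_l2[of \<phi> \<Omega>]
  by (simp add: L2_iff)

lemma has_weak_partial_lincomb:
  assumes "\<And>i. i < (n::nat) \<Longrightarrow> f i \<in> L2 \<Omega>" "\<And>i. i < n \<Longrightarrow> g i \<in> L2 \<Omega>" "b \<in> Basis"
    and "\<And>i. i < n \<Longrightarrow> has_weak_partial \<Omega> b (f i) (g i)"
  shows "has_weak_partial \<Omega> b (\<lambda>x. \<Sum>i<n. c i * f i x) (\<lambda>x. \<Sum>i<n. c i * g i x)"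
  unfolding has_weak_partial_iff
proof
  fix \<phi> assume \<phi>: "\<phi> \<in> test_functions \<Omega>"
  have c: "cut \<Omega> (\<lambda>x. \<Sum>i<n. c i * h i x) = (\<lambda>x. \<Sum>i<n. c i * cut \<Omega> (h i) x)" for h
    by (simp add: cut_def sum_distrib_left mult_ac)
  have 1: "partial b \<phi> \<in> l2_fun lborel" "\<phi> \<in> l2_fun lborel"
    using test_functions_l2 test_functions_partial[OF \<phi> assms(3)] \<phi> by auto
  have "l2_ip lborel (cut \<Omega> (f i)) (partial b \<phi>) = - l2_ip lborel (cut \<Omega> (g i)) \<phi>" if "i < n" for i
    using assms(4)[OF that] \<phi> by (simp add: has_weak_partial_iff)
  then show "l2_ip lborel (cut \<Omega> (\<lambda>x. \<Sum>i<n. c i * f i x)) (partial b \<phi>)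
      = - l2_ip lborel (cut \<Omega> (\<lambda>x. \<Sum>i<n. c i * g i x)) \<phi>"
    unfolding c using assms(1,2) 1 by (simp add: l2.ip_lincomb L2_iff sum_negf)
qed

lemma has_weak_partial_add:
  assumes "f \<in> L2 \<Omega>" "f' \<in> L2 \<Omega>" "g \<in> L2 \<Omega>" "g' \<in> L2 \<Omega>" "b \<in> Basis"
    "has_weak_partial \<Omega> b f f'" "has_weak_partial \<Omega> b g g'"
  shows "has_weak_partial \<Omega> b (\<lambda>x. f x + g x) (\<lambda>x. f' x + g' x)"
  using has_weak_partial_lincomb[of 2 "\<lambda>i. if i = 0 then f else g" \<Omega> "\<lambda>i. if i = 0 then f' else g'" b "\<lambda>_. 1"]
    assms by (simp add: numeral_2_eq_2)

lemma has_weak_partial_scale: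
  assumes "f \<in> L2 \<Omega>" "f' \<in> L2 \<Omega>" "b \<in> Basis" "has_weak_partial \<Omega> b f f'"
  shows "has_weak_partial \<Omega> b (\<lambda>x. c * f x) (\<lambda>x. c * f' x)"
  using has_weak_partial_lincomb[of 1 "\<lambda>i. f" \<Omega> "\<lambda>i. f'" b "\<lambda>_. c"] assms by simp

lemma weak_partial:
  assumes "f \<in> H1 \<Omega>" "b \<in> Basis"
  shows "weak_partial \<Omega> b f \<in> L2 \<Omega>" "has_weak_partial \<Omega> b f (weak_partial \<Omega> b f)"
proof -
  have "\<exists>g. g \<in> L2 \<Omega> \<and> has_weak_partial \<Omega> b f g" using assms by (auto simp: H1_def)
  from someI_ex[OF this] show "weak_partial \<Omega> b f \<in> L2 \<Omega>" "has_weak_partial \<Omega> b f (weak_partial \<Omega> b f)"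
    by (auto simp: weak_partial_def)
qed

lemma H1_L2: "f \<in> H1 \<Omega> \<Longrightarrow> f \<in> L2 \<Omega>"
  by (simp add: H1_def)

text \<open>One locale for the product domain and for each factor, the latter being a product over
  the one-element basis of the reals. Openness of the factors gives density of the test
  functions.\<close>

locale coord_domain =
  fixes \<Omega> :: "'a::euclidean_space set" and I :: "'a \<Rightarrow> real set"
  assumes open_I: "b \<in> Basis \<Longrightarrow> open (I b)" and \<Omega>: "\<Omega> = coord_product I"
begin

text \<open>The difference of two weak derivatives is orthogonal to all tensor products of test
  functions, and these are dense.\<close>

lemma weak_partial_unique:
  assumes "g \<in> L2 \<Omega>" "h \<in> L2 \<Omega>" "has_weak_partial \<Omega> b f g" "has_weak_partial \<Omega> b f h"
  shows "l2_nrm lborel (\<lambda>x. cut \<Omega> g x - cut \<Omega> h x) = 0"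
proof -
  have d: "(\<lambda>x. cut \<Omega> g x - cut \<Omega> h x) \<in> l2_fun lborel"
    using assms(1,2) by (intro l2.diff) (auto simp: L2_iff)
  have test: "l2_ip lborel (\<lambda>x. cut \<Omega> g x - cut \<Omega> h x) \<phi> = 0" if "\<phi> \<in> tensor_tests I" for \<phi>
  proof -
    have "\<phi> \<in> test_functions \<Omega>" using that tensor_tests_subset[of I] by (auto simp: \<Omega>)
    then show ?thesis
      using assms test_functions_l2[of \<phi> \<Omega>] by (simp add: has_weak_partial_iff L2_iff l2.ip_diff)
  qed
  show ?thesis
  proof (rule l2.nclosure_orthogonal[OF tensor_tests_l2])
    show "(\<lambda>x. cut \<Omega> g x - cut \<Omega> h x) \<in> l2.nclosure lborel (fun_span (tensor_tests I))"
      by (rule tensor_tests_dense[OF open_I d]) (auto simp: cut_def \<Omega>)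
    show "l2_ip lborel (\<lambda>x. cut \<Omega> g x - cut \<Omega> h x) p = 0" if "p \<in> fun_span (tensor_tests I)" for p
    proof -
      obtain n :: nat and c s where p: "\<forall>i<n. s i \<in> tensor_tests I" "p = (\<lambda>x. \<Sum>i<n. c i * s i x)"
        using \<open>p \<in> fun_span (tensor_tests I)\<close> unfolding fun_span_def by blast
      have "s i \<in> l2_fun lborel" if "i < n" for i
        using p(1) that tensor_tests_subset[of I] test_functions_l2 by blast
      then show ?thesis unfolding p(2) using d p(1) test by (subst l2.ip_lincomb_right) auto
    qed
  qed
qed

lemma weak_partial_ip:
  assumes "f \<in> H1 \<Omega>" "b \<in> Basis" "g \<in> L2 \<Omega>" "has_weak_partial \<Omega> b f g" "h \<in> l2_fun lborel"
  shows "l2_ip lborel (cut \<Omega> (weak_partial \<Omega> b f)) h = l2_ip lborel (cut \<Omega> g) h"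
  using weak_partial[OF assms(1,2)] assms(3-5)
  by (intro l2.ip_null_cong weak_partial_unique) (auto simp: L2_iff)

lemma H1_add: assumes "f \<in> H1 \<Omega>" "g \<in> H1 \<Omega>" shows "(\<lambda>x. f x + g x) \<in> H1 \<Omega>"
proof -
  have "\<exists>h\<in>L2 \<Omega>. has_weak_partial \<Omega> b (\<lambda>x. f x + g x) h" if "b \<in> Basis" for b
    using weak_partial[OF assms(1) that] weak_partial[OF assms(2) that] H1_L2[OF assms(1)] H1_L2[OF assms(2)] that
    by (intro bexI[of _ "\<lambda>x. weak_partial \<Omega> b f x + weak_partial \<Omega> b g x"] has_weak_partial_add
        fun_subspace.add[OF L2_subspace])
  then show ?thesis
    using fun_subspace.add[OF L2_subspace] H1_L2[OF assms(1)] H1_L2[OF assms(2)] by (auto simp: H1_def)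
qed

lemma H1_scale: assumes "f \<in> H1 \<Omega>" shows "(\<lambda>x. c * f x) \<in> H1 \<Omega>"
proof -
  have "\<exists>h\<in>L2 \<Omega>. has_weak_partial \<Omega> b (\<lambda>x. c * f x) h" if "b \<in> Basis" for b
    using weak_partial[OF assms that] H1_L2[OF assms] that
    by (intro bexI[of _ "\<lambda>x. c * weak_partial \<Omega> b f x"] has_weak_partial_scale
        fun_subspace.scale[OF L2_subspace])
  then show ?thesis
    using fun_subspace.scale[OF L2_subspace] H1_L2[OF assms] by (auto simp: H1_def)
qed

lemma H1_inner_cut:
  "H1_inner \<Omega> f g = l2_ip lborel (cut \<Omega> f) (cut \<Omega> g)
    + (\<Sum>b\<in>Basis. l2_ip lborel (cut \<Omega> (weak_partial \<Omega> b f)) (cut \<Omega> (weak_partial \<Omega> b g)))"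
  by (simp add: H1_inner_def L2_inner_cut)

text \<open>\<open>weak_partial\<close> is an arbitrary choice and not linear as a function.
  Uniqueness allows any other weak derivatives in its place, and taking sums and multiples of given
  ones yields the bilinearity in \<open>H1_psd\<close>.\<close>

lemma H1_inner_eq:
  assumes f: "f \<in> H1 \<Omega>" "\<And>b. b \<in> Basis \<Longrightarrow> f' b \<in> L2 \<Omega> \<and> has_weak_partial \<Omega> b f (f' b)"
    and g: "g \<in> H1 \<Omega>" "\<And>b. b \<in> Basis \<Longrightarrow> g' b \<in> L2 \<Omega> \<and> has_weak_partial \<Omega> b g (g' b)"
  shows "H1_inner \<Omega> f g = l2_ip lborel (cut \<Omega> f) (cut \<Omega> g)
    + (\<Sum>b\<in>Basis. l2_ip lborel (cut \<Omega> (f' b)) (cut \<Omega> (g' b)))"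
proof -
  have "l2_ip lborel (cut \<Omega> (weak_partial \<Omega> b f)) (cut \<Omega> (weak_partial \<Omega> b g))
      = l2_ip lborel (cut \<Omega> (f' b)) (cut \<Omega> (g' b))" if b: "b \<in> Basis" for b
  proof -
    have L: "cut \<Omega> (weak_partial \<Omega> b g) \<in> l2_fun lborel" "cut \<Omega> (g' b) \<in> l2_fun lborel" "cut \<Omega> (f' b) \<in> l2_fun lborel"
      using weak_partial(1)[OF g(1) b] f(2)[OF b] g(2)[OF b] by (auto simp: L2_iff)
    have "l2_ip lborel (cut \<Omega> (weak_partial \<Omega> b f)) (cut \<Omega> (weak_partial \<Omega> b g))
        = l2_ip lborel (cut \<Omega> (f' b)) (cut \<Omega> (weak_partial \<Omega> b g))"
      using f(2)[OF b] by (intro weak_partial_ip f(1) b L) auto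
    also have "\<dots> = l2_ip lborel (cut \<Omega> (weak_partial \<Omega> b g)) (cut \<Omega> (f' b))" using L by (intro l2.ip_sym)
    also have "\<dots> = l2_ip lborel (cut \<Omega> (g' b)) (cut \<Omega> (f' b))"
      using g(2)[OF b] by (intro weak_partial_ip g(1) b L) auto
    also have "\<dots> = l2_ip lborel (cut \<Omega> (f' b)) (cut \<Omega> (g' b))" using L by (intro l2.ip_sym)
    finally show ?thesis .
  qed
  then show ?thesis by (simp add: H1_inner_cut)
qed

lemma H1_psd: "psd_space (H1 \<Omega>) (H1_inner \<Omega>)"
proof
  fix f g h and c :: real
  have "has_weak_partial \<Omega> b (\<lambda>x. 0) (\<lambda>x. 0)" for b by (simp add: has_weak_partial_iff cut_def l2_ip_def)
  then show "(\<lambda>x. 0) \<in> H1 \<Omega>" using fun_subspace.zero[OF L2_subspace] by (auto simp: H1_def)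
  assume f: "f \<in> H1 \<Omega>"
  have wf: "weak_partial \<Omega> b f \<in> L2 \<Omega> \<and> has_weak_partial \<Omega> b f (weak_partial \<Omega> b f)" if "b \<in> Basis" for b
    using weak_partial[OF f that] by simp
  have cf: "cut \<Omega> f \<in> l2_fun lborel" "b \<in> Basis \<Longrightarrow> cut \<Omega> (weak_partial \<Omega> b f) \<in> l2_fun lborel" for b
    using H1_L2[OF f] wf by (auto simp: L2_iff)
  show "(\<lambda>x. c * f x) \<in> H1 \<Omega>" by (rule H1_scale[OF f])
  show "0 \<le> H1_inner \<Omega> f f" unfolding H1_inner_cut
    using cf by (intro add_nonneg_nonneg sum_nonneg l2.ip_nonneg)
  {
    assume h: "h \<in> H1 \<Omega>"
    have wh: "weak_partial \<Omega> b h \<in> L2 \<Omega> \<and> has_weak_partial \<Omega> b h (weak_partial \<Omega> b h)" if "b \<in> Basis" for b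
      using weak_partial[OF h that] by simp
    have ch: "cut \<Omega> h \<in> l2_fun lborel" "b \<in> Basis \<Longrightarrow> cut \<Omega> (weak_partial \<Omega> b h) \<in> l2_fun lborel" for b
      using H1_L2[OF h] wh by (auto simp: L2_iff)
    have "H1_inner \<Omega> (\<lambda>x. c * f x) h = l2_ip lborel (cut \<Omega> (\<lambda>x. c * f x)) (cut \<Omega> h)
      + (\<Sum>b\<in>Basis. l2_ip lborel (cut \<Omega> (\<lambda>x. c * weak_partial \<Omega> b f x)) (cut \<Omega> (weak_partial \<Omega> b h)))"
      using wf wh f
      by (intro H1_inner_eq H1_scale h)
        (auto intro!: has_weak_partial_scale fun_subspace.scale[OF L2_subspace] H1_L2[OF f])
    also have "\<dots> = c * H1_inner \<Omega> f h"
      unfolding cut_scale H1_inner_cut using cf ch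
      by (simp add: l2.ip_scale sum_distrib_left distrib_left)
    finally show "H1_inner \<Omega> (\<lambda>x. c * f x) h = c * H1_inner \<Omega> f h" .
  }
  assume g: "g \<in> H1 \<Omega>"
  have wg: "weak_partial \<Omega> b g \<in> L2 \<Omega> \<and> has_weak_partial \<Omega> b g (weak_partial \<Omega> b g)" if "b \<in> Basis" for b
    using weak_partial[OF g that] by simp
  have cg: "cut \<Omega> g \<in> l2_fun lborel" "b \<in> Basis \<Longrightarrow> cut \<Omega> (weak_partial \<Omega> b g) \<in> l2_fun lborel" for b
    using H1_L2[OF g] wg by (auto simp: L2_iff)
  show "(\<lambda>x. f x + g x) \<in> H1 \<Omega>" by (rule H1_add[OF f g])
  show "H1_inner \<Omega> f g = H1_inner \<Omega> g f"
    unfolding H1_inner_cut using cf cg by (simp add: l2.ip_sym cong: sum.cong)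
  assume h: "h \<in> H1 \<Omega>"
  have wh: "weak_partial \<Omega> b h \<in> L2 \<Omega> \<and> has_weak_partial \<Omega> b h (weak_partial \<Omega> b h)" if "b \<in> Basis" for b
    using weak_partial[OF h that] by simp
  have ch: "cut \<Omega> h \<in> l2_fun lborel" "b \<in> Basis \<Longrightarrow> cut \<Omega> (weak_partial \<Omega> b h) \<in> l2_fun lborel" for b
    using H1_L2[OF h] wh by (auto simp: L2_iff)
  have "H1_inner \<Omega> (\<lambda>x. f x + g x) h = l2_ip lborel (cut \<Omega> (\<lambda>x. f x + g x)) (cut \<Omega> h)
    + (\<Sum>b\<in>Basis. l2_ip lborel (cut \<Omega> (\<lambda>x. weak_partial \<Omega> b f x + weak_partial \<Omega> b g x)) (cut \<Omega> (weak_partial \<Omega> b h)))"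
    using wf wg wh f g
    by (intro H1_inner_eq H1_add h)
      (auto intro!: has_weak_partial_add fun_subspace.add[OF L2_subspace] H1_L2[OF f] H1_L2[OF g])
  also have "\<dots> = H1_inner \<Omega> f h + H1_inner \<Omega> g h"
    unfolding cut_add H1_inner_cut using cf cg ch by (simp add: l2.ip_add sum.distrib)
  finally show "H1_inner \<Omega> (\<lambda>x. f x + g x) h = H1_inner \<Omega> f h + H1_inner \<Omega> g h" .
qed

lemma H1_norm_eq: "H1_norm \<Omega> f = ip_norm (H1_inner \<Omega>) f"
  by (simp add: H1_norm_def ip_norm_def)

lemma H1_closure_incl: assumes "f \<in> S" "f \<in> H1 \<Omega>" shows "f \<in> H1_closure \<Omega> S"
proof -
  interpret psd_space "H1 \<Omega>" "H1_inner \<Omega>" by (rule H1_psd)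
  show ?thesis using assms by (auto simp: H1_closure_def H1_norm_eq nrm_zero intro!: bexI[of _ f])
qed

end

subsection \<open>Elementary tensors\<close>

definition rest_tensor :: "'d::finite \<Rightarrow> ('d \<Rightarrow> real \<Rightarrow> real) \<Rightarrow> ('d \<Rightarrow> real) \<Rightarrow> real" where
  "rest_tensor j g y = (\<Prod>k\<in>UNIV - {j}. g k (y k))"

lemma rest_tensor_l2:
  assumes "\<And>k. k \<noteq> j \<Longrightarrow> g k \<in> l2_fun lborel"
  shows "rest_tensor j g \<in> l2_fun (other_coords j)"
proof -
  have gm: "(\<lambda>y. g k (y k)) \<in> borel_measurable (other_coords j)" if "k \<noteq> j" for k
    using measurable_compose[OF measurable_component_singleton[of k "UNIV - {j}" "\<lambda>_. lborel"] l2_fun_meas[OF assms[OF that]]] that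
    by simp
  have "rest_tensor j g \<in> borel_measurable (other_coords j)"
    unfolding rest_tensor_def[abs_def] using gm by (intro borel_measurable_prod) auto
  moreover have "integrable (other_coords j) (\<lambda>y. \<Prod>k\<in>UNIV - {j}. (g k (y k))\<^sup>2)"
    using l2_fun_sq[OF assms] by (intro lborel_product.product_integrable_prod) auto
  ultimately show ?thesis by (simp add: l2_fun_def rest_tensor_def prod_power_distrib)
qed

lemma elementary_tensor_insert:
  "elementary_tensor v (insert_coord j z) = v j (fst z) * rest_tensor j v (snd z)"
proof -
  have "elementary_tensor v (insert_coord j z) = v j (insert_coord j z $ j) * (\<Prod>k\<in>UNIV - {j}. v k (insert_coord j z $ k))"
    unfolding elementary_tensor_def by (rule prod.remove) auto
  then show ?thesis by (simp add: insert_coord_nth rest_tensor_def)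
qed

lemma rest_tensor_cong: "(\<And>k. k \<noteq> j \<Longrightarrow> v k = w k) \<Longrightarrow> rest_tensor j v = rest_tensor j w"
  by (auto simp: rest_tensor_def fun_eq_iff intro!: prod.cong)

lemma elementary_tensor_measurable:
  fixes v :: "'d::finite \<Rightarrow> real \<Rightarrow> real"
  assumes "\<And>k. v k \<in> borel_measurable lborel"
  shows "elementary_tensor v \<in> borel_measurable lborel"
proof -
  have "(\<lambda>x. v k (x $ k)) \<in> borel_measurable (lborel :: (real ^ 'd) measure)" for k
  proof -
    have "(\<lambda>x :: real ^ 'd. x $ k) \<in> borel_measurable borel"
      by (intro borel_measurable_continuous_onI continuous_on_component continuous_on_id)
    moreover have "v k \<in> borel_measurable borel" using assms[of k] by simp
    ultimately have "(\<lambda>x :: real ^ 'd. v k (x $ k)) \<in> borel_measurable borel" by (rule measurable_compose)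
    then show ?thesis by simp
  qed
  then show ?thesis unfolding elementary_tensor_def[abs_def] by measurable
qed

lemma elementary_tensor_l2:
  fixes v :: "'d::finite \<Rightarrow> real \<Rightarrow> real"
  assumes "\<And>k. v k \<in> l2_fun lborel"
  shows "elementary_tensor v \<in> l2_fun lborel"
proof -
  fix j :: 'd
  have m: "elementary_tensor v \<in> borel_measurable lborel"
    using assms by (intro elementary_tensor_measurable l2_fun_meas)
  show ?thesis
    \<comment> \<open>Any coordinate may be split off; \<open>undefined\<close> stands for an
      arbitrary one.\<close>
    unfolding l2_fun_insert_coord[OF m, of undefined] elementary_tensor_insert
    by (intro coord.l2_tensor assms rest_tensor_l2)
qed

context pair_sigma_finite
begin

lemma l2_ip_contraction_fst:
  assumes "v \<in> l2_fun (M1 \<Otimes>\<^sub>M M2)" "a \<in> l2_fun M1" "f \<in> l2_fun M2"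
  shows "l2_ip M1 (\<lambda>x. l2_ip M2 (\<lambda>y. v (x, y)) f) a = l2_ip (M1 \<Otimes>\<^sub>M M2) v (\<lambda>z. a (fst z) * f (snd z))"
proof -
  have "l2_ip (M1 \<Otimes>\<^sub>M M2) v (\<lambda>z. a (fst z) * f (snd z))
      = (LINT x|M1. LINT y|M2. v (x, y) * (a x * f y))"
    using integral_fst'[OF l2_integrable_mult[OF assms(1) l2_tensor[OF assms(2,3)]]] by (simp add: l2_ip_def)
  also have "\<dots> = (LINT x|M1. l2_ip M2 (\<lambda>y. v (x, y)) f * a x)"
  proof (rule Bochner_Integration.integral_cong[OF refl])
    fix x
    have "(\<lambda>y. v (x, y) * (a x * f y)) = (\<lambda>y. a x * (v (x, y) * f y))" by (simp add: mult_ac)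
    then show "(LINT y|M2. v (x, y) * (a x * f y)) = l2_ip M2 (\<lambda>y. v (x, y)) f * a x"
      by (simp add: l2_ip_def)
  qed
  finally show ?thesis by (simp add: l2_ip_def)
qed

lemma l2_ip_contraction_snd:
  assumes "v \<in> l2_fun (M1 \<Otimes>\<^sub>M M2)" "a \<in> l2_fun M1" "f \<in> l2_fun M2"
  shows "l2_ip M2 (\<lambda>y. l2_ip M1 (\<lambda>x. v (x, y)) a) f = l2_ip (M1 \<Otimes>\<^sub>M M2) v (\<lambda>z. a (fst z) * f (snd z))"
proof -
  have "integrable (M1 \<Otimes>\<^sub>M M2) (case_prod (\<lambda>x y. v (x, y) * (a x * f y)))"
    using l2_integrable_mult[OF assms(1) l2_tensor[OF assms(2,3)]] by (simp add: split_def)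
  then have "l2_ip (M1 \<Otimes>\<^sub>M M2) v (\<lambda>z. a (fst z) * f (snd z))
      = (LINT y|M2. LINT x|M1. v (x, y) * (a x * f y))"
    using integral_snd[of "\<lambda>x y. v (x, y) * (a x * f y)"] by (simp add: l2_ip_def split_def)
  also have "\<dots> = (LINT y|M2. l2_ip M1 (\<lambda>x. v (x, y)) a * f y)"
  proof (rule Bochner_Integration.integral_cong[OF refl])
    fix y
    have "(\<lambda>x. v (x, y) * (a x * f y)) = (\<lambda>x. f y * (v (x, y) * a x))" by (simp add: mult_ac)
    then show "(LINT x|M1. v (x, y) * (a x * f y)) = l2_ip M1 (\<lambda>x. v (x, y)) a * f y"
      by (simp add: l2_ip_def)
  qed
  finally show ?thesis by (simp add: l2_ip_def)
qed

end

lemma product_domain_coord: "product_domain \<Omega> = coord_product (\<lambda>b. \<Omega> (axis_index b))"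
proof -
  have "axis_index (axis k (1::real)) = k" for k
    using axis_index[of "axis k (1::real)"] by (auto simp: axis_in_Basis_iff axis_eq_axis)
  then show ?thesis
    by (auto simp: product_domain_def coord_product_def Basis_vec_def cart_eq_inner_axis)
qed

lemma elementary_tensor_Basis: "(\<lambda>x. \<Prod>b\<in>Basis. \<psi> b (x \<bullet> b)) = elementary_tensor (\<lambda>k. \<psi> (axis k 1))"
  by (simp add: fun_eq_iff elementary_tensor_def prod_Basis_vec cart_eq_inner_axis)

lemma tensor_tests_vec:
  fixes \<Omega> :: "'d::finite \<Rightarrow> real set"
  shows "tensor_tests (\<lambda>b. \<Omega> (axis_index b)) = {elementary_tensor \<psi> |\<psi>. \<forall>k. \<psi> k \<in> test_functions (\<Omega> k)}"
proof -
  have ax: "axis_index (axis k (1::real)) = k" for k :: 'd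
    using axis_index[of "axis k (1::real)"] by (auto simp: axis_in_Basis_iff axis_eq_axis)
  show ?thesis
  proof (intro set_eqI iffI)
    fix f :: "real ^ 'd \<Rightarrow> real" assume "f \<in> tensor_tests (\<lambda>b. \<Omega> (axis_index b))"
    then obtain \<psi> where "f = (\<lambda>x. \<Prod>b\<in>Basis. \<psi> b (x \<bullet> b))" "\<forall>b\<in>Basis. \<psi> b \<in> test_functions (\<Omega> (axis_index b))"
      unfolding tensor_tests_def by blast
    then have "f = elementary_tensor (\<lambda>k. \<psi> (axis k 1))" "\<forall>k. \<psi> (axis k 1) \<in> test_functions (\<Omega> k)"
      by (auto simp: elementary_tensor_Basis axis_in_Basis_iff ax dest: bspec[of _ _ "axis _ 1"])
    then show "f \<in> {elementary_tensor \<psi> |\<psi>. \<forall>k. \<psi> k \<in> test_functions (\<Omega> k)}" by blast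
  next
    fix f :: "real ^ 'd \<Rightarrow> real" assume "f \<in> {elementary_tensor \<psi> |\<psi>. \<forall>k. \<psi> k \<in> test_functions (\<Omega> k)}"
    then obtain \<psi> where "f = elementary_tensor \<psi>" "\<forall>k. \<psi> k \<in> test_functions (\<Omega> k)" by blast
    then show "f \<in> tensor_tests (\<lambda>b. \<Omega> (axis_index b))"
      unfolding tensor_tests_def
      by (intro CollectI exI[of _ "\<lambda>b. \<psi> (axis_index b)"]) (simp add: elementary_tensor_Basis[of "\<lambda>b. \<psi> (axis_index b)"] ax)
  qed
qed

lemma cut_elementary_tensor: "cut (product_domain \<Omega>) (elementary_tensor v) = elementary_tensor (\<lambda>k. cut (\<Omega> k) (v k))"
proof
  fix x
  have "indicator (product_domain \<Omega>) x = (\<Prod>k\<in>UNIV. indicator (\<Omega> k) (x $ k) :: real)"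
  proof (cases "x \<in> product_domain \<Omega>")
    case False
    then obtain k where k: "x $ k \<notin> \<Omega> k" by (auto simp: product_domain_def)
    then have "(\<Prod>k\<in>UNIV. indicator (\<Omega> k) (x $ k) :: real) = 0" by (intro prod_zero bexI[of _ k]) auto
    with False show ?thesis by simp
  qed (auto simp: product_domain_def)
  then show "cut (product_domain \<Omega>) (elementary_tensor v) x = elementary_tensor (\<lambda>k. cut (\<Omega> k) (v k)) x"
    by (simp add: cut_def elementary_tensor_def prod.distrib)
qed

lemma elementary_tensor_test:
  fixes \<Omega> :: "'d::finite \<Rightarrow> real set"
  assumes "\<And>k. \<psi> k \<in> test_functions (\<Omega> k)"
  shows "elementary_tensor \<psi> \<in> test_functions (product_domain \<Omega>)"
  using tensor_tests_subset[of "\<lambda>b :: real ^ 'd. \<Omega> (axis_index b)"] assms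
  unfolding tensor_tests_vec product_domain_coord[symmetric] by auto

lemma insert_coord_line: "insert_coord j (t, y) = insert_coord j (0, y) + t *\<^sub>R axis j 1"
  by (simp add: vec_eq_iff insert_coord_nth axis_def)

lemma test_function_slice:
  fixes \<Omega> :: "'d::finite \<Rightarrow> real set"
  assumes "\<phi> \<in> test_functions (product_domain \<Omega>)"
  shows "(\<lambda>t. \<phi> (insert_coord j (t, y))) \<in> test_functions (\<Omega> j)"
    and "partial 1 (\<lambda>t. \<phi> (insert_coord j (t, y))) t = partial (axis j 1) \<phi> (insert_coord j (t, y))"
proof -
  let ?w = "insert_coord j (0, y)"
  have line: "(\<lambda>t. \<phi> (insert_coord j (t, y))) = (\<lambda>t. \<phi> (?w + t *\<^sub>R axis j 1))"
    by (intro ext arg_cong[OF insert_coord_line])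
  show "partial 1 (\<lambda>t. \<phi> (insert_coord j (t, y))) t = partial (axis j 1) \<phi> (insert_coord j (t, y))"
    unfolding line using partial_slice[of \<phi> ?w t "axis j 1"] test_functions_differentiable[OF assms]
    by (simp add: insert_coord_line[of j t, symmetric])
  obtain K where K: "compact K" "K \<subseteq> product_domain \<Omega>" "\<And>x. x \<notin> K \<Longrightarrow> \<phi> x = 0"
    by (rule test_functionsE[OF assms]) (rule that)
  \<comment> \<open>The part of \<open>K\<close> on the line through \<open>y\<close> is closed in
    \<open>K\<close>, hence compact, and so is its image under the coordinate.\<close>
  let ?K = "(\<lambda>x. x $ j) ` {x \<in> K. \<forall>k. k \<noteq> j \<longrightarrow> x $ k = y k}"
  show "(\<lambda>t. \<phi> (insert_coord j (t, y))) \<in> test_functions (\<Omega> j)"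
  proof (rule test_functionsI[of _ ?K])
    show "times_cont_diff n (\<lambda>t. \<phi> (insert_coord j (t, y)))" for n
      unfolding line by (rule times_cont_diff_slice[OF _ test_functions_smooth[OF assms]]) (simp add: axis_in_Basis_iff)
    have "{x \<in> K. \<forall>k. k \<noteq> j \<longrightarrow> x $ k = y k} = K \<inter> (\<Inter>k\<in>UNIV - {j}. (\<lambda>x. x $ k) -` {y k})" by auto
    moreover have "closed (\<Inter>k\<in>UNIV - {j}. (\<lambda>x :: real ^ 'd. x $ k) -` {y k})"
      by (intro closed_INT ballI continuous_closed_vimage) (auto intro!: continuous_intros)
    ultimately have "compact {x \<in> K. \<forall>k. k \<noteq> j \<longrightarrow> x $ k = y k}" using K(1) by (simp add: compact_Int_closed)
    then show "compact ?K" by (intro compact_continuous_image) (auto intro!: continuous_intros)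
    show "?K \<subseteq> \<Omega> j" using K(2) by (auto simp: product_domain_def)
    show "\<phi> (insert_coord j (t, y)) = 0" if "t \<notin> ?K" for t
    proof (rule K(3), rule notI)
      assume "insert_coord j (t, y) \<in> K"
      then have "t \<in> ?K"
        by (intro image_eqI[of _ _ "insert_coord j (t, y)"]) (auto simp: insert_coord_nth)
      then show False using that by simp
    qed
  qed
qed

lemma partial_elementary_tensor:
  fixes \<Omega> :: "'d::finite \<Rightarrow> real set"
  assumes "\<And>k. \<psi> k \<in> test_functions (\<Omega> k)"
  shows "partial (axis j 1) (elementary_tensor \<psi>) = elementary_tensor (\<psi>(j := partial 1 (\<psi> j)))"
proof
  fix x :: "real ^ 'd"
  define y where "y k = x $ k" for k
  have x: "x = insert_coord j (x $ j, y)" by (simp add: vec_eq_iff insert_coord_nth y_def)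
  have d: "(\<psi> j has_derivative (\<lambda>h. partial h (\<psi> j) t)) (at t)" for t
    by (intro has_derivative_frechet test_functions_differentiable[OF assms])
  have "((\<lambda>t. \<psi> j t * rest_tensor j \<psi> y) has_derivative (\<lambda>h. partial h (\<psi> j) t * rest_tensor j \<psi> y)) (at t)" for t
    by (rule has_derivative_mult_left[OF d])
  then have "partial 1 (\<lambda>t. \<psi> j t * rest_tensor j \<psi> y) (x $ j) = partial 1 (\<psi> j) (x $ j) * rest_tensor j \<psi> y"
    by (rule partial_eq)
  then have "partial (axis j 1) (elementary_tensor \<psi>) x = partial 1 (\<psi> j) (x $ j) * rest_tensor j \<psi> y"
    using test_function_slice(2)[OF elementary_tensor_test[of \<psi> \<Omega>, OF assms], where j = j and y = y and t = "x $ j"]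
    by (simp add: elementary_tensor_insert x[symmetric])
  also have "\<dots> = elementary_tensor (\<psi>(j := partial 1 (\<psi> j))) x"
    by (subst x) (simp add: elementary_tensor_insert rest_tensor_cong[of j "\<psi>(j := partial 1 (\<psi> j))" \<psi>])
  finally show "partial (axis j 1) (elementary_tensor \<psi>) x = elementary_tensor (\<psi>(j := partial 1 (\<psi> j))) x" .
qed

text \<open>By Fubini the pairing is integrated along the coordinate \<open>j\<close> first. There
  the slice of the test function is a test function on \<open>\<Omega> j\<close>, so the
  one-dimensional weak derivative applies; the other factors enter as square integrable
  weights.\<close>

lemma elementary_tensor_weak_partial:
  assumes v: "\<And>k. v k \<in> L2 (\<Omega> k)" and d: "d \<in> L2 (\<Omega> j)" "has_weak_partial (\<Omega> j) 1 (v j) d"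
  shows "has_weak_partial (product_domain \<Omega>) (axis j 1) (elementary_tensor v) (elementary_tensor (v(j := d)))"
  unfolding has_weak_partial_iff
proof
  fix \<phi> assume \<phi>: "\<phi> \<in> test_functions (product_domain \<Omega>)"
  let ?c = "\<lambda>k. cut (\<Omega> k) (v k)" and ?P = "lborel \<Otimes>\<^sub>M other_coords j"
  have c: "?c k \<in> l2_fun lborel" for k using v by (simp add: L2_iff)
  have cd: "cut (\<Omega> j) d \<in> l2_fun lborel" using d by (simp add: L2_iff)
  have r: "rest_tensor j ?c \<in> l2_fun (other_coords j)" by (intro rest_tensor_l2 c)
  have p: "partial (axis j 1) \<phi> \<in> test_functions (product_domain \<Omega>)"
    by (rule test_functions_partial[OF \<phi>]) (simp add: axis_in_Basis_iff)
  have pl: "\<phi> \<in> l2_fun lborel" "partial (axis j 1) \<phi> \<in> l2_fun lborel"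
    using test_functions_l2 \<phi> p by auto
  have fub: "l2_ip lborel (elementary_tensor w) ph = l2_ip (other_coords j) (\<lambda>y. l2_ip lborel (\<lambda>t. ph (insert_coord j (t, y))) (w j)) (rest_tensor j w)"
    if w: "\<And>k. w k \<in> l2_fun lborel" and ph: "ph \<in> l2_fun lborel" for w ph
  proof -
    have et: "elementary_tensor w \<in> l2_fun lborel" by (rule elementary_tensor_l2[OF w])
    have "l2_ip lborel (elementary_tensor w) ph = l2_ip lborel ph (elementary_tensor w)"
      by (rule l2.ip_sym[OF et ph])
    also have "\<dots> = l2_ip ?P (\<lambda>z. ph (insert_coord j z)) (\<lambda>z. w j (fst z) * rest_tensor j w (snd z))"
      unfolding elementary_tensor_insert[symmetric] by (intro l2_ip_insert_coord l2_fun_meas et ph)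
    also have "\<dots> = l2_ip (other_coords j) (\<lambda>y. l2_ip lborel (\<lambda>t. ph (insert_coord j (t, y))) (w j)) (rest_tensor j w)"
      using l2_fun_insert_coord[OF l2_fun_meas[OF ph], of j] ph w
      by (subst coord.l2_ip_contraction_snd) (auto intro!: rest_tensor_l2)
    finally show ?thesis .
  qed
  have eq: "l2_ip lborel (\<lambda>t. partial (axis j 1) \<phi> (insert_coord j (t, y))) (?c j)
      = - l2_ip lborel (\<lambda>t. \<phi> (insert_coord j (t, y))) (cut (\<Omega> j) d)" for y
  proof -
    have "l2_ip lborel (?c j) (partial 1 (\<lambda>t. \<phi> (insert_coord j (t, y))))
        = - l2_ip lborel (cut (\<Omega> j) d) (\<lambda>t. \<phi> (insert_coord j (t, y)))"
      using d(2) test_function_slice(1)[OF \<phi>] by (auto simp: has_weak_partial_iff)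
    then show ?thesis
      using test_function_slice(2)[OF \<phi>, of j y] by (simp add: l2_ip_def mult.commute)
  qed
  have upd: "(\<lambda>k. cut (\<Omega> k) ((v(j := d)) k)) = ?c(j := cut (\<Omega> j) d)" by auto
  have "l2_ip lborel (cut (product_domain \<Omega>) (elementary_tensor v)) (partial (axis j 1) \<phi>)
     = l2_ip (other_coords j) (\<lambda>y. - 1 * l2_ip lborel (\<lambda>t. \<phi> (insert_coord j (t, y))) (cut (\<Omega> j) d)) (rest_tensor j ?c)"
    unfolding cut_elementary_tensor fub[OF c pl(2)] eq by simp
  also have "\<dots> = - l2_ip (other_coords j) (\<lambda>y. l2_ip lborel (\<lambda>t. \<phi> (insert_coord j (t, y))) (cut (\<Omega> j) d)) (rest_tensor j ?c)"
    by (simp add: l2_ip_def)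
  also have "\<dots> = - l2_ip lborel (cut (product_domain \<Omega>) (elementary_tensor (v(j := d)))) \<phi>"
    unfolding cut_elementary_tensor upd
    using c cd pl(1)
    by (subst fub) (auto simp: rest_tensor_cong[of j "?c(j := cut (\<Omega> j) d)" ?c])
  finally show "l2_ip lborel (cut (product_domain \<Omega>) (elementary_tensor v)) (partial (axis j 1) \<phi>)
      = - l2_ip lborel (cut (product_domain \<Omega>) (elementary_tensor (v(j := d)))) \<phi>" .
qed

lemma insert_coord_measurable_l2:
  fixes w :: "real ^ 'd::finite \<Rightarrow> real"
  assumes "w \<in> l2_fun lborel"
  shows "(\<lambda>z. w (insert_coord j z)) \<in> l2_fun (lborel \<Otimes>\<^sub>M other_coords j)"
  using l2_fun_insert_coord[OF l2_fun_meas[OF assms]] assms by blast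

section \<open>Operators acting on one coordinate\<close>

abbreviation l2_tensors :: "(real ^ 'd::finite \<Rightarrow> real) set" where
  "l2_tensors \<equiv> algebraic_tensor (\<lambda>_. l2_fun lborel)"

definition one_op :: "nat \<Rightarrow> (nat \<Rightarrow> real \<Rightarrow> real) \<Rightarrow> (nat \<Rightarrow> real \<Rightarrow> real) \<Rightarrow> (real \<Rightarrow> real) \<Rightarrow> real \<Rightarrow> real" where
  "one_op p a g h = (\<lambda>t. \<Sum>m<p. l2_ip lborel h (g m) * a m t)"

text \<open>The tensor product of \<open>one_op\<close> in coordinate \<open>j\<close> with the
  identity in the others. On \<open>l2_tensors\<close> all slices, rather than almost all, are
  square integrable, so its linearity there holds pointwise.\<close>

definition coord_op :: "'d::finite \<Rightarrow> nat \<Rightarrow> (nat \<Rightarrow> real \<Rightarrow> real) \<Rightarrow> (nat \<Rightarrow> real \<Rightarrow> real) \<Rightarrow>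
    (real ^ 'd \<Rightarrow> real) \<Rightarrow> real ^ 'd \<Rightarrow> real" where
  "coord_op j p a g w x = one_op p a g (\<lambda>t. w (insert_coord j (t, ($) x))) (x $ j)"

lemma insert_coord_idem: "insert_coord j (t, ($) (insert_coord j z)) = insert_coord j (t, snd z)"
  by (simp add: vec_eq_iff insert_coord_nth)

lemma insert_coord_self: "insert_coord j (x $ j, ($) x) = x"
  by (simp add: vec_eq_iff insert_coord_nth)

lemma coord_op_insert:
  "coord_op j p a g w (insert_coord j z) = one_op p a g (\<lambda>t. w (insert_coord j (t, snd z))) (fst z)"
  by (simp add: coord_op_def insert_coord_idem) (simp add: insert_coord_nth)

lemma l2_tensors_l2: "l2_tensors \<subseteq> l2_fun lborel"
  unfolding algebraic_tensor_def
  by (intro fun_span_subset l2.fun_subspace_axioms) (auto intro!: elementary_tensor_l2)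

lemma algebraic_tensor_subspace: "fun_subspace (algebraic_tensor X)"
  unfolding algebraic_tensor_def by (rule fun_span_subspace)

lemma algebraic_tensor_sum:
  assumes "\<And>l k. l < (n::nat) \<Longrightarrow> v l k \<in> X k"
  shows "(\<lambda>x. \<Sum>l<n. c l * elementary_tensor (v l) x) \<in> algebraic_tensor X"
  unfolding algebraic_tensor_def
  using assms by (intro fun_subspace.lincomb[OF fun_span_subspace] fun_span_incl) blast

lemma l2_tensors_slice:
  assumes "w \<in> l2_tensors"
  shows "(\<lambda>t. w (insert_coord j (t, y))) \<in> l2_fun lborel"
proof -
  obtain n :: nat and c s where s: "\<forall>i<n. s i \<in> {elementary_tensor v |v. \<forall>k. v k \<in> l2_fun lborel}"
    and w: "w = (\<lambda>x. \<Sum>i<n. c i * s i x)"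
    using assms unfolding algebraic_tensor_def fun_span_def by blast
  have "(\<lambda>t. s i (insert_coord j (t, y))) \<in> l2_fun lborel" if i: "i < n" for i
  proof -
    obtain v where v: "s i = elementary_tensor v" "\<forall>k. v k \<in> l2_fun lborel" using s i by auto
    then show ?thesis using l2.scale[of "v j" lborel "rest_tensor j v y"]
      by (simp add: elementary_tensor_insert mult.commute)
  qed
  then show ?thesis unfolding w by (intro l2.lincomb)
qed

text \<open>Only the factor \<open>j\<close> changes. Hence the operators of different coordinates
  commute on finite tensor sums, and each leaves the differentiated factors in the other directions
  alone.\<close>

lemma coord_op_elementary:
  "coord_op j p a g (elementary_tensor v) = elementary_tensor (v(j := one_op p a g (v j)))"
proof
  fix x
  have r: "rest_tensor j (v(j := one_op p a g (v j))) = rest_tensor j v"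
    by (rule rest_tensor_cong) simp
  have "l2_ip lborel (\<lambda>t. v j t * rest_tensor j v (($) x)) (g m) = rest_tensor j v (($) x) * l2_ip lborel (v j) (g m)" for m
  proof -
    have "(\<lambda>t. v j t * rest_tensor j v (($) x) * g m t) = (\<lambda>t. rest_tensor j v (($) x) * (v j t * g m t))"
      by (simp add: mult_ac)
    then show ?thesis by (simp add: l2_ip_def)
  qed
  then have "coord_op j p a g (elementary_tensor v) x = one_op p a g (v j) (x $ j) * rest_tensor j v (($) x)"
    by (simp add: coord_op_def elementary_tensor_insert one_op_def sum_distrib_left mult_ac)
  also have "\<dots> = elementary_tensor (v(j := one_op p a g (v j))) (insert_coord j (x $ j, ($) x))"
    by (simp add: elementary_tensor_insert r)
  finally show "coord_op j p a g (elementary_tensor v) x = elementary_tensor (v(j := one_op p a g (v j))) x"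
    by (simp add: insert_coord_self)
qed

lemma coord_op_lincomb:
  assumes g: "\<And>m. m < p \<Longrightarrow> g m \<in> l2_fun lborel" and w: "\<And>l. l < (n::nat) \<Longrightarrow> w l \<in> l2_tensors"
  shows "coord_op j p a g (\<lambda>x. \<Sum>l<n. c l * w l x) = (\<lambda>x. \<Sum>l<n. c l * coord_op j p a g (w l) x)"
proof
  fix x
  have "l2_ip lborel (\<lambda>t. \<Sum>l<n. c l * w l (insert_coord j (t, ($) x))) (g m)
      = (\<Sum>l<n. c l * l2_ip lborel (\<lambda>t. w l (insert_coord j (t, ($) x))) (g m))" if "m < p" for m
    using that by (intro l2.ip_lincomb l2_tensors_slice w g)
  then have "coord_op j p a g (\<lambda>x. \<Sum>l<n. c l * w l x) x
      = (\<Sum>m<p. \<Sum>l<n. c l * (l2_ip lborel (\<lambda>t. w l (insert_coord j (t, ($) x))) (g m) * a m (x $ j)))"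
    by (simp add: coord_op_def one_op_def sum_distrib_right mult.assoc)
  also have "\<dots> = (\<Sum>l<n. c l * coord_op j p a g (w l) x)"
    by (subst sum.swap) (simp add: coord_op_def one_op_def sum_distrib_left)
  finally show "coord_op j p a g (\<lambda>x. \<Sum>l<n. c l * w l x) x = (\<Sum>l<n. c l * coord_op j p a g (w l) x)" .
qed

lemma coord_op_diff:
  assumes g: "\<And>m. m < p \<Longrightarrow> g m \<in> l2_fun lborel" and w: "v \<in> l2_tensors" "w \<in> l2_tensors"
  shows "coord_op j p a g (\<lambda>x. v x - w x) = (\<lambda>x. coord_op j p a g v x - coord_op j p a g w x)"
  using coord_op_lincomb[of p g 2 "\<lambda>i. if i = 0 then v else w" j a "\<lambda>i. if i = 0 then 1 else -1"] g w
  by (simp add: numeral_2_eq_2)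

lemma one_op_l2:
  assumes "\<And>m. m < p \<Longrightarrow> a m \<in> l2_fun lborel"
  shows "one_op p a g h \<in> l2_fun lborel"
  unfolding one_op_def by (intro l2.lincomb assms)

lemma coord_op_l2_tensors:
  assumes a: "\<And>m. m < p \<Longrightarrow> a m \<in> l2_fun lborel" and g: "\<And>m. m < p \<Longrightarrow> g m \<in> l2_fun lborel"
    and w: "w \<in> l2_tensors"
  shows "coord_op j p a g w \<in> l2_tensors"
proof -
  obtain n :: nat and c s where s: "\<forall>i<n. s i \<in> {elementary_tensor v |v. \<forall>k. v k \<in> l2_fun lborel}"
    and w: "w = (\<lambda>x. \<Sum>i<n. c i * s i x)"
    using w unfolding algebraic_tensor_def fun_span_def by blast
  have sT: "s i \<in> l2_tensors" if "i < n" for i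
    unfolding algebraic_tensor_def using s that by (intro fun_span_incl) auto
  have "coord_op j p a g (s i) \<in> l2_tensors" if i: "i < n" for i
  proof -
    obtain v where v: "s i = elementary_tensor v" "\<forall>k. v k \<in> l2_fun lborel" using s i by auto
    show ?thesis
      unfolding v(1) coord_op_elementary algebraic_tensor_def
      using v(2) one_op_l2[OF a] by (intro fun_span_incl) auto
  qed
  then have "(\<lambda>x. \<Sum>i<n. c i * coord_op j p a g (s i) x) \<in> l2_tensors"
    by (intro fun_subspace.lincomb[OF algebraic_tensor_subspace])
  moreover have "coord_op j p a g w = (\<lambda>x. \<Sum>i<n. c i * coord_op j p a g (s i) x)"
    unfolding w by (rule coord_op_lincomb) (use g sT in auto)
  ultimately show ?thesis by simp
qed

lemma coord_op_bound:
  assumes a: "\<And>m. m < p \<Longrightarrow> a m \<in> l2_fun lborel" and g: "\<And>m. m < p \<Longrightarrow> g m \<in> l2_fun lborel"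
    and w: "w \<in> l2_tensors" and "0 \<le> C"
    and le: "\<And>h. h \<in> l2_fun lborel \<Longrightarrow> l2_nrm lborel (one_op p a g h) \<le> C * l2_nrm lborel h"
  shows "l2_nrm lborel (coord_op j p a g w) \<le> C * l2_nrm lborel w"
proof -
  have L: "w \<in> l2_fun lborel" "coord_op j p a g w \<in> l2_fun lborel"
    using l2_tensors_l2 w coord_op_l2_tensors[OF a g w] by auto
  have "l2_nrm (lborel \<Otimes>\<^sub>M other_coords j) (\<lambda>z. coord_op j p a g w (insert_coord j z))
      \<le> C * l2_nrm (lborel \<Otimes>\<^sub>M other_coords j) (\<lambda>z. w (insert_coord j z))"
    using le[OF l2_tensors_slice[OF w]]
    by (intro coord.l2_le_snd insert_coord_measurable_l2 L \<open>0 \<le> C\<close>) (simp add: coord_op_insert)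
  then show ?thesis using l2_nrm_insert_coord[OF l2_fun_meas[OF L(1)], of j]
      l2_nrm_insert_coord[OF l2_fun_meas[OF L(2)], of j] by simp
qed

section \<open>Contractions of \<open>u\<close> and their weak derivatives\<close>

locale tensor_h1 =
  fixes \<Omega> :: "'d::finite \<Rightarrow> real set" and u :: "real ^ 'd \<Rightarrow> real"
  assumes open_\<Omega>: "open (\<Omega> j)" and u: "u \<in> H1 (product_domain \<Omega>)"
begin

abbreviation "PD \<equiv> product_domain \<Omega>"

definition u0 :: "real ^ 'd \<Rightarrow> real" where "u0 = cut PD u"
definition du :: "'d \<Rightarrow> real ^ 'd \<Rightarrow> real" where "du j = cut PD (weak_partial PD (axis j 1) u)"

sublocale dom: coord_domain PD "\<lambda>b. \<Omega> (axis_index b)"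
  by unfold_locales (auto simp: open_\<Omega> product_domain_coord)

sublocale one: coord_domain "\<Omega> j" "\<lambda>_. \<Omega> j" for j
  by unfold_locales (auto simp: open_\<Omega> coord_product_def)

lemma u0_l2: "u0 \<in> l2_fun lborel"
  using H1_L2[OF u] by (simp add: u0_def L2_iff)

lemma du_l2: "du j \<in> l2_fun lborel"
  using weak_partial(1)[OF u, of "axis j 1"] by (simp add: du_def L2_iff axis_in_Basis_iff)

lemma du_weak: "\<phi> \<in> test_functions PD \<Longrightarrow> l2_ip lborel u0 (partial (axis j 1) \<phi>) = - l2_ip lborel (du j) \<phi>"
  using weak_partial(2)[OF u, of "axis j 1"] by (simp add: u0_def du_def has_weak_partial_iff axis_in_Basis_iff)

definition contr :: "'d \<Rightarrow> (real ^ 'd \<Rightarrow> real) \<Rightarrow> (('d \<Rightarrow> real) \<Rightarrow> real) \<Rightarrow> real \<Rightarrow> real" where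
  "contr j w f t = l2_ip (other_coords j) (\<lambda>y. w (insert_coord j (t, y))) f"

lemma contr_l2: "w \<in> l2_fun lborel \<Longrightarrow> f \<in> l2_fun (other_coords j) \<Longrightarrow> contr j w f \<in> l2_fun lborel"
  unfolding contr_def[abs_def] by (intro coord.l2_contraction_fst insert_coord_measurable_l2)

lemma cut_contr: "cut (\<Omega> j) (contr j (cut PD w) f) = contr j (cut PD w) f"
proof (rule cut_ident)
  fix t assume "t \<notin> \<Omega> j"
  then have "insert_coord j (t, y) \<notin> PD" for y
    by (auto simp: product_domain_def insert_coord_nth intro!: exI[of _ j])
  then show "contr j (cut PD w) f t = 0" by (simp add: contr_def cut_def l2_ip_def)
qed

lemma partial_contraction_cut: "cut (\<Omega> j) (partial_contraction \<Omega> j g u) = contr j u0 (rest_tensor j g)"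
proof
  fix t
  show "cut (\<Omega> j) (partial_contraction \<Omega> j g u) t = contr j u0 (rest_tensor j g) t"
  proof (cases "t \<in> \<Omega> j")
    case False
    then show ?thesis
      using fun_cong[OF cut_contr[where j = j and w = u and f = "rest_tensor j g"], of t] by (simp add: u0_def cut_outside)
  next
    case True
    have "partial_contraction \<Omega> j g u t = contr j u0 (rest_tensor j g) t"
      unfolding partial_contraction_def contr_def l2_ip_def set_lebesgue_integral_def
    proof (rule Bochner_Integration.integral_cong[OF refl])
      fix y :: "'d \<Rightarrow> real" assume "y \<in> space (other_coords j)"
      then have "y \<in> (\<Pi>\<^sub>E k\<in>UNIV - {j}. \<Omega> k) \<longleftrightarrow> insert_coord j (t, y) \<in> PD"
        using True by (auto simp: space_PiM PiE_def Pi_def product_domain_def insert_coord_nth)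
      moreover have "(\<chi> k. if k = j then t else y k) = insert_coord j (t, y)"
        by (simp add: vec_eq_iff insert_coord_nth)
      ultimately show "indicat_real (\<Pi>\<^sub>E k\<in>UNIV - {j}. \<Omega> k) y *\<^sub>R
          (u (\<chi> k. if k = j then t else y k) * (\<Prod>k\<in>UNIV - {j}. g k (y k)))
        = u0 (insert_coord j (t, y)) * rest_tensor j g y"
        by (simp add: u0_def cut_def rest_tensor_def indicator_def)
    qed
    with True show ?thesis by (simp add: cut_inside)
  qed
qed

lemma contr_ip:
  assumes w: "w \<in> l2_fun lborel" and v: "\<And>k. v k \<in> l2_fun lborel"
  shows "l2_ip lborel (contr j w (rest_tensor j v)) (v j) = l2_ip lborel w (elementary_tensor v)"
proof -
  have "l2_ip lborel (contr j w (rest_tensor j v)) (v j)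
      = l2_ip (lborel \<Otimes>\<^sub>M other_coords j) (\<lambda>z. w (insert_coord j z)) (\<lambda>z. v j (fst z) * rest_tensor j v (snd z))"
    unfolding contr_def[abs_def]
    by (intro coord.l2_ip_contraction_fst insert_coord_measurable_l2 w v rest_tensor_l2)
  also have "\<dots> = l2_ip lborel w (elementary_tensor v)"
    unfolding elementary_tensor_insert[symmetric]
    by (intro l2_ip_insert_coord[symmetric] l2_fun_meas w elementary_tensor_l2 v)
  finally show ?thesis .
qed

text \<open>Testing the contraction with \<phi> amounts to testing \<open>u\<close> with the tensor
  product of the \<open>g k\<close> and of \<phi> in the slot \<open>j\<close>. The
  \<open>g k\<close> are test functions so that this product is one as well.\<close>

lemma contr_weak_partial:
  assumes "\<And>k. k \<noteq> j \<Longrightarrow> g k \<in> test_functions (\<Omega> k)"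
  shows "has_weak_partial (\<Omega> j) 1 (partial_contraction \<Omega> j g u) (contr j (du j) (rest_tensor j g))"
  unfolding has_weak_partial_iff
proof
  fix \<phi> assume \<phi>: "\<phi> \<in> test_functions (\<Omega> j)"
  define \<psi> where "\<psi> = g(j := \<phi>)"
  have \<psi>: "\<psi> k \<in> test_functions (\<Omega> k)" for k using assms \<phi> by (simp add: \<psi>_def)
  have dj: "partial 1 \<phi> \<in> test_functions (\<Omega> j)" using test_functions_partial[OF \<phi>, of 1] by simp
  have r: "rest_tensor j g = rest_tensor j \<psi>" "rest_tensor j g = rest_tensor j (\<psi>(j := partial 1 \<phi>))"
    by (auto intro!: rest_tensor_cong simp: \<psi>_def)
  have l: "\<psi> k \<in> l2_fun lborel" "(\<psi>(j := partial 1 \<phi>)) k \<in> l2_fun lborel" for k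
    using \<psi> dj by (auto intro: test_functions_l2)
  have "l2_ip lborel (cut (\<Omega> j) (partial_contraction \<Omega> j g u)) (partial 1 \<phi>)
      = l2_ip lborel (contr j u0 (rest_tensor j (\<psi>(j := partial 1 \<phi>)))) ((\<psi>(j := partial 1 \<phi>)) j)"
    by (simp add: partial_contraction_cut r(2))
  also have "\<dots> = l2_ip lborel u0 (elementary_tensor (\<psi>(j := partial 1 \<phi>)))"
    by (intro contr_ip u0_l2 l)
  also have "elementary_tensor (\<psi>(j := partial 1 \<phi>)) = partial (axis j 1) (elementary_tensor \<psi>)"
    using partial_elementary_tensor[of \<psi> \<Omega> j, OF \<psi>] by (simp add: \<psi>_def)
  also have "l2_ip lborel u0 \<dots> = - l2_ip lborel (du j) (elementary_tensor \<psi>)"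
    by (intro du_weak elementary_tensor_test \<psi>)
  also have "l2_ip lborel (du j) (elementary_tensor \<psi>) = l2_ip lborel (contr j (du j) (rest_tensor j \<psi>)) (\<psi> j)"
    by (intro contr_ip[symmetric] du_l2 l)
  also have "\<psi> j = \<phi>" by (simp add: \<psi>_def)
  finally show "l2_ip lborel (cut (\<Omega> j) (partial_contraction \<Omega> j g u)) (partial 1 \<phi>)
      = - l2_ip lborel (cut (\<Omega> j) (contr j (du j) (rest_tensor j g))) \<phi>"
    by (simp add: r(1) du_def cut_contr)
qed

definition rest_tests :: "'d \<Rightarrow> (('d \<Rightarrow> real) \<Rightarrow> real) set" where
  "rest_tests j = fun_span {rest_tensor j g |g. \<forall>k. k \<noteq> j \<longrightarrow> g k \<in> test_functions (\<Omega> k)}"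

lemma rest_tests_l2: "rest_tests j \<subseteq> l2_fun (other_coords j)"
  unfolding rest_tests_def
  by (intro fun_span_subset l2.fun_subspace_axioms) (auto intro!: rest_tensor_l2 intro: test_functions_l2)

text \<open>Membership in \<open>U_span\<close> concerns the function \<open>a\<close> itself,
  whereas agreement with the contraction of \<open>f\<close> can only be asked almost
  everywhere.\<close>

definition is_contr :: "'d \<Rightarrow> (('d \<Rightarrow> real) \<Rightarrow> real) \<Rightarrow> (real \<Rightarrow> real) \<Rightarrow> (real \<Rightarrow> real) \<Rightarrow> bool" where
  "is_contr j f a d \<longleftrightarrow> a \<in> U_span \<Omega> j u \<and> a \<in> L2 (\<Omega> j) \<and> d \<in> L2 (\<Omega> j) \<and> has_weak_partial (\<Omega> j) 1 a d \<and>
     (AE t in lborel. cut (\<Omega> j) a t = contr j u0 f t) \<and> (AE t in lborel. cut (\<Omega> j) d t = contr j (du j) f t)"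

lemma contr_lincomb_AE:
  assumes "w \<in> l2_fun lborel" "\<And>i. i < (n::nat) \<Longrightarrow> s i \<in> l2_fun (other_coords j)"
  shows "AE t in lborel. contr j w (\<lambda>y. \<Sum>i<n. c i * s i y) t = (\<Sum>i<n. c i * contr j w (s i) t)"
  using coord.l2_slice_fst[OF insert_coord_measurable_l2[OF assms(1)], of j]
  by eventually_elim (simp add: contr_def l2.ip_lincomb_right assms(2))

lemma is_contr_exists:
  assumes "f \<in> rest_tests j"
  shows "\<exists>a d. is_contr j f a d"
proof -
  obtain n :: nat and c s where s: "\<forall>i<n. s i \<in> {rest_tensor j g |g. \<forall>k. k \<noteq> j \<longrightarrow> g k \<in> test_functions (\<Omega> k)}"
    and f: "f = (\<lambda>y. \<Sum>i<n. c i * s i y)"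
    using assms unfolding rest_tests_def fun_span_def by blast
  have "\<forall>i. \<exists>g. i < n \<longrightarrow> s i = rest_tensor j g \<and> (\<forall>k. k \<noteq> j \<longrightarrow> g k \<in> test_functions (\<Omega> k))"
    using s by blast
  then obtain g where g': "\<forall>i. i < n \<longrightarrow> s i = rest_tensor j (g i) \<and> (\<forall>k. k \<noteq> j \<longrightarrow> g i k \<in> test_functions (\<Omega> k))"
    by (rule choice[THEN exE])
  then have g: "\<And>i. i < n \<Longrightarrow> s i = rest_tensor j (g i)" "\<And>i k. i < n \<Longrightarrow> k \<noteq> j \<Longrightarrow> g i k \<in> test_functions (\<Omega> k)"
    by auto
  have sl: "s i \<in> l2_fun (other_coords j)" if "i < n" for i
    unfolding g(1)[OF that] using g(2)[OF that] by (intro rest_tensor_l2) (auto intro: test_functions_l2)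
  define a where "a t = (\<Sum>i<n. c i * partial_contraction \<Omega> j (g i) u t)" for t
  define d where "d t = (\<Sum>i<n. c i * contr j (du j) (s i) t)" for t
  have cpc: "cut (\<Omega> j) (partial_contraction \<Omega> j (g i) u) = contr j u0 (s i)" if "i < n" for i
    by (simp add: partial_contraction_cut g(1)[OF that])
  have pL: "partial_contraction \<Omega> j (g i) u \<in> L2 (\<Omega> j)" if "i < n" for i
    unfolding L2_iff cpc[OF that] by (intro contr_l2 u0_l2 sl that)
  have cdu: "cut (\<Omega> j) (contr j (du j) h) = contr j (du j) h" for h
    unfolding du_def by (rule cut_contr)
  have dL: "contr j (du j) (s i) \<in> L2 (\<Omega> j)" if "i < n" for i
    unfolding L2_iff cdu by (intro contr_l2 du_l2 sl that)
  have ae: "AE t in lborel. contr j w (\<lambda>y. \<Sum>i<n. c i * s i y) t = (\<Sum>i<n. c i * contr j w (s i) t)"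
    if "w \<in> l2_fun lborel" for w by (rule contr_lincomb_AE[OF that]) (rule sl)
  have "a \<in> U_span \<Omega> j u"
    unfolding a_def[abs_def] U_span_def
    using g(2) by (intro fun_subspace.lincomb[OF fun_span_subspace] fun_span_incl) (auto intro!: test_functions_L2 exI)
  moreover have "a \<in> L2 (\<Omega> j)" "d \<in> L2 (\<Omega> j)"
    unfolding a_def[abs_def] d_def[abs_def] by (intro fun_subspace.lincomb[OF L2_subspace] pL dL; simp)+
  moreover have "has_weak_partial (\<Omega> j) 1 a d"
    unfolding a_def[abs_def] d_def[abs_def]
    using contr_weak_partial[of j] g by (intro has_weak_partial_lincomb pL dL) auto
  moreover have "AE t in lborel. cut (\<Omega> j) a t = contr j u0 f t"
    using ae[OF u0_l2]
  proof eventually_elim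
    case (elim t)
    have "cut (\<Omega> j) a t = (\<Sum>i<n. c i * cut (\<Omega> j) (partial_contraction \<Omega> j (g i) u) t)"
      by (simp add: a_def cut_def sum_distrib_left mult_ac)
    then show ?case using elim by (simp add: f cpc)
  qed
  moreover have "AE t in lborel. cut (\<Omega> j) d t = contr j (du j) f t"
    using ae[OF du_l2[of j]]
  proof eventually_elim
    case (elim t)
    have "cut (\<Omega> j) d t = (\<Sum>i<n. c i * cut (\<Omega> j) (contr j (du j) (s i)) t)"
      by (simp add: d_def cut_def sum_distrib_left mult_ac)
    then show ?case using elim by (simp add: f cdu)
  qed
  ultimately show ?thesis unfolding is_contr_def by blast
qed

text \<open>Contraction is linear in \<open>f\<close> only almost everywhere, as divergent integrals have the value 0.
  Hence elements of \<open>U_span\<close> that represent the contraction and its derivative are chosen.\<close>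

definition \<alpha> :: "'d \<Rightarrow> (('d \<Rightarrow> real) \<Rightarrow> real) \<Rightarrow> real \<Rightarrow> real" where
  "\<alpha> j f = (SOME a. \<exists>d. is_contr j f a d)"

definition \<beta> :: "'d \<Rightarrow> (('d \<Rightarrow> real) \<Rightarrow> real) \<Rightarrow> real \<Rightarrow> real" where
  "\<beta> j f = (SOME d. is_contr j f (\<alpha> j f) d)"

lemma is_contr: assumes "f \<in> rest_tests j" shows "is_contr j f (\<alpha> j f) (\<beta> j f)"
proof -
  have "\<exists>d. is_contr j f (\<alpha> j f) d" unfolding \<alpha>_def by (rule someI_ex[OF is_contr_exists[OF assms]])
  then show ?thesis unfolding \<beta>_def by (rule someI_ex)
qed

lemma tests_approximation:
  assumes "0 < e"
  obtains n :: nat and c \<psi> where "\<And>l k. l < n \<Longrightarrow> \<psi> l k \<in> test_functions (\<Omega> k)"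
    "l2_nrm lborel (\<lambda>x. u0 x - (\<Sum>l<n. c l * elementary_tensor (\<psi> l) x)) < e"
proof -
  have "u0 \<in> l2.nclosure lborel (fun_span (tensor_tests (\<lambda>b. \<Omega> (axis_index b))))"
    using u0_l2 by (intro tensor_tests_dense) (auto simp: open_\<Omega> u0_def product_domain_coord cut_outside)
  then obtain p where p: "p \<in> fun_span (tensor_tests (\<lambda>b. \<Omega> (axis_index b)))" "l2_nrm lborel (\<lambda>x. u0 x - p x) < e"
    using assms unfolding l2.nclosure_def by blast
  obtain n :: nat and c s where s: "\<forall>i<n. s i \<in> {elementary_tensor \<psi> |\<psi>. \<forall>k. \<psi> k \<in> test_functions (\<Omega> k)}"
    and f: "p = (\<lambda>y. \<Sum>i<n. c i * s i y)"
    using p(1) unfolding fun_span_def tensor_tests_vec by blast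
  have "\<forall>i. \<exists>g. i < n \<longrightarrow> s i = elementary_tensor g \<and> (\<forall>k. g k \<in> test_functions (\<Omega> k))" using s by blast
  then obtain g where g: "\<forall>i. i < n \<longrightarrow> s i = elementary_tensor (g i) \<and> (\<forall>k. g i k \<in> test_functions (\<Omega> k))"
    by (rule choice[THEN exE])
  have "p = (\<lambda>x. \<Sum>l<n. c l * elementary_tensor (g l) x)" using g by (simp add: f)
  with p(2) g show ?thesis by (intro that[of n g c]) auto
qed

lemma contraction_pair: "contraction_pair lborel (other_coords j) (\<lambda>z. u0 (insert_coord j z))
    (\<lambda>z. du j (insert_coord j z)) (rest_tests j) (\<lambda>f. cut (\<Omega> j) (\<alpha> j f)) (\<lambda>f. cut (\<Omega> j) (\<beta> j f))"
proof (intro contraction_pair.intro contraction_pair_axioms.intro coord.pair_sigma_finite_axioms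
    insert_coord_measurable_l2 u0_l2 du_l2 rest_tests_l2)
  show "fun_subspace (rest_tests j)" unfolding rest_tests_def by (rule fun_span_subspace)
  fix f assume "f \<in> rest_tests j"
  from is_contr[OF this]
  show "cut (\<Omega> j) (\<alpha> j f) \<in> l2_fun lborel" "cut (\<Omega> j) (\<beta> j f) \<in> l2_fun lborel"
    "AE x in lborel. cut (\<Omega> j) (\<alpha> j f) x = l2_ip (other_coords j) (\<lambda>y. u0 (insert_coord j (x, y))) f"
    "AE x in lborel. cut (\<Omega> j) (\<beta> j f) x = l2_ip (other_coords j) (\<lambda>y. du j (insert_coord j (x, y))) f"
    by (auto simp: is_contr_def L2_iff contr_def)
next
  fix e :: real assume "0 < e"
  then obtain n :: nat and c \<psi> where \<psi>: "\<And>l k. l < n \<Longrightarrow> \<psi> l k \<in> test_functions (\<Omega> k)"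
    "l2_nrm lborel (\<lambda>x. u0 x - (\<Sum>l<n. c l * elementary_tensor (\<psi> l) x)) < e"
    by (rule tests_approximation) (rule that)
  define w where "w = (\<lambda>x. u0 x - (\<Sum>l<n. c l * elementary_tensor (\<psi> l) x))"
  have "w \<in> l2_fun lborel"
    unfolding w_def using \<psi>(1) by (intro l2.diff u0_l2 l2.lincomb elementary_tensor_l2 test_functions_l2)
  then have "l2_nrm (lborel \<Otimes>\<^sub>M other_coords j) (\<lambda>z. w (insert_coord j z)) < e"
    using \<psi>(2) l2_nrm_insert_coord[OF l2_fun_meas, of w j] by (simp add: w_def)
  then have "l2_nrm (lborel \<Otimes>\<^sub>M other_coords j) (\<lambda>z. u0 (insert_coord j z) -
      (\<Sum>l<n. (\<lambda>l t. c l * \<psi> l j t) l (fst z) * (\<lambda>l. rest_tensor j (\<psi> l)) l (snd z))) < e"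
    by (simp add: w_def elementary_tensor_insert mult.assoc)
  moreover have "\<forall>l<n. (\<lambda>l t. c l * \<psi> l j t) l \<in> l2_fun lborel \<and> (\<lambda>l. rest_tensor j (\<psi> l)) l \<in> rest_tests j"
    using \<psi>(1) by (auto intro!: l2.scale fun_span_incl simp: rest_tests_def intro: test_functions_l2)
  ultimately show "\<exists>(n::nat) \<psi> \<rho>. (\<forall>l<n. \<psi> l \<in> l2_fun lborel \<and> \<rho> l \<in> rest_tests j) \<and>
      l2_nrm (lborel \<Otimes>\<^sub>M other_coords j) (\<lambda>z. u0 (insert_coord j z) - (\<Sum>l<n. \<psi> l (fst z) * \<rho> l (snd z))) < e"
    by (intro exI[of _ n] exI conjI)
qed

text \<open>The output of \<open>truncation\<close> carried over to \<open>real ^ 'd\<close> and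
  packed into one tuple, so that a single application of choice supplies it for all
  directions.\<close>

definition direction_data :: "'d \<Rightarrow> real \<Rightarrow>
    nat \<times> (nat \<Rightarrow> real \<Rightarrow> real) \<times> (nat \<Rightarrow> real \<Rightarrow> real) \<times> (nat \<Rightarrow> real \<Rightarrow> real) \<times> real \<Rightarrow> bool" where
  "direction_data j \<eta> X \<longleftrightarrow> (case X of (p, a, d, g, \<delta>) \<Rightarrow> 0 < \<delta> \<and>
     (\<forall>m<p. a m \<in> U_span \<Omega> j u \<and> a m \<in> L2 (\<Omega> j) \<and> d m \<in> L2 (\<Omega> j) \<and>
        has_weak_partial (\<Omega> j) 1 (a m) (d m) \<and> g m \<in> l2_fun lborel) \<and>
     (\<forall>h\<in>l2_fun lborel. l2_nrm lborel (one_op p (\<lambda>m. cut (\<Omega> j) (a m)) g h) \<le> 2 * l2_nrm lborel h) \<and>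
     (\<forall>v\<in>l2_tensors. l2_nrm lborel (\<lambda>x. v x - u0 x) < \<delta> \<longrightarrow>
        l2_nrm lborel (\<lambda>x. v x - coord_op j p (\<lambda>m. cut (\<Omega> j) (a m)) g v x) < \<eta> \<and>
        l2_nrm lborel (coord_op j p (\<lambda>m. cut (\<Omega> j) (d m)) g v) \<le> 3 * l2_nrm lborel (du j)))"

lemma direction_data_exists:
  assumes "0 < \<eta>" shows "\<exists>X. direction_data j \<eta> X"
proof -
  let ?P = "lborel \<Otimes>\<^sub>M other_coords j"
  obtain p f g \<delta> where *: "0 < \<delta>" "\<forall>m<(p::nat). f m \<in> rest_tests j \<and> g m \<in> l2_fun lborel"
    "\<forall>h\<in>l2_fun lborel. l2_nrm lborel (\<lambda>x. \<Sum>m<p. l2_ip lborel h (g m) * cut (\<Omega> j) (\<alpha> j (f m)) x) \<le> 2 * l2_nrm lborel h"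
    "\<forall>v\<in>l2_fun ?P. l2_nrm ?P (\<lambda>z. v z - u0 (insert_coord j z)) < \<delta> \<longrightarrow>
       l2_nrm ?P (\<lambda>z. v z - (\<Sum>m<p. cut (\<Omega> j) (\<alpha> j (f m)) (fst z) * l2_ip lborel (\<lambda>x. v (x, snd z)) (g m))) < \<eta> \<and>
       l2_nrm ?P (\<lambda>z. \<Sum>m<p. cut (\<Omega> j) (\<beta> j (f m)) (fst z) * l2_ip lborel (\<lambda>x. v (x, snd z)) (g m)) \<le> 3 * l2_nrm ?P (\<lambda>z. du j (insert_coord j z))"
    using contraction_pair.truncation[OF contraction_pair[of j] assms] by (elim exE conjE) (rule that)
  have c: "is_contr j (f m) (\<alpha> j (f m)) (\<beta> j (f m))" if "m < p" for m using *(2) that is_contr by blast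
  let ?a = "\<lambda>m. cut (\<Omega> j) (\<alpha> j (f m))" and ?d = "\<lambda>m. cut (\<Omega> j) (\<beta> j (f m))"
  have al: "?a m \<in> l2_fun lborel" "?d m \<in> l2_fun lborel" "g m \<in> l2_fun lborel" if "m < p" for m
    using c[OF that] *(2) that by (auto simp: is_contr_def L2_iff)
  have "l2_nrm lborel (\<lambda>x. v x - coord_op j p ?a g v x) < \<eta> \<and>
        l2_nrm lborel (coord_op j p ?d g v) \<le> 3 * l2_nrm lborel (du j)"
    if v: "v \<in> l2_tensors" and vu: "l2_nrm lborel (\<lambda>x. v x - u0 x) < \<delta>" for v
  proof -
    have vl: "v \<in> l2_fun lborel" using v l2_tensors_l2 by auto
    have ol: "coord_op j p ?a g v \<in> l2_fun lborel" "coord_op j p ?d g v \<in> l2_fun lborel"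
      using l2_tensors_l2 coord_op_l2_tensors[OF al(1,3) v] coord_op_l2_tensors[OF al(2,3) v] by auto
    have tr: "l2_nrm lborel w = l2_nrm ?P (\<lambda>z. w (insert_coord j z))" if "w \<in> l2_fun lborel" for w
      by (rule l2_nrm_insert_coord[OF l2_fun_meas[OF that]])
    have "l2_nrm ?P (\<lambda>z. v (insert_coord j z) - u0 (insert_coord j z)) < \<delta>"
      using vu tr[OF l2.diff[OF vl u0_l2]] by simp
    then have "l2_nrm ?P (\<lambda>z. v (insert_coord j z) - (\<Sum>m<p. ?a m (fst z) * l2_ip lborel (\<lambda>x. v (insert_coord j (x, snd z))) (g m))) < \<eta> \<and>
       l2_nrm ?P (\<lambda>z. \<Sum>m<p. ?d m (fst z) * l2_ip lborel (\<lambda>x. v (insert_coord j (x, snd z))) (g m)) \<le> 3 * l2_nrm ?P (\<lambda>z. du j (insert_coord j z))"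
      by (rule *(4)[rule_format, OF insert_coord_measurable_l2[OF vl, of j]])
    then show ?thesis
      unfolding tr[OF l2.diff[OF vl ol(1)]] tr[OF ol(2)] tr[OF du_l2] coord_op_insert one_op_def
      by (simp add: mult.commute)
  qed
  then have "direction_data j \<eta> (p, \<lambda>m. \<alpha> j (f m), \<lambda>m. \<beta> j (f m), g, \<delta>)"
    unfolding direction_data_def using *(1-3) c al
    by (auto simp: is_contr_def one_op_def)
  then show ?thesis by blast
qed

end

section \<open>Applying the operators of all directions\<close>

lemma tensor_sum_cong:
  assumes "\<And>l. l < (n::nat) \<Longrightarrow> v l = w l"
  shows "(\<lambda>x. \<Sum>l<n. c l * elementary_tensor (v l) x) = (\<lambda>x. \<Sum>l<n. c l * elementary_tensor (w l) x)"
  using assms by simp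

context tensor_h1
begin

lemma L2_lincomb: "(\<And>m. m < (p::nat) \<Longrightarrow> a m \<in> L2 S) \<Longrightarrow> (\<lambda>t. \<Sum>m<p. c m * a m t) \<in> L2 S"
  by (intro fun_subspace.lincomb[OF L2_subspace])

lemma elementary_tensor_L2:
  assumes "\<And>k. v k \<in> L2 (\<Omega> k)" shows "elementary_tensor v \<in> L2 PD"
  unfolding L2_iff cut_elementary_tensor using assms by (intro elementary_tensor_l2) (simp add: L2_iff)

lemma cut_one_op: "cut S (one_op p a g h) = one_op p (\<lambda>m. cut S (a m)) g h"
  by (simp add: one_op_def cut_def sum_distrib_left mult_ac)

lemma cut_lincomb: "cut S (\<lambda>x. \<Sum>l<(n::nat). c l * f l x) = (\<lambda>x. \<Sum>l<n. c l * cut S (f l) x)"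
  by (simp add: cut_def sum_distrib_left mult_ac)

lemma U_span_H1_U_min:
  assumes "a \<in> U_span \<Omega> j u" "a \<in> L2 (\<Omega> j)" "d \<in> L2 (\<Omega> j)" "has_weak_partial (\<Omega> j) 1 a d"
  shows "a \<in> U_min \<Omega> j u"
  unfolding U_min_def using assms by (intro one.H1_closure_incl) (auto simp: H1_def)

text \<open>Each direction turns an \<open>L\<^sup>2\<close>-error \<open>x\<close> into at most
  \<open>2 * x + \<eta>\<close>, which explains the power of 2. A derivative gets the factor 3 from
  its own direction and 2 from every other one.\<close>

lemma approximation:
  assumes "0 < \<eta>"
  shows "\<exists>s s'. s \<in> algebraic_tensor (\<lambda>j. U_min \<Omega> j u) \<and> s \<in> H1 PD \<and>
    l2_nrm lborel (\<lambda>x. cut PD s x - u0 x) \<le> 2 ^ CARD('d) * \<eta> \<and>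
    (\<forall>k. s' k \<in> L2 PD \<and> has_weak_partial PD (axis k 1) s (s' k) \<and>
      l2_nrm lborel (cut PD (s' k)) \<le> 2 ^ CARD('d) * (3 * l2_nrm lborel (du k)))"
proof -
  have "\<forall>j. \<exists>X. direction_data j \<eta> X" using direction_data_exists[OF assms] by blast
  then obtain X where X: "\<forall>j. direction_data j \<eta> (X j)" by (rule choice[THEN exE])
  define p where "p j = fst (X j)" for j
  define a where "a j = fst (snd (X j))" for j
  define d where "d j = fst (snd (snd (X j)))" for j
  define g where "g j = fst (snd (snd (snd (X j))))" for j
  define \<delta> where "\<delta> j = snd (snd (snd (snd (X j))))" for j
  let ?ca = "\<lambda>j m. cut (\<Omega> j) (a j m)" and ?cd = "\<lambda>j m. cut (\<Omega> j) (d j m)"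
  have data: "direction_data j \<eta> (p j, a j, d j, g j, \<delta> j)" for j
    using X by (simp add: p_def a_def d_def g_def \<delta>_def)
  have \<delta>: "0 < \<delta> j" for j using data[of j] by (simp add: direction_data_def)
  have a: "a j m \<in> U_span \<Omega> j u" "a j m \<in> L2 (\<Omega> j)" and d: "d j m \<in> L2 (\<Omega> j)"
    and ad: "has_weak_partial (\<Omega> j) 1 (a j m) (d j m)" and g: "g j m \<in> l2_fun lborel" if "m < p j" for j m
    using data[of j] that by (auto simp: direction_data_def)
  have ca: "?ca j m \<in> l2_fun lborel" "?cd j m \<in> l2_fun lborel" if "m < p j" for j m
    using a d that by (auto simp: L2_iff)
  have bound: "l2_nrm lborel (one_op (p j) (?ca j) (g j) h) \<le> 2 * l2_nrm lborel h"
    if "h \<in> l2_fun lborel" for h j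
    using data[of j] that by (simp add: direction_data_def)
  have small: "l2_nrm lborel (\<lambda>x. v x - coord_op j (p j) (?ca j) (g j) v x) < \<eta>"
    and dbound: "l2_nrm lborel (coord_op j (p j) (?cd j) (g j) v) \<le> 3 * l2_nrm lborel (du j)"
    if "v \<in> l2_tensors" "l2_nrm lborel (\<lambda>x. v x - u0 x) < \<delta> j" for v j
    using data[of j] that by (auto simp: direction_data_def)

  \<comment> \<open>One tensor sum has to meet the tolerances of all directions at once, and to be
    within \<eta> of \<open>u0\<close> itself.\<close>
  define \<delta>0 where "\<delta>0 = Min (insert \<eta> (range \<delta>))"
  have "0 < \<delta>0" using assms \<delta> by (auto simp: \<delta>0_def)
  then obtain n :: nat and c \<psi> where \<psi>: "\<And>l k. l < n \<Longrightarrow> \<psi> l k \<in> test_functions (\<Omega> k)"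
    and app: "l2_nrm lborel (\<lambda>x. u0 x - (\<Sum>l<n. c l * elementary_tensor (\<psi> l) x)) < \<delta>0"
    by (rule tests_approximation) (rule that)
  have \<psi>l: "\<psi> l k \<in> l2_fun lborel" if "l < n" for l k using \<psi>[OF that] by (rule test_functions_l2)
  define A where "A j = one_op (p j) (?ca j) (g j)" for j
  define Dd where "Dd j = one_op (p j) (?cd j) (g j)" for j
  have Al: "A j h \<in> l2_fun lborel" "Dd j h \<in> l2_fun lborel" for j h
    unfolding A_def Dd_def by (intro one_op_l2 ca; assumption)+
  \<comment> \<open>In \<open>E J\<close> the operators of the directions in \<open>J\<close> have
    been applied. \<open>E' i J\<close> has in addition the coefficients of the derivative in the
    slot \<open>i\<close>; for \<open>J = UNIV - {i}\<close> it is the \<open>i\<close>-th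
    derivative of \<open>E UNIV\<close>.\<close>
  define E where "E J = (\<lambda>x. \<Sum>l<n. c l * elementary_tensor (\<lambda>k. if k \<in> J then A k (\<psi> l k) else \<psi> l k) x)" for J
  define E' where "E' i J = (\<lambda>x. \<Sum>l<n. c l * elementary_tensor
      (\<lambda>k. if k = i then Dd k (\<psi> l k) else if k \<in> J then A k (\<psi> l k) else \<psi> l k) x)" for i J
  have vT: "elementary_tensor v \<in> l2_tensors" if "\<And>k. v k \<in> l2_fun lborel" for v :: "'d \<Rightarrow> real \<Rightarrow> real"
    unfolding algebraic_tensor_def using that by (intro fun_span_incl) auto
  have ET: "E J \<in> l2_tensors" "E' i J \<in> l2_tensors" for i J
    unfolding E_def E'_def by (rule algebraic_tensor_sum; simp add: Al \<psi>l)+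
  have El: "E J \<in> l2_fun lborel" "E' i J \<in> l2_fun lborel" for i J
    using ET l2_tensors_l2 by auto
  have E_step: "E (insert j J) = coord_op j (p j) (?ca j) (g j) (E J)" if "j \<notin> J" for j J
  proof -
    have "coord_op j (p j) (?ca j) (g j) (E J) = (\<lambda>x. \<Sum>l<n. c l * coord_op j (p j) (?ca j) (g j)
        (elementary_tensor (\<lambda>k. if k \<in> J then A k (\<psi> l k) else \<psi> l k)) x)"
      unfolding E_def by (rule coord_op_lincomb[OF g]) (auto intro!: vT Al \<psi>l)
    also have "\<dots> = E (insert j J)"
      unfolding E_def coord_op_elementary A_def[symmetric]
      by (rule tensor_sum_cong) (use that in \<open>auto simp: fun_eq_iff\<close>)
    finally show ?thesis by simp
  qed
  have E'_step: "E' i (insert j J) = coord_op j (p j) (?ca j) (g j) (E' i J)" if "j \<notin> J" "j \<noteq> i" for i j J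
  proof -
    have "coord_op j (p j) (?ca j) (g j) (E' i J) = (\<lambda>x. \<Sum>l<n. c l * coord_op j (p j) (?ca j) (g j)
        (elementary_tensor (\<lambda>k. if k = i then Dd k (\<psi> l k) else if k \<in> J then A k (\<psi> l k) else \<psi> l k)) x)"
      unfolding E'_def by (rule coord_op_lincomb[OF g]) (auto intro!: vT Al \<psi>l)
    also have "\<dots> = E' i (insert j J)"
      unfolding E'_def coord_op_elementary A_def[symmetric]
      by (rule tensor_sum_cong) (use that in \<open>auto simp: fun_eq_iff\<close>)
    finally show ?thesis by simp
  qed
  have E'_0: "E' i {} = coord_op i (p i) (?cd i) (g i) (E {})" for i
  proof -
    have "coord_op i (p i) (?cd i) (g i) (E {}) = (\<lambda>x. \<Sum>l<n. c l * coord_op i (p i) (?cd i) (g i)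
        (elementary_tensor (\<lambda>k. if k \<in> {} then A k (\<psi> l k) else \<psi> l k)) x)"
      unfolding E_def by (rule coord_op_lincomb[OF g]) (auto intro!: vT Al \<psi>l)
    also have "\<dots> = E' i {}"
      unfolding E'_def coord_op_elementary Dd_def[symmetric]
      by (rule tensor_sum_cong) (auto simp: fun_eq_iff)
    finally show ?thesis by simp
  qed
  have E0u: "l2_nrm lborel (\<lambda>x. E {} x - u0 x) < \<delta>0"
    using app l2.nrm_diff_commute[OF u0_l2 El(1)[of "{}"]] by (simp add: E_def)
  then have E0\<delta>: "l2_nrm lborel (\<lambda>x. E {} x - u0 x) < \<delta> j" for j
    by (rule less_le_trans) (unfold \<delta>0_def, rule Min_le, auto)
  have E0\<eta>: "l2_nrm lborel (\<lambda>x. E {} x - u0 x) < \<eta>"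
    by (rule less_le_trans[OF E0u]) (simp add: \<delta>0_def)
  have opbound: "l2_nrm lborel (coord_op j (p j) (?ca j) (g j) w) \<le> 2 * l2_nrm lborel w" if "w \<in> l2_tensors" for w j
    by (intro coord_op_bound ca g that bound) auto
  have E_bound: "l2_nrm lborel (\<lambda>x. E J x - E {} x) \<le> (2 ^ card J - 1) * \<eta>" for J
  proof (induction J rule: finite_induct[OF finite])
    case 1
    then show ?case by (simp add: l2.nrm_zero)
  next
    case (2 j J)
    let ?T = "coord_op j (p j) (?ca j) (g j)"
    have EJ: "(\<lambda>x. E J x - E {} x) \<in> l2_tensors"
      by (intro fun_subspace.diff[OF algebraic_tensor_subspace] ET)
    have Tl: "?T w \<in> l2_fun lborel" if "w \<in> l2_tensors" for w
      by (rule subsetD[OF l2_tensors_l2], rule coord_op_l2_tensors) (use ca g that in auto)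
    note TE = Tl[OF ET(1)[of "{}"]] and TEJ = Tl[OF EJ]
    \<comment> \<open>This splitting makes the estimate \<open>small\<close> necessary only at
      \<open>E {}\<close>, whose distance to \<open>u0\<close> is known; on the rest the bound 2 for
      the operator suffices. The recursion \<open>x \<mapsto> 2 * x + \<eta>\<close> started at 0
      gives \<open>(2 ^ card J - 1) * \<eta>\<close>.\<close>
    have "(\<lambda>x. E (insert j J) x - E {} x) = (\<lambda>x. ?T (\<lambda>x. E J x - E {} x) x - (E {} x - ?T (E {}) x))"
      using E_step[OF 2(2)] coord_op_diff[where p = "p j" and g = "g j" and j = j and a = "?ca j",
          OF _ ET(1)[of J] ET(1)[of "{}"]] g by simp
    then have "l2_nrm lborel (\<lambda>x. E (insert j J) x - E {} x)
        \<le> l2_nrm lborel (?T (\<lambda>x. E J x - E {} x)) + l2_nrm lborel (\<lambda>x. E {} x - ?T (E {}) x)"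
      using l2.triangle_diff[OF TEJ l2.diff[OF El(1) TE]] by simp
    also have "\<dots> \<le> 2 * l2_nrm lborel (\<lambda>x. E J x - E {} x) + \<eta>"
      using opbound[OF EJ, of j] small[OF ET(1) E0\<delta>, of j] by simp
    also have "\<dots> \<le> 2 * ((2 ^ card J - 1) * \<eta>) + \<eta>" using 2(3) by simp
    finally show ?case using 2(1,2) by (simp add: algebra_simps)
  qed
  \<comment> \<open>As the operators commute, the one with derivative coefficients may be applied
    before the others, to \<open>E {}\<close>, where \<open>dbound\<close> is available. Each of the
    others at most doubles the norm.\<close>
  have E'_bound: "i \<notin> J \<longrightarrow> l2_nrm lborel (E' i J) \<le> 2 ^ card J * (3 * l2_nrm lborel (du i))" for i J
  proof (induction J rule: finite_induct[OF finite])
    case 1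
    then show ?case unfolding E'_0 using dbound[OF ET(1) E0\<delta>] by simp
  next
    case (2 j J)
    show ?case
    proof
      assume i: "i \<notin> insert j J"
      have "l2_nrm lborel (E' i (insert j J)) \<le> 2 * l2_nrm lborel (E' i J)"
        using i by (subst E'_step[OF 2(2)]) (auto intro!: opbound ET)
      also have "\<dots> \<le> 2 * (2 ^ card J * (3 * l2_nrm lborel (du i)))" using 2(3) i by simp
      finally show "l2_nrm lborel (E' i (insert j J)) \<le> 2 ^ card (insert j J) * (3 * l2_nrm lborel (du i))"
        using 2(1,2) by simp
    qed
  qed

  \<comment> \<open>The same operators with the functions \<open>a j\<close> and \<open>d j\<close>
    before extension by zero, because it is the former that lie in \<open>U_span\<close>. Cutting
    recovers \<open>A\<close> and \<open>Dd\<close>.\<close>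
  define AU where "AU j = one_op (p j) (a j) (g j)" for j
  define DU where "DU j = one_op (p j) (d j) (g j)" for j
  have AU_L2: "AU j h \<in> L2 (\<Omega> j)" "DU j h \<in> L2 (\<Omega> j)" for j h
    unfolding AU_def DU_def one_op_def by (intro L2_lincomb a d; assumption)+
  have AU_weak: "has_weak_partial (\<Omega> j) 1 (AU j h) (DU j h)" for j h
    unfolding AU_def DU_def one_op_def by (intro has_weak_partial_lincomb a d ad) auto
  have AU_U: "AU j h \<in> U_min \<Omega> j u" for j h
  proof (rule U_span_H1_U_min[OF _ AU_L2 AU_weak])
    show "AU j h \<in> U_span \<Omega> j u"
      unfolding AU_def one_op_def U_span_def
      by (intro fun_subspace.lincomb[OF fun_span_subspace] a(1)[unfolded U_span_def])
  qed
  have cutA: "cut (\<Omega> j) (AU j h) = A j h" "cut (\<Omega> j) (DU j h) = Dd j h" for j h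
    by (simp_all add: AU_def DU_def A_def Dd_def cut_one_op)
  define s where "s = (\<lambda>x. \<Sum>l<n. c l * elementary_tensor (\<lambda>k. AU k (\<psi> l k)) x)"
  define s' where "s' i = (\<lambda>x. \<Sum>l<n. c l * elementary_tensor ((\<lambda>k. AU k (\<psi> l k))(i := DU i (\<psi> l i))) x)" for i
  have etL: "elementary_tensor (\<lambda>k. AU k (\<psi> l k)) \<in> L2 PD"
    "elementary_tensor ((\<lambda>k. AU k (\<psi> l k))(i := DU i (\<psi> l i))) \<in> L2 PD" for l i
    by (rule elementary_tensor_L2; simp add: AU_L2)+
  have sL: "s \<in> L2 PD" "s' i \<in> L2 PD" for i
    unfolding s_def s'_def by (intro L2_lincomb etL)+
  have sw: "has_weak_partial PD (axis i 1) s (s' i)" for i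
    unfolding s_def s'_def
    by (intro has_weak_partial_lincomb etL elementary_tensor_weak_partial AU_L2 AU_weak)
      (simp add: axis_in_Basis_iff)
  have cs: "cut PD s = E UNIV" unfolding s_def E_def cut_lincomb cut_elementary_tensor cutA by simp
  have cs': "cut PD (s' i) = E' i (UNIV - {i})" for i
    unfolding s'_def E'_def cut_lincomb cut_elementary_tensor
    by (rule tensor_sum_cong) (auto simp: fun_eq_iff cutA)
  have "s \<in> algebraic_tensor (\<lambda>j. U_min \<Omega> j u)"
    unfolding s_def by (rule algebraic_tensor_sum) (rule AU_U)
  moreover have "s \<in> H1 PD"
    using sL sw unfolding H1_def by (auto simp: Basis_vec_def)
  moreover have "l2_nrm lborel (\<lambda>x. cut PD s x - u0 x) \<le> 2 ^ CARD('d) * \<eta>"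
  proof -
    have "l2_nrm lborel (\<lambda>x. E UNIV x - u0 x) \<le> l2_nrm lborel (\<lambda>x. E UNIV x - E {} x) + l2_nrm lborel (\<lambda>x. E {} x - u0 x)"
      using l2.triangle[OF l2.diff[OF El(1) El(1)] l2.diff[OF El(1) u0_l2], of UNIV "{}" "{}"] by simp
    also have "\<dots> \<le> (2 ^ CARD('d) - 1) * \<eta> + \<eta>" using E_bound[of UNIV] E0\<eta> by simp
    finally show ?thesis by (simp add: cs algebra_simps)
  qed
  moreover have "l2_nrm lborel (cut PD (s' i)) \<le> 2 ^ CARD('d) * (3 * l2_nrm lborel (du i))" for i
  proof -
    have "l2_nrm lborel (cut PD (s' i)) \<le> 2 ^ card (UNIV - {i}) * (3 * l2_nrm lborel (du i))"
      using E'_bound[of i "UNIV - {i}"] by (simp add: cs')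
    also have "\<dots> \<le> 2 ^ CARD('d) * (3 * l2_nrm lborel (du i))"
      using l2.nrm_nonneg[OF du_l2[of i]] by (intro mult_right_mono power_increasing card_mono) auto
    finally show ?thesis .
  qed
  ultimately show ?thesis using sL sw by (intro exI[of _ s] exI[of _ s']) auto
qed

section \<open>Passage to the weak limit\<close>

theorem in_closure: "u \<in> H1_closure PD (algebraic_tensor (\<lambda>j. U_min \<Omega> j u))"
proof -
  let ?T = "algebraic_tensor (\<lambda>j. U_min \<Omega> j u) \<inter> H1 PD"
  interpret H: psd_space "H1 PD" "H1_inner PD" by (rule dom.H1_psd)
  interpret S: fun_subspace "algebraic_tensor (\<lambda>j. U_min \<Omega> j u)" by (rule algebraic_tensor_subspace)
  define N where "N = (2::real) ^ CARD('d)"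
  have N: "0 < N" by (simp add: N_def)
  \<comment> \<open>Chosen so that the \<open>L\<^sup>2\<close>-error \<open>N * \<eta> n\<close> is
    \<open>1 / (n + 1)\<close>.\<close>
  define \<eta> where "\<eta> n = 1 / (N * (real n + 1))" for n
  have \<eta>: "0 < \<eta> n" for n using N by (simp add: \<eta>_def)
  have "\<forall>n. \<exists>s. (\<exists>s'. s \<in> algebraic_tensor (\<lambda>j. U_min \<Omega> j u) \<and> s \<in> H1 PD \<and>
    l2_nrm lborel (\<lambda>x. cut PD s x - u0 x) \<le> 2 ^ CARD('d) * \<eta> n \<and>
    (\<forall>k. s' k \<in> L2 PD \<and> has_weak_partial PD (axis k 1) s (s' k) \<and>
      l2_nrm lborel (cut PD (s' k)) \<le> 2 ^ CARD('d) * (3 * l2_nrm lborel (du k))))"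
    using approximation[OF \<eta>] by blast
  then obtain s where s0: "\<forall>n. \<exists>s'. s n \<in> algebraic_tensor (\<lambda>j. U_min \<Omega> j u) \<and> s n \<in> H1 PD \<and>
    l2_nrm lborel (\<lambda>x. cut PD (s n) x - u0 x) \<le> 2 ^ CARD('d) * \<eta> n \<and>
    (\<forall>k. s' k \<in> L2 PD \<and> has_weak_partial PD (axis k 1) (s n) (s' k) \<and>
      l2_nrm lborel (cut PD (s' k)) \<le> 2 ^ CARD('d) * (3 * l2_nrm lborel (du k)))"
    by (rule choice[THEN exE])
  then obtain s' where s1: "\<forall>n. s n \<in> algebraic_tensor (\<lambda>j. U_min \<Omega> j u) \<and> s n \<in> H1 PD \<and>
    l2_nrm lborel (\<lambda>x. cut PD (s n) x - u0 x) \<le> 2 ^ CARD('d) * \<eta> n \<and>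
    (\<forall>k. s' n k \<in> L2 PD \<and> has_weak_partial PD (axis k 1) (s n) (s' n k) \<and>
      l2_nrm lborel (cut PD (s' n k)) \<le> 2 ^ CARD('d) * (3 * l2_nrm lborel (du k)))"
    by (rule choice[THEN exE])
  have sT: "s n \<in> ?T" and sH: "s n \<in> H1 PD" for n using s1 by auto
  have s'L: "s' n k \<in> L2 PD" "has_weak_partial PD (axis k 1) (s n) (s' n k)"
    and s'b: "l2_nrm lborel (cut PD (s' n k)) \<le> N * (3 * l2_nrm lborel (du k))" for n k
    using s1 by (auto simp: N_def)
  have sb: "l2_nrm lborel (\<lambda>x. cut PD (s n) x - u0 x) \<le> 1 / (real n + 1)" for n
    using s1 N by (simp add: \<eta>_def N_def[symmetric])
  define e where "e n = (\<lambda>x. cut PD (s n) x - u0 x)" for n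
  define e' where "e' n k = (\<lambda>x. cut PD (s' n k) x - du k x)" for n k
  have el: "e n \<in> l2_fun lborel" "e' n k \<in> l2_fun lborel" for n k
    unfolding e_def e'_def using H1_L2[OF sH[of n]] s'L(1)[of n k]
    by (auto intro!: l2.diff u0_l2 du_l2 simp: L2_iff)
  have e0: "(\<lambda>n. l2_nrm lborel (e n)) \<longlonglongrightarrow> 0"
  proof (rule tendsto_sandwich[OF _ _ tendsto_const])
    show "(\<lambda>n. 1 / (real n + 1)) \<longlonglongrightarrow> 0"
      using LIMSEQ_inverse_real_of_nat by (simp add: inverse_eq_divide add.commute)
  qed (auto simp: e_def sb intro!: always_eventually l2.nrm_nonneg el[unfolded e_def])
  have e'b: "l2_nrm lborel (e' n k) \<le> (3 * N + 1) * l2_nrm lborel (du k)" for n k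
  proof -
    have "l2_nrm lborel (e' n k) \<le> l2_nrm lborel (cut PD (s' n k)) + l2_nrm lborel (du k)"
      unfolding e'_def using s'L(1)[of n k] by (intro l2.triangle_diff du_l2) (simp add: L2_iff)
    then show ?thesis using s'b[of n k] by (simp add: algebra_simps)
  qed
  have null: "(\<lambda>n. l2_ip lborel z (e n)) \<longlonglongrightarrow> 0" if "z \<in> l2_fun lborel" for z
  proof (rule tendsto_rabs_zero_cancel, rule tendsto_sandwich[OF _ _ tendsto_const])
    show "\<forall>\<^sub>F n in sequentially. \<bar>l2_ip lborel z (e n)\<bar> \<le> l2_nrm lborel z * l2_nrm lborel (e n)"
      by (intro always_eventually allI l2.Cauchy_Schwarz that el)
    show "(\<lambda>n. l2_nrm lborel z * l2_nrm lborel (e n)) \<longlonglongrightarrow> 0" using tendsto_mult_right_zero[OF e0] .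
  qed auto
  have du_cut: "weak_partial PD (axis k 1) u \<in> L2 PD" "has_weak_partial PD (axis k 1) u (weak_partial PD (axis k 1) u)"
    "cut PD (weak_partial PD (axis k 1) u) = du k" for k
    using weak_partial[OF u, of "axis k 1"] by (auto simp: du_def axis_in_Basis_iff)
  \<comment> \<open>Integration by parts moves the derivative to the test function, after which the
    convergence of \<open>e n\<close> in \<open>L\<^sup>2\<close> is enough.\<close>
  have e'_test: "l2_ip lborel \<phi> (e' n k) = - l2_ip lborel (partial (axis k 1) \<phi>) (e n)"
    if \<phi>: "\<phi> \<in> test_functions PD" for \<phi> n k
  proof -
    have pl: "\<phi> \<in> l2_fun lborel" "partial (axis k 1) \<phi> \<in> l2_fun lborel"
      using \<phi> test_functions_partial[OF \<phi>, of "axis k 1"] test_functions_l2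
      by (auto simp: axis_in_Basis_iff)
    have cl: "cut PD (s n) \<in> l2_fun lborel" "cut PD (s' n k) \<in> l2_fun lborel"
      using H1_L2[OF sH[of n]] s'L(1)[of n k] by (auto simp: L2_iff)
    have 1: "l2_ip lborel (cut PD (s n)) (partial (axis k 1) \<phi>) = - l2_ip lborel (cut PD (s' n k)) \<phi>"
      using s'L(2)[of k n] \<phi> by (simp add: has_weak_partial_iff)
    have "l2_ip lborel \<phi> (e' n k) = l2_ip lborel (cut PD (s' n k)) \<phi> - l2_ip lborel (du k) \<phi>"
      unfolding e'_def using pl cl du_l2[of k] by (simp add: l2.ip_diff_right l2.ip_sym)
    also have "\<dots> = - (l2_ip lborel (cut PD (s n)) (partial (axis k 1) \<phi>) - l2_ip lborel u0 (partial (axis k 1) \<phi>))"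
      using 1 du_weak[OF \<phi>, of k] by simp
    also have "\<dots> = - l2_ip lborel (partial (axis k 1) \<phi>) (e n)"
      unfolding e_def using pl cl u0_l2 by (simp add: l2.ip_diff_right l2.ip_sym)
    finally show ?thesis .
  qed
  let ?tests = "fun_span (tensor_tests (\<lambda>b :: real ^ 'd. \<Omega> (axis_index b)))"
  \<comment> \<open>The differences of the derivatives are bounded, tend to zero against test
    functions, and these are dense.\<close>
  have null': "(\<lambda>n. l2_ip lborel (cut PD z) (e' n k)) \<longlonglongrightarrow> 0" if z: "cut PD z \<in> l2_fun lborel" for z k
  proof (rule l2.weak_null_nclosure[OF tensor_tests_l2 _ el(2) e'b])
    show "cut PD z \<in> l2.nclosure lborel ?tests"
      using z by (intro tensor_tests_dense) (auto simp: open_\<Omega> product_domain_coord cut_outside)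
    fix q assume "q \<in> ?tests"
    then obtain r :: nat and c f where f: "\<forall>i<r. f i \<in> tensor_tests (\<lambda>b :: real ^ 'd. \<Omega> (axis_index b))"
      and q: "q = (\<lambda>x. \<Sum>i<r. c i * f i x)"
      unfolding fun_span_def by blast
    have ft: "f i \<in> test_functions PD" if "i < r" for i
      using f that tensor_tests_subset unfolding product_domain_coord by blast
    have "l2_ip lborel q (e' n k) = (\<Sum>i<r. c i * (- l2_ip lborel (partial (axis k 1) (f i)) (e n)))" for n
      unfolding q using ft by (subst l2.ip_lincomb) (auto intro: test_functions_l2 simp: el e'_test)
    moreover have "(\<lambda>n. \<Sum>i<r. c i * (- l2_ip lborel (partial (axis k 1) (f i)) (e n))) \<longlonglongrightarrow> (\<Sum>i<r. c i * (- 0))"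
      using ft by (intro tendsto_sum tendsto_mult tendsto_minus tendsto_const null test_functions_l2[OF test_functions_partial])
        (auto simp: axis_in_Basis_iff)
    ultimately show "(\<lambda>n. l2_ip lborel q (e' n k)) \<longlonglongrightarrow> 0" by simp
  qed
  have diffH: "(\<lambda>x. s n x - u x) \<in> H1 PD" for n by (rule H.diff[OF sH u])
  define w' where "w' n b = (\<lambda>x. s' n (axis_index b) x + (- 1) * weak_partial PD b u x)" for n and b :: "real ^ 'd"
  have ax: "axis_index (axis k (1::real)) = k" for k :: 'd
    using axis_index[of "axis k (1::real)"] by (auto simp: axis_in_Basis_iff axis_eq_axis)
  have w': "w' n b \<in> L2 PD \<and> has_weak_partial PD b (\<lambda>x. s n x - u x) (w' n b)" if "b \<in> Basis" for n b
  proof -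
    obtain k where b: "b = axis k 1" using axis_index[OF \<open>b \<in> Basis\<close>] by blast
    have 1: "(\<lambda>x. (- 1) * u x) \<in> L2 PD" "(\<lambda>x. (- 1) * weak_partial PD b u x) \<in> L2 PD"
      by (intro fun_subspace.scale[OF L2_subspace] H1_L2 u weak_partial(1) that)+
    have "has_weak_partial PD b (\<lambda>x. (- 1) * u x) (\<lambda>x. (- 1) * weak_partial PD b u x)"
      by (intro has_weak_partial_scale H1_L2 u weak_partial that)
    then have "has_weak_partial PD b (\<lambda>x. s n x + (- 1) * u x) (w' n b)"
      unfolding w'_def using s'L[where n = n and k = k] 1 that by (intro has_weak_partial_add H1_L2[OF sH]) (auto simp: b ax)
    moreover have "w' n b \<in> L2 PD"
      unfolding w'_def using s'L(1) 1 by (intro fun_subspace.add[OF L2_subspace])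
    ultimately show ?thesis by simp
  qed
  have cw': "cut PD (w' n b) = e' n (axis_index b)" if "b \<in> Basis" for n b
  proof -
    obtain k where b: "b = axis k 1" using axis_index[OF \<open>b \<in> Basis\<close>] by blast
    show ?thesis unfolding w'_def e'_def b ax du_def cut_add cut_scale by simp
  qed
  have cdiff: "cut PD (\<lambda>x. s n x - u x) = e n" for n by (simp add: cut_diff e_def u0_def)
  \<comment> \<open>The summand 1 covers the \<open>L\<^sup>2\<close>-part, whose norm is at most
    \<open>1 / (n + 1)\<close>; the others are the bounds \<open>e'b\<close> for the
    derivatives.\<close>
  define M where "M = sqrt (1 + (\<Sum>b\<in>(Basis :: (real ^ 'd) set). ((3 * N + 1) * l2_nrm lborel (du (axis_index b)))\<^sup>2))"
  have bounded: "H.nrm (\<lambda>x. s n x - u x) \<le> M" for n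
  proof -
    have "H1_inner PD (\<lambda>x. s n x - u x) (\<lambda>x. s n x - u x)
        = l2_ip lborel (e n) (e n) + (\<Sum>b\<in>(Basis :: (real ^ 'd) set). l2_ip lborel (e' n (axis_index b)) (e' n (axis_index b)))"
      using dom.H1_inner_eq[OF diffH w' diffH w', of n n] by (simp add: cdiff cw')
    also have "\<dots> = (l2_nrm lborel (e n))\<^sup>2 + (\<Sum>b\<in>(Basis :: (real ^ 'd) set). (l2_nrm lborel (e' n (axis_index b)))\<^sup>2)"
      by (simp add: l2.nrm_sq el)
    also have "\<dots> \<le> 1 + (\<Sum>b\<in>(Basis :: (real ^ 'd) set). ((3 * N + 1) * l2_nrm lborel (du (axis_index b)))\<^sup>2)"
    proof (intro add_mono sum_mono power_mono e'b l2.nrm_nonneg el)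
      have "l2_nrm lborel (e n) \<le> 1" using order_trans[OF sb[of n], of 1] by (simp add: e_def)
      then show "(l2_nrm lborel (e n))\<^sup>2 \<le> 1" by (intro power_le_one l2.nrm_nonneg el)
    qed
    finally show ?thesis by (simp add: ip_norm_def M_def)
  qed
  have weak: "(\<lambda>n. H1_inner PD z (\<lambda>x. s n x - u x)) \<longlonglongrightarrow> 0" if z: "z \<in> H1 PD" for z
  proof -
    have wz: "weak_partial PD b z \<in> L2 PD \<and> has_weak_partial PD b z (weak_partial PD b z)" if "b \<in> Basis" for b
      using weak_partial[OF z that] by simp
    have "H1_inner PD z (\<lambda>x. s n x - u x) = l2_ip lborel (cut PD z) (e n)
        + (\<Sum>b\<in>(Basis :: (real ^ 'd) set). l2_ip lborel (cut PD (weak_partial PD b z)) (e' n (axis_index b)))" for n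
      using dom.H1_inner_eq[OF z wz diffH w', of n] by (simp add: cdiff cw')
    moreover have "(\<lambda>n. l2_ip lborel (cut PD z) (e n)
        + (\<Sum>b\<in>(Basis :: (real ^ 'd) set). l2_ip lborel (cut PD (weak_partial PD b z)) (e' n (axis_index b)))) \<longlonglongrightarrow> 0 + (\<Sum>b\<in>(Basis :: (real ^ 'd) set). 0)"
      using H1_L2[OF z] wz by (intro tendsto_add tendsto_sum null null') (auto simp: L2_iff)
    ultimately show ?thesis by simp
  qed
  have Tsub: "fun_subspace ?T"
    by unfold_locales (auto intro: H.zero H.add H.scale S.zero S.add S.scale)
  have "\<exists>t\<in>?T. H.nrm (\<lambda>x. u x - t x) < r" if "0 < r" for r
    by (rule H.weak_limit_in_closure[OF u Tsub _ bounded sT weak that]) auto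
  then show ?thesis
    using u by (auto simp: H1_closure_def dom.H1_norm_eq)
qed

end

theorem proposition3p7:
  fixes \<Omega> :: "'d::finite \<Rightarrow> real set"
    and u :: "real ^ 'd \<Rightarrow> real"
    and P :: "'d \<Rightarrow> (real \<Rightarrow> real) \<Rightarrow> real \<Rightarrow> real"
  assumes domain: "\<And>j. open (\<Omega> j) \<and> is_interval (\<Omega> j) \<and> \<Omega> j \<noteq> {}"
    and u: "u \<in> H1 (product_domain \<Omega>)"
    and proj: "\<And>j. H1_orthogonal_projection (\<Omega> j) (U_min \<Omega> j u) (P j)"
    and L2_continuous:
      "\<And>j. (SUP v \<in> {v \<in> H1 (\<Omega> j). \<not> (AE t\<in>\<Omega> j in lborel. v t = 0)}.
              ereal (L2_norm (\<Omega> j) (P j v) / L2_norm (\<Omega> j) v)) < \<infinity>"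
  shows "u \<in> H1_closure (product_domain \<Omega>) (algebraic_tensor (\<lambda>j. U_min \<Omega> j u))"
proof -
  interpret tensor_h1 \<Omega> u
    using domain u by unfold_locales auto
  show ?thesis by (rule in_closure)
qed

end
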